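(* Let $\varphi \in C(\Gamma)$. Then $T\varphi \in H^1(\Omega)$ if and only if there exists a $\Phi \in C(\overline\Omega) \cap H^1(\Omega)$ such that $\Phi|_\Gamma = \varphi$.
   Context: Setting: $d \ge 2$, $\Omega \subset \mathbb R^d$ is open and bounded with boundary $\Gamma = \partial\Omega$; functions are complex-valued unless said otherwise. For $k,l \in \{1,\ldots,d\}$, $a_{kl} \colon \Omega \to \mathbb R$ is bounded and measurable, and there is $\mu \in (0,1]$ with $\mathrm{Re} \sum_{k,l=1}^d a_{kl}(x)\,\xi_k\,\overline{\xi_l} \ge \mu|\xi|^2$ for all $x \in \Omega$, $\xi \in \mathbb C^d$. Further $b_k, c_0 \colon \Omega \to \mathbb C$ and $c_k \colon \Omega \to \mathbb R$ ($k=1,\ldots,d$) are bounded and measurable. $\mathcal D'(\Omega)$ is the antidual of $\mathcal D(\Omega) = C_c^\infty(\Omega)$. Define $\mathcal A \colon H^1_{\mathrm{loc}}(\Omega) \to \mathcal D'(\Omega)$ by $$\langle \mathcal A u, v\rangle = \sum_{k,l=1}^d \int_\Omega a_{kl}(\partial_l u)\overline{\partial_k v} + \sum_{k=1}^d \int_\Omega b_k u\,\overline{\partial_k v} + \sum_{k=1}^d \int_\Omega c_k(\partial_k u)\overline v + \int_\Omega c_0 u \overline v$$ for $v \in C_c^\infty(\Omega)$. A function $u$ is called $\mathcal A$-harmonic if $u \in H^1_{\mathrm{loc}}(\Omega)$ and $\mathcal A u = 0$. Standing assumption: $0$ is not a Dirichlet eigenvalue, i.e. if $u \in H^1_0(\Omega)$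 and $\mathcal A u = 0$, then $u = 0$. Perron solution operator: $T \colon C(\Gamma) \to C_b(\Omega)$ is the unique bounded linear map (supremum norms; $C_b(\Omega)$ is the space of bounded continuous functions) such that $T\varphi$ is $\mathcal A$-harmonic for all $\varphi \in C(\Gamma)$ and $\Phi|_\Omega - T(\Phi|_\Gamma) \in H^1_0(\Omega)$ for all $\Phi \in C(\overline\Omega)\cap H^1(\Omega)$. Such a map exists and is unique. *)

theory Defs
  imports "HOL-Analysis.Analysis"
begin

text \<open>
  Functions on a subset of \<open>real^'n\<close> are represented by total functions of which only the values on
  that subset matter; Lebesgue classes are represented by their members, so that equality of
  classes is equality almost everywhere.
\<close>

definition partial :: "'n::finite \<Rightarrow> (real^'n \<Rightarrow> complex) \<Rightarrow> real^'n \<Rightarrow> complex" where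
  "partial k f x = frechet_derivative f (at x) (axis k 1)"

primrec continuously_differentiable :: "nat \<Rightarrow> (real^'n::finite \<Rightarrow> complex) \<Rightarrow> bool" where
  "continuously_differentiable 0 f \<longleftrightarrow> continuous_on UNIV f"
| "continuously_differentiable (Suc m) f \<longleftrightarrow>
     (\<forall>x. f differentiable (at x)) \<and> (\<forall>k. continuously_differentiable m (partial k f))"

text \<open>\<open>C\<^sub>c\<^sup>\<infinity>(\<Omega>)\<close>, each function being extended by zero to the whole space.\<close>

definition test_functions :: "(real^'n::finite) set \<Rightarrow> (real^'n \<Rightarrow> complex) set" where
  "test_functions \<Omega> =
     {v. (\<forall>m. continuously_differentiable m v) \<and>
         compact (closure {x. v x \<noteq> 0}) \<and> closure {x. v x \<noteq> 0} \<subseteq> \<Omega>}"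

definition locally_integrable :: "(real^'n::finite) set \<Rightarrow> (real^'n \<Rightarrow> complex) \<Rightarrow> bool" where
  "locally_integrable \<Omega> f \<longleftrightarrow> (\<forall>K. compact K \<and> K \<subseteq> \<Omega> \<longrightarrow> integrable (lebesgue_on K) f)"

definition L2 :: "(real^'n::finite) set \<Rightarrow> (real^'n \<Rightarrow> complex) set" where
  "L2 \<Omega> = {u. u \<in> borel_measurable (lebesgue_on \<Omega>) \<and>
              integrable (lebesgue_on \<Omega>) (\<lambda>x. (cmod (u x))\<^sup>2)}"

definition L2_loc :: "(real^'n::finite) set \<Rightarrow> (real^'n \<Rightarrow> complex) set" where
  "L2_loc \<Omega> = {u. \<forall>K. compact K \<and> K \<subseteq> \<Omega> \<longrightarrow> u \<in> L2 K}"

definition is_weak_partial ::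
  "(real^'n::finite) set \<Rightarrow> 'n \<Rightarrow> (real^'n \<Rightarrow> complex) \<Rightarrow> (real^'n \<Rightarrow> complex) \<Rightarrow> bool" where
  "is_weak_partial \<Omega> k u g \<longleftrightarrow>
     locally_integrable \<Omega> u \<and> locally_integrable \<Omega> g \<and>
     (\<forall>v\<in>test_functions \<Omega>.
        (LINT x|lebesgue_on \<Omega>. u x * partial k v x) = - (LINT x|lebesgue_on \<Omega>. g x * v x))"

text \<open>On an open set weak derivatives are unique up to null sets; this chooses a representative.\<close>

definition weak_partial ::
  "(real^'n::finite) set \<Rightarrow> 'n \<Rightarrow> (real^'n \<Rightarrow> complex) \<Rightarrow> real^'n \<Rightarrow> complex" where
  "weak_partial \<Omega> k u = (SOME g. is_weak_partial \<Omega> k u g)"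

definition H1 :: "(real^'n::finite) set \<Rightarrow> (real^'n \<Rightarrow> complex) set" where
  "H1 \<Omega> = {u \<in> L2 \<Omega>. \<forall>k. \<exists>g\<in>L2 \<Omega>. is_weak_partial \<Omega> k u g}"

definition H1_loc :: "(real^'n::finite) set \<Rightarrow> (real^'n \<Rightarrow> complex) set" where
  "H1_loc \<Omega> = {u \<in> L2_loc \<Omega>. \<forall>k. \<exists>g\<in>L2_loc \<Omega>. is_weak_partial \<Omega> k u g}"

definition H1_norm :: "(real^'n::finite) set \<Rightarrow> (real^'n \<Rightarrow> complex) \<Rightarrow> real" where
  "H1_norm \<Omega> u =
     sqrt ((LINT x|lebesgue_on \<Omega>. (cmod (u x))\<^sup>2) +
           (\<Sum>k\<in>UNIV. LINT x|lebesgue_on \<Omega>. (cmod (weak_partial \<Omega> k u x))\<^sup>2))"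

text \<open>The closure of \<open>C\<^sub>c\<^sup>\<infinity>(\<Omega>)\<close> in \<open>H\<^sup>1(\<Omega>)\<close>.\<close>

definition H1_0 :: "(real^'n::finite) set \<Rightarrow> (real^'n \<Rightarrow> complex) set" where
  "H1_0 \<Omega> = {u \<in> H1 \<Omega>. \<forall>\<epsilon>>0. \<exists>v\<in>test_functions \<Omega>. H1_norm \<Omega> (\<lambda>x. u x - v x) < \<epsilon>}"

text \<open>
  \<open>elliptic_op \<Omega> a b c c0 u v\<close> is \<open>\<langle>\<A>u, v\<rangle>\<close>. It is meaningful only for \<open>u \<in> H1_loc \<Omega>\<close> and
  \<open>v \<in> test_functions \<Omega>\<close>, when all the integrals converge.
\<close>

definition elliptic_op ::
  "(real^'n::finite) set \<Rightarrow> ('n \<Rightarrow> 'n \<Rightarrow> real^'n \<Rightarrow> real) \<Rightarrow> ('n \<Rightarrow> real^'n \<Rightarrow> complex) \<Rightarrow>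
   ('n \<Rightarrow> real^'n \<Rightarrow> real) \<Rightarrow> (real^'n \<Rightarrow> complex) \<Rightarrow>
   (real^'n \<Rightarrow> complex) \<Rightarrow> (real^'n \<Rightarrow> complex) \<Rightarrow> complex" where
  "elliptic_op \<Omega> a b c c0 u v =
     (\<Sum>k\<in>UNIV. \<Sum>l\<in>UNIV.
        LINT x|lebesgue_on \<Omega>. of_real (a k l x) * weak_partial \<Omega> l u x * cnj (partial k v x)) +
     (\<Sum>k\<in>UNIV. LINT x|lebesgue_on \<Omega>. b k x * u x * cnj (partial k v x)) +
     (\<Sum>k\<in>UNIV. LINT x|lebesgue_on \<Omega>. of_real (c k x) * weak_partial \<Omega> k u x * cnj (v x)) +
     (LINT x|lebesgue_on \<Omega>. c0 x * u x * cnj (v x))"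

definition harmonic ::
  "(real^'n::finite) set \<Rightarrow> ('n \<Rightarrow> 'n \<Rightarrow> real^'n \<Rightarrow> real) \<Rightarrow> ('n \<Rightarrow> real^'n \<Rightarrow> complex) \<Rightarrow>
   ('n \<Rightarrow> real^'n \<Rightarrow> real) \<Rightarrow> (real^'n \<Rightarrow> complex) \<Rightarrow> (real^'n \<Rightarrow> complex) \<Rightarrow> bool" where
  "harmonic \<Omega> a b c c0 u \<longleftrightarrow>
     u \<in> H1_loc \<Omega> \<and> (\<forall>v\<in>test_functions \<Omega>. elliptic_op \<Omega> a b c c0 u v = 0)"

text \<open>
  The properties that characterise the Perron solution operator \<open>C(\<Gamma>) \<rightarrow> C\<^sub>b(\<Omega>)\<close>, where
  \<open>\<Gamma> = frontier \<Omega>\<close>. Linearity and the supremum bound over \<open>\<Gamma>\<close> together force \<open>T \<phi>\<close> on \<open>\<Omega>\<close> to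
  depend only on the values of \<open>\<phi>\<close> on \<open>\<Gamma>\<close>, so \<open>T \<Phi>\<close> in the last clause is \<open>T(\<Phi>|\<^sub>\<Gamma>)\<close>.
\<close>

definition perron_operator ::
  "(real^'n::finite) set \<Rightarrow> ('n \<Rightarrow> 'n \<Rightarrow> real^'n \<Rightarrow> real) \<Rightarrow> ('n \<Rightarrow> real^'n \<Rightarrow> complex) \<Rightarrow>
   ('n \<Rightarrow> real^'n \<Rightarrow> real) \<Rightarrow> (real^'n \<Rightarrow> complex) \<Rightarrow>
   ((real^'n \<Rightarrow> complex) \<Rightarrow> real^'n \<Rightarrow> complex) \<Rightarrow> bool" where
  "perron_operator \<Omega> a b c c0 T \<longleftrightarrow>
     (\<forall>\<phi>. continuous_on (frontier \<Omega>) \<phi> \<longrightarrow> continuous_on \<Omega> (T \<phi>) \<and> bounded (T \<phi> ` \<Omega>)) \<and>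
     (\<forall>\<phi> \<psi>. continuous_on (frontier \<Omega>) \<phi> \<and> continuous_on (frontier \<Omega>) \<psi> \<longrightarrow>
        (\<forall>x\<in>\<Omega>. T (\<lambda>y. \<phi> y + \<psi> y) x = T \<phi> x + T \<psi> x)) \<and>
     (\<forall>\<alpha> \<phi>. continuous_on (frontier \<Omega>) \<phi> \<longrightarrow> (\<forall>x\<in>\<Omega>. T (\<lambda>y. \<alpha> * \<phi> y) x = \<alpha> * T \<phi> x)) \<and>
     (\<exists>C. \<forall>\<phi>. continuous_on (frontier \<Omega>) \<phi> \<longrightarrow>
        (\<forall>x\<in>\<Omega>. cmod (T \<phi> x) \<le> C * (SUP y\<in>frontier \<Omega>. cmod (\<phi> y)))) \<and>
     (\<forall>\<phi>. continuous_on (frontier \<Omega>) \<phi> \<longrightarrow> harmonic \<Omega> a b c c0 (T \<phi>)) \<and>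
     (\<forall>\<Phi>. continuous_on (closure \<Omega>) \<Phi> \<and> \<Phi> \<in> H1 \<Omega> \<longrightarrow> (\<lambda>x. \<Phi> x - T \<Phi> x) \<in> H1_0 \<Omega>)"

end

theory Submission
  imports Defs
begin

text \<open>
  If \<open>\<Phi>\<close> extends \<open>\<phi>\<close>, then \<open>T \<phi> = \<Phi> - (\<Phi> - T \<Phi>)\<close> lies in \<open>H1\<close>. Conversely let \<open>u = T \<phi>\<close> be in \<open>H1\<close>.
  Extend \<open>\<phi>\<close> to a continuous \<open>\<Phi>0\<close>, choose polynomials \<open>P n\<close> with \<open>\<bar>P n - \<Phi>0\<bar> \<le> r\<close> on the closure of \<open>\<Omega>\<close>,
  where \<open>r = (1/2)^n\<close>, and put \<open>z n = P n - T (P n)\<close>. This function belongs to \<open>H1_0\<close>, and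
  \<open>u - P n\<close> differs from \<open>- z n\<close> by at most \<open>C r\<close>. Hence, with a cutoff \<open>F\<close> that is 1 on \<open>{\<bar>t\<bar> \<le> r}\<close> and
  0 on \<open>{\<bar>t\<bar> \<ge> 2 r}\<close>, the function \<open>v n = P n + (u - P n) F(z n)\<close> is in \<open>H1\<close>, continuous on \<open>\<Omega>\<close> and uniformly
  within \<open>(C + 3) r\<close> of \<open>\<Phi>0\<close>. The difference \<open>v (n + 1) - v n\<close> vanishes where both \<open>z n\<close> and \<open>z (n + 1)\<close> are small, so
  multiplying it by cutoffs (0 for large arguments, 1 at 0) of test functions close to \<open>z n\<close> and \<open>z (n + 1)\<close> changes it only on a compact
  set and makes it arbitrarily small in \<open>H1\<close>. Summing the modified differences gives a function in
  \<open>H1\<close> that is asymptotic to \<open>v n\<close>, up to \<open>O(r)\<close>, near the boundary, for every \<open>n\<close>, and thus tends to \<open>\<Phi>0\<close>.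
\<close>

section \<open>Smooth functions and cutoff profiles\<close>

text \<open>The obstacle is that \<open>T \<phi>\<close> need not tend to \<open>\<phi>\<close> at
  every boundary point, so it cannot itself serve as the extension although it lies in
  \<open>H1\<close>. Where it fails, a polynomial takes over; since \<open>z n\<close> lies in
  \<open>H1_0\<close>, the factor \<open>F(z n)\<close> can switch between \<open>u\<close> and
  \<open>P n\<close> inside \<open>H1\<close>. But polynomials approximating a merely continuous
  function have uncontrolled gradients, so no bound on the \<open>H1\<close> norms of the
  \<open>v n\<close> is at hand and their uniform limit may leave \<open>H1\<close>.

  The way out is that changes on compact subsets of \<open>\<Omega>\<close> do not affect boundary
  values. Let D be the difference of two consecutive \<open>v n\<close>, and let G, G' be cutoffs
  with value 1 at 0 such that D G(z) G'(z') = 0 for the two functions z, z' of \<open>H1_0\<close>.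
  For test functions \<psi>, \<psi>' the function D (1 - G(\<psi>) G'(\<psi>')) has compact support,
  and it can be brought close in \<open>H1\<close> to D (1 - G(z) G'(z')) = D. So D behaves like an
  element of \<open>H1_0\<close>, and the remainder D G(\<psi>) G'(\<psi>') is as small in
  \<open>H1\<close> as desired, however large the \<open>H1\<close> norm of D is. Its modulus never
  exceeds that of D, which preserves uniform convergence.\<close>

definition smooth :: "(real^'n::finite \<Rightarrow> complex) \<Rightarrow> bool" where
  "smooth f \<longleftrightarrow> (\<forall>m. continuously_differentiable m f)"

lemma partial_eqI: "(f has_derivative f') (at x) \<Longrightarrow> partial k f x = f' (axis k 1)"
  unfolding partial_def by (metis frechet_derivative_at)

text \<open>The Leibniz rule multiplies derivatives by undifferentiated factors, so the induction
  for products needs the factors at the lower order too.\<close>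

lemma continuously_differentiable_Suc_imp:
  "continuously_differentiable (Suc m) f \<Longrightarrow> continuously_differentiable m f"
proof (induction m arbitrary: f)
  case 0
  then show ?case
    by (auto simp: differentiable_imp_continuous_within continuous_on_eq_continuous_within)
next
  case (Suc m)
  then show ?case by fastforce
qed

lemma smooth_differentiable: "smooth f \<Longrightarrow> f differentiable (at x)"
  unfolding smooth_def by (meson continuously_differentiable.simps(2))

lemma smooth_partial: "smooth f \<Longrightarrow> smooth (partial k f)"
  unfolding smooth_def by (meson continuously_differentiable.simps(2))

lemma smooth_continuous_on: "smooth f \<Longrightarrow> continuous_on S f"
  unfolding smooth_def by (meson continuously_differentiable.simps(1) continuous_on_subset subset_UNIV)

lemma smooth_has_derivative: "smooth f \<Longrightarrow> (f has_derivative frechet_derivative f (at x)) (at x)"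
  using frechet_derivative_works smooth_differentiable by blast

lemma partial_const [simp]: "partial k (\<lambda>x. c) = (\<lambda>x. 0)"
  by (rule ext, rule partial_eqI[THEN trans]) (auto intro!: derivative_eq_intros)

lemma partial_add:
  assumes "f differentiable (at x)" "g differentiable (at x)"
  shows "partial k (\<lambda>x. f x + g x) x = partial k f x + partial k g x"
  using assms unfolding partial_def frechet_derivative_works
  by (subst frechet_derivative_at[symmetric, OF has_derivative_add]) auto

lemma partial_mult:
  assumes "f differentiable (at x)" "g differentiable (at x)"
  shows "partial k (\<lambda>x. f x * g x) x = f x * partial k g x + partial k f x * g x"
  using assms unfolding partial_def frechet_derivative_works
  by (subst frechet_derivative_at[symmetric, OF has_derivative_mult]) auto

lemma partial_cnj:
  assumes "f differentiable (at x)"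
  shows "partial k (\<lambda>x. cnj (f x)) x = cnj (partial k f x)"
  using assms unfolding partial_def frechet_derivative_works
  by (subst frechet_derivative_at[symmetric, OF bounded_linear.has_derivative[OF bounded_linear_cnj]]) auto

text \<open>The profiles are real functions of a real variable, whereas smoothness is defined for
  complex-valued functions only; \<open>Re\<close> inside and \<open>of_real\<close> outside keep
  compositions in that class.\<close>

lemma partial_compose_Re:
  assumes f: "f differentiable (at x)" and h: "(h has_real_derivative d) (at (Re (f x)))"
  shows "partial k (\<lambda>x. of_real (h (Re (f x)))) x = of_real (d * Re (partial k f x))"
    and "(\<lambda>x. complex_of_real (h (Re (f x)))) differentiable (at x)"
proof -
  have "((\<lambda>x. Re (f x)) has_derivative (\<lambda>y. Re (frechet_derivative f (at x) y))) (at x)"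
    using f[unfolded frechet_derivative_works] by (rule bounded_linear.has_derivative[OF bounded_linear_Re])
  from has_derivative_compose[OF this h[unfolded has_field_derivative_def]]
  have D: "((\<lambda>x. complex_of_real (h (Re (f x)))) has_derivative
      (\<lambda>y. of_real (d * Re (frechet_derivative f (at x) y)))) (at x)"
    by (rule bounded_linear.has_derivative[OF bounded_linear_of_real])
  show "partial k (\<lambda>x. of_real (h (Re (f x)))) x = of_real (d * Re (partial k f x))"
    by (subst partial_eqI[OF D]) (simp add: partial_def)
  show "(\<lambda>x. complex_of_real (h (Re (f x)))) differentiable (at x)"
    using D by (rule differentiableI)
qed

section \<open>Closure properties of smooth functions\<close>

lemma continuously_differentiable_const: "continuously_differentiable m (\<lambda>x. c)"
  by (induction m arbitrary: c) auto

lemma continuously_differentiable_add: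
  "continuously_differentiable m f \<Longrightarrow> continuously_differentiable m g \<Longrightarrow>
   continuously_differentiable m (\<lambda>x. f x + g x)"
proof (induction m arbitrary: f g)
  case 0
  then show ?case by (auto intro: continuous_intros)
next
  case (Suc m)
  then have "partial k (\<lambda>x. f x + g x) = (\<lambda>x. partial k f x + partial k g x)" for k
    by (auto simp: partial_add)
  with Suc show ?case by auto
qed

lemma continuously_differentiable_mult:
  "continuously_differentiable m f \<Longrightarrow> continuously_differentiable m g \<Longrightarrow>
   continuously_differentiable m (\<lambda>x. f x * g x)"
proof (induction m arbitrary: f g)
  case 0
  then show ?case by (auto intro: continuous_intros)
next
  case (Suc m)
  then have "partial k (\<lambda>x. f x * g x) = (\<lambda>x. f x * partial k g x + partial k f x * g x)" for k
    by (auto simp: partial_mult)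
  moreover have "continuously_differentiable m f" "continuously_differentiable m g"
    using Suc.prems continuously_differentiable_Suc_imp by blast+
  ultimately show ?case
    using Suc by (auto intro!: continuously_differentiable_add)
qed

lemma continuously_differentiable_cnj:
  "continuously_differentiable m f \<Longrightarrow> continuously_differentiable m (\<lambda>x. cnj (f x))"
proof (induction m arbitrary: f)
  case 0
  then show ?case by (auto intro: continuous_intros)
next
  case (Suc m)
  then have "partial k (\<lambda>x. cnj (f x)) = (\<lambda>x. cnj (partial k f x))" for k
    by (auto simp: partial_cnj)
  moreover have "(\<lambda>x. cnj (f x)) differentiable (at x)" for x
    using Suc.prems bounded_linear.has_derivative[OF bounded_linear_cnj]
    unfolding continuously_differentiable.simps(2) differentiable_def by blast
  ultimately show ?case using Suc by simp
qed

lemma smooth_const [simp]: "smooth (\<lambda>x. c)"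
  by (simp add: smooth_def continuously_differentiable_const)

lemma smooth_add: "smooth f \<Longrightarrow> smooth g \<Longrightarrow> smooth (\<lambda>x. f x + g x)"
  by (simp add: smooth_def continuously_differentiable_add)

lemma smooth_mult: "smooth f \<Longrightarrow> smooth g \<Longrightarrow> smooth (\<lambda>x. f x * g x)"
  by (simp add: smooth_def continuously_differentiable_mult)

lemma smooth_cnj: "smooth f \<Longrightarrow> smooth (\<lambda>x. cnj (f x))"
  by (simp add: smooth_def continuously_differentiable_cnj)

lemma smooth_diff: "smooth f \<Longrightarrow> smooth g \<Longrightarrow> smooth (\<lambda>x. f x - g x)"
  using smooth_add[of f "\<lambda>x. (-1) * g x"] smooth_mult[of "\<lambda>x. -1" g] by simp

lemma smooth_prod: "(\<And>i. i \<in> I \<Longrightarrow> smooth (f i)) \<Longrightarrow> smooth (\<lambda>x. \<Prod>i\<in>I. f i x)"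
  by (induction I rule: infinite_finite_induct) (auto intro: smooth_mult)

lemma smooth_linear:
  assumes "bounded_linear f"
  shows "smooth (\<lambda>x. complex_of_real (f x))"
proof -
  have D: "((\<lambda>x. complex_of_real (f x)) has_derivative (\<lambda>y. of_real (f y))) (at x)" for x
    by (rule bounded_linear_imp_has_derivative) (intro bounded_linear_compose[OF bounded_linear_of_real] assms)
  have "partial k (\<lambda>x. complex_of_real (f x)) = (\<lambda>x. of_real (f (axis k 1)))" for k
    by (rule ext) (rule partial_eqI[OF D])
  moreover have "(\<lambda>x. complex_of_real (f x)) differentiable (at x)" for x
    using D by (rule differentiableI)
  moreover have "continuous_on UNIV (\<lambda>x. complex_of_real (f x))"
    by (intro continuous_intros linear_continuous_on assms)
  ultimately have "continuously_differentiable m (\<lambda>x. complex_of_real (f x))" for m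
    by (cases m) (auto simp: continuously_differentiable_const)
  then show ?thesis by (simp add: smooth_def)
qed

lemma smooth_real_polynomial:
  "real_polynomial_function p \<Longrightarrow> smooth (\<lambda>x. complex_of_real (p x))"
  by (induction p rule: real_polynomial_function.induct)
     (auto intro: smooth_linear smooth_add smooth_mult)

lemma smooth_polynomial:
  fixes p :: "real^'n::finite \<Rightarrow> complex"
  assumes "polynomial_function p"
  shows "smooth p"
proof -
  have "smooth (\<lambda>x. complex_of_real (Re (p x)))" "smooth (\<lambda>x. complex_of_real (Im (p x)))"
    using assms bounded_linear_Re bounded_linear_Im
    by (auto intro!: smooth_real_polynomial simp: polynomial_function_def o_def)
  then have "smooth (\<lambda>x. complex_of_real (Re (p x)) + \<i> * complex_of_real (Im (p x)))"
    by (intro smooth_add smooth_mult) auto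
  then show ?thesis
    by (simp flip: complex_eq)
qed

text \<open>The functions \<open>p(1/s) exp(-1/s)\<close> with a polynomial \<open>p\<close>, continued by zero to \<open>s \<le> 0\<close>, are closed
  under differentiation; hence all of them are smooth.\<close>

definition flat :: "real poly \<Rightarrow> real \<Rightarrow> real" where
  "flat p s = (if s \<le> 0 then 0 else poly p (1/s) * exp (- (1/s)))"

lemma poly_div_exp_tendsto_0: "((\<lambda>y::real. poly p y * exp (- y)) \<longlongrightarrow> 0) at_top"
proof -
  have "((\<lambda>y::real. \<Sum>i\<le>degree p. coeff p i * (y ^ i / exp y)) \<longlongrightarrow> (\<Sum>i\<le>degree p. coeff p i * 0)) at_top"
    by (intro tendsto_intros tendsto_power_div_exp_0)
  then show ?thesis
    by (simp add: poly_altdef sum_divide_distrib exp_minus divide_inverse sum_distrib_right mult.assoc)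
qed

text \<open>For \<open>s > 0\<close> the chain rule gives
  \<open>(1/s)^2 * (p - p')(1/s) * exp (- (1/s))\<close>, which explains the polynomial
  \<open>monom 1 2 * (p - pderiv p)\<close>. Only \<open>s = 0\<close> needs a limit
  argument.\<close>

lemma flat_has_derivative:
  "(flat p has_real_derivative flat (monom 1 2 * (p - pderiv p)) s) (at s)"
proof -
  consider "s < 0" | "s > 0" | "s = 0" by linarith
  then show ?thesis
  proof cases
    case 1
    have "((\<lambda>s. 0) has_real_derivative 0) (at s)" by simp
    then have "(flat p has_real_derivative 0) (at s)"
      by (rule has_field_derivative_transform_within_open[where S="{..<0}"]) (use 1 in \<open>auto simp: flat_def\<close>)
    then show ?thesis using 1 by (simp add: flat_def)
  next
    case 2
    have "((\<lambda>s. poly p (1/s) * exp (- (1/s))) has_real_derivative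
        flat (monom 1 2 * (p - pderiv p)) s) (at s)"
      using 2 by (auto simp: flat_def poly_monom field_simps power2_eq_square
          intro!: derivative_eq_intros)
    then show ?thesis
      by (rule has_field_derivative_transform_within_open[where S="{0<..}"]) (use 2 in \<open>auto simp: flat_def\<close>)
  next
    case 3
    have "((\<lambda>h. flat p h / h) \<longlongrightarrow> 0) (at_right 0)"
    proof -
      \<comment> \<open>With \<open>y = 1/h\<close> the quotient \<open>flat p h / h\<close> is
        \<open>y * p(y) * exp (- y)\<close>; the factor \<open>y\<close> is the
        \<open>monom 1 1\<close>.\<close>
      have "((\<lambda>h. poly (monom 1 1 * p) (inverse h) * exp (- inverse h)) \<longlongrightarrow> 0) (at_right (0::real))"
        by (rule filterlim_compose[OF poly_div_exp_tendsto_0 filterlim_inverse_at_top_right])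
      then show ?thesis
        by (rule Lim_transform_eventually)
           (auto simp: eventually_at_filter flat_def poly_monom field_simps)
    qed
    moreover have "((\<lambda>h. flat p h / h) \<longlongrightarrow> 0) (at_left 0)"
      by (rule Lim_transform_eventually[OF tendsto_const]) (auto simp: eventually_at_filter flat_def)
    ultimately have "((\<lambda>h. flat p h / h) \<longlongrightarrow> 0) (at 0)"
      by (rule filterlim_split_at[rotated])
    then show ?thesis
      using 3 by (simp add: DERIV_def flat_def)
  qed
qed

lemma continuous_on_flat:
  assumes "continuous_on S g"
  shows "continuous_on S (\<lambda>x. flat p (g x))"
proof -
  have "continuous_on UNIV (flat p)"
    using DERIV_isCont[OF flat_has_derivative] continuous_at_imp_continuous_on by blast
  from continuous_on_compose2[OF this assms] show ?thesis by simp
qed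

lemma smooth_flat:
  assumes "smooth g"
  shows "smooth (\<lambda>x. complex_of_real (flat p (Re (g x))))"
proof -
  have "continuously_differentiable m (\<lambda>x. complex_of_real (flat p (Re (g x))))" for m
  proof (induction m arbitrary: p)
    case 0
    show ?case
      using smooth_continuous_on[OF assms] by (auto intro!: continuous_intros continuous_on_flat)
  next
    case (Suc m)
    have g: "g differentiable (at x)" for x using assms by (rule smooth_differentiable)
    let ?q = "monom 1 2 * (p - pderiv p)"
    \<comment> \<open>Writing \<open>Re w\<close> as \<open>(w + cnj w) / 2\<close> expresses the
      derivative by operations that preserve smoothness; the induction hypothesis is used for the
      new polynomial \<open>?q\<close>.\<close>
    have "partial k (\<lambda>x. complex_of_real (flat p (Re (g x)))) =
      (\<lambda>x. complex_of_real (flat ?q (Re (g x))) * ((1/2) * (partial k g x + cnj (partial k g x))))" for k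
      by (rule ext, subst partial_compose_Re[OF g flat_has_derivative])
         (simp add: complex_add_cnj)
    moreover have "smooth (\<lambda>x. (1/2) * (partial k g x + cnj (partial k g x)))" for k
      by (rule smooth_mult[OF smooth_const smooth_add[OF smooth_partial[OF assms] smooth_cnj[OF smooth_partial[OF assms]]]])
    ultimately have "continuously_differentiable m (partial k (\<lambda>x. complex_of_real (flat p (Re (g x)))))" for k
      using continuously_differentiable_mult[OF Suc] unfolding smooth_def by presburger
    then show ?case
      using partial_compose_Re(2)[OF g flat_has_derivative] by simp
  qed
  then show ?thesis by (simp add: smooth_def)
qed

text \<open>Both profiles are 1 at 0; \<open>hat\<close> vanishes on \<open>[1,\<infinity>)\<close>, while \<open>plateau\<close> is still 1 there up to
  the argument 1 and vanishes on \<open>[2,\<infinity>)\<close>, so that \<open>hat * (1 - plateau) = 0\<close>.\<close>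

definition hat :: "real \<Rightarrow> real" where "hat s = exp 1 * flat 1 (1 - s)"

definition plateau :: "real \<Rightarrow> real" where "plateau s = hat (exp 1 * flat 1 (s - 1))"

lemma flat_nonneg: "0 \<le> flat 1 s" by (simp add: flat_def)

text \<open>The factor \<open>exp 1\<close> in \<open>hat\<close> is the reciprocal of
  \<open>flat 1 1\<close>.\<close>

lemma hat_0: "hat 0 = 1" by (simp add: hat_def flat_def flip: exp_add)

lemma hat_ge_1: "s \<ge> 1 \<Longrightarrow> hat s = 0" by (simp add: hat_def flat_def)

lemma hat_nonneg: "0 \<le> hat s" by (simp add: hat_def flat_nonneg)

lemma hat_le_1: "0 \<le> s \<Longrightarrow> hat s \<le> 1"
  by (auto simp: hat_def flat_def field_simps simp flip: exp_add)

lemma plateau_le_1: "s \<le> 1 \<Longrightarrow> plateau s = 1" by (simp add: plateau_def flat_def hat_0)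

text \<open>From 2 on the inner argument is \<open>exp (1 - 1/(s - 1))\<close>, which is at least 1
  and hence lies where \<open>hat\<close> vanishes.\<close>

lemma plateau_ge_2: "s \<ge> 2 \<Longrightarrow> plateau s = 0"
  unfolding plateau_def by (rule hat_ge_1) (auto simp: flat_def field_simps simp flip: exp_add)

lemma plateau_bounds: "0 \<le> plateau s" "plateau s \<le> 1"
  by (auto simp: plateau_def hat_nonneg hat_le_1 flat_nonneg)

text \<open>In existential form because \<open>cutoff_radial\<close> asks for some continuous
  derivative and never for its formula.\<close>

lemma hat_has_derivative:
  "\<exists>h'. continuous_on UNIV h' \<and> (\<forall>s. (hat has_real_derivative h' s) (at s))"
proof (intro exI conjI allI)
  fix s
  have "((\<lambda>s. flat 1 (1 - s)) has_real_derivative flat (monom 1 2 * (1 - pderiv 1)) (1 - s) * (-1)) (at s)"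
    by (rule DERIV_chain2[OF flat_has_derivative]) (auto intro!: derivative_eq_intros)
  then show "(hat has_real_derivative exp 1 * (flat (monom 1 2 * (1 - pderiv 1)) (1 - s) * (-1))) (at s)"
    unfolding hat_def by (rule DERIV_cmult)
  show "continuous_on UNIV (\<lambda>s. exp 1 * (flat (monom 1 2 * (1 - pderiv 1)) (1 - s) * (-1)))"
    by (intro continuous_intros continuous_on_flat)
qed

lemma plateau_has_derivative:
  "\<exists>h'. continuous_on UNIV h' \<and> (\<forall>s. (plateau has_real_derivative h' s) (at s))"
proof -
  obtain h' where h: "continuous_on UNIV h'" "\<And>s. (hat has_real_derivative h' s) (at s)"
    using hat_has_derivative by blast
  have *: "((\<lambda>s. exp 1 * flat 1 (s - 1)) has_real_derivative
      exp 1 * (flat (monom 1 2 * (1 - pderiv 1)) (s - 1) * 1)) (at s)" for s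
    by (rule DERIV_cmult, rule DERIV_chain2[OF flat_has_derivative]) (auto intro!: derivative_eq_intros)
  show ?thesis
  proof (intro exI conjI allI)
    show "(plateau has_real_derivative h' (exp 1 * flat 1 (s - 1)) *
       (exp 1 * (flat (monom 1 2 * (1 - pderiv 1)) (s - 1) * 1))) (at s)" for s
      unfolding plateau_def by (rule DERIV_chain2[OF h(2) *])
    show "continuous_on UNIV (\<lambda>s. h' (exp 1 * flat 1 (s - 1)) *
       (exp 1 * (flat (monom 1 2 * (1 - pderiv 1)) (s - 1) * 1)))"
      by (intro continuous_on_mult continuous_on_compose2[OF h(1)] continuous_on_flat continuous_intros) auto
  qed
qed

lemma smooth_hat: 
  assumes "smooth g" shows "smooth (\<lambda>x. complex_of_real (hat (Re (g x))))"
proof -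
  have "smooth (\<lambda>x. complex_of_real (flat 1 (Re (1 - g x))))"
    by (intro smooth_flat smooth_diff assms smooth_const)
  then have "smooth (\<lambda>x. complex_of_real (exp 1) * complex_of_real (flat 1 (Re (1 - g x))))"
    by (intro smooth_mult smooth_const)
  then show ?thesis by (simp add: hat_def)
qed

lemma smooth_plateau:
  assumes "smooth g" shows "smooth (\<lambda>x. complex_of_real (plateau (Re (g x))))"
proof -
  have "smooth (\<lambda>x. complex_of_real (exp 1) * complex_of_real (flat 1 (Re (g x - 1))))"
    by (rule smooth_mult[OF smooth_const smooth_flat[OF smooth_diff[OF assms smooth_const]]])
  from smooth_hat[OF this] show ?thesis by (simp add: plateau_def)
qed

text \<open>\<open>H\<close> encodes the gradient of \<open>F\<close>: the derivative of \<open>F\<close> at \<open>t\<close> in direction \<open>w\<close> is \<open>Re (H t * w)\<close>.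
  Only the type argument mentions the dimension of the domain of \<open>\<psi>\<close>.\<close>

definition cutoff :: "'n::finite itself \<Rightarrow> (complex \<Rightarrow> real) \<Rightarrow> (complex \<Rightarrow> complex) \<Rightarrow> bool" where
  "cutoff _ F H \<longleftrightarrow> continuous_on UNIV F \<and> continuous_on UNIV H \<and> bounded (range H) \<and>
     (\<forall>t. 0 \<le> F t \<and> F t \<le> 1) \<and>
     (\<forall>\<psi>::real^'n \<Rightarrow> complex. smooth \<psi> \<longrightarrow>
        smooth (\<lambda>x. of_real (F (\<psi> x))) \<and>
        (\<forall>k x. partial k (\<lambda>x. of_real (F (\<psi> x))) x = of_real (Re (H (\<psi> x) * partial k \<psi> x))))"

text \<open>The profile is applied to the squared modulus because \<open>t * cnj t\<close> is smooth
  while \<open>cmod t\<close> is not differentiable at 0. The gradient is bounded since it is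
  continuous and supported in a ball.\<close>

lemma cutoff_radial:
  assumes der: "\<exists>h'. continuous_on UNIV h' \<and> (\<forall>s. (h has_real_derivative h' s) (at s))"
    and sm: "\<And>g :: real^'n::finite \<Rightarrow> complex. smooth g \<Longrightarrow> smooth (\<lambda>x. complex_of_real (h (Re (g x))))"
    and bd: "\<And>s. s \<ge> 0 \<Longrightarrow> 0 \<le> h s \<and> h s \<le> 1"
    and z: "\<And>s. s \<ge> 2 \<Longrightarrow> h s = 0" and r: "r > 0"
  shows "\<exists>H. cutoff TYPE('n) (\<lambda>t. h ((cmod t / r)\<^sup>2)) H"
proof -
  obtain h' where h': "continuous_on UNIV h'" "\<And>s. (h has_real_derivative h' s) (at s)"
    using der by blast
  have h'z: "h' s = 0" if "s > 2" for s
  proof -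
    have "((\<lambda>s. 0) has_real_derivative 0) (at s)" by simp
    then have "(h has_real_derivative 0) (at s)"
      by (rule has_field_derivative_transform_within_open[where S="{2<..}"]) (use that z in auto)
    with h'(2) show ?thesis using DERIV_unique by blast
  qed
  \<comment> \<open>The derivative of \<open>(cmod t / r)^2\<close> in direction \<open>w\<close> is
    \<open>Re ((2 / r^2) * cnj t * w)\<close>; the chain rule contributes the factor
    \<open>h'\<close>.\<close>
  define H where "H t = of_real (h' ((cmod t / r)\<^sup>2) * 2 / r\<^sup>2) * cnj t" for t
  have cH: "continuous_on UNIV H"
    unfolding H_def by (intro continuous_intros continuous_on_compose2[OF h'(1)]) (use r in auto)
  have H0: "H t = 0" if "t \<notin> cball 0 (2 * r)" for t
  proof -
    have "cmod t / r > 2" using that r by (auto simp: field_simps)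
    then have "(cmod t / r)\<^sup>2 > 2"
      by (smt (verit) power2_eq_square mult_le_cancel_left1 mult_strict_mono)
    then show ?thesis by (simp add: H_def h'z)
  qed
  have "bounded (H ` cball 0 (2 * r))"
    by (intro compact_imp_bounded compact_continuous_image continuous_on_subset[OF cH]) auto
  moreover have "range H \<subseteq> insert 0 (H ` cball 0 (2 * r))" using H0 by blast
  ultimately have bH: "bounded (range H)" by (metis bounded_insert bounded_subset)
  have "smooth (\<lambda>x. of_real (h ((cmod (\<psi> x) / r)\<^sup>2))) \<and>
      (\<forall>k x. partial k (\<lambda>x. of_real (h ((cmod (\<psi> x) / r)\<^sup>2))) x = of_real (Re (H (\<psi> x) * partial k \<psi> x)))"
    if \<psi>: "smooth \<psi>" for \<psi> :: "real^'n \<Rightarrow> complex"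
  proof -
    define g where "g x = of_real (1 / r\<^sup>2) * (\<psi> x * cnj (\<psi> x))" for x
    have g: "smooth g" unfolding g_def by (intro smooth_mult smooth_cnj \<psi> smooth_const)
    have Reg: "Re (g x) = (cmod (\<psi> x) / r)\<^sup>2" for x
      unfolding g_def complex_mult_cnj cmod_power2 power_divide by simp
    have pg: "partial k g x = of_real (1 / r\<^sup>2) * (\<psi> x * cnj (partial k \<psi> x) + partial k \<psi> x * cnj (\<psi> x))" for k x
      unfolding g_def using \<psi>
      by (subst partial_mult, simp, intro smooth_differentiable smooth_mult smooth_cnj \<psi>,
          subst partial_mult, intro smooth_differentiable \<psi>, intro smooth_differentiable smooth_cnj \<psi>,
          subst partial_cnj, intro smooth_differentiable \<psi>, simp)
    have "partial k (\<lambda>x. of_real (h (Re (g x)))) x = of_real (Re (H (\<psi> x) * partial k \<psi> x))" for k x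
      by (subst partial_compose_Re[OF smooth_differentiable[OF g] h'(2)])
         (simp add: pg Reg H_def field_simps)
    with sm[OF g] show ?thesis by (simp add: Reg)
  qed
  moreover have "continuous_on UNIV h"
    using DERIV_isCont[OF h'(2)] continuous_at_imp_continuous_on by blast
  then have "continuous_on UNIV (\<lambda>t. h ((cmod t / r)\<^sup>2))"
    by (rule continuous_on_compose2) (use r in \<open>auto intro!: continuous_intros\<close>)
  ultimately have "cutoff TYPE('n) (\<lambda>t. h ((cmod t / r)\<^sup>2)) H"
    using cH bH bd by (simp add: cutoff_def)
  then show ?thesis by (rule exI[of _ H])
qed

section \<open>Test functions and weak derivatives\<close>

lemma test_functionsD:
  assumes "v \<in> test_functions \<Omega>"
  shows "smooth v" and "compact (closure {x. v x \<noteq> 0})" and "closure {x. v x \<noteq> 0} \<subseteq> \<Omega>"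
  using assms by (auto simp: test_functions_def smooth_def)

lemma test_functionsI:
  assumes "smooth v" "compact K" "K \<subseteq> \<Omega>" "\<And>x. x \<notin> K \<Longrightarrow> v x = 0"
  shows "v \<in> test_functions \<Omega>"
proof -
  have "closure {x. v x \<noteq> 0} \<subseteq> K"
    by (rule closure_minimal) (use assms in \<open>auto intro: compact_imp_closed\<close>)
  moreover from this have "compact (closure {x. v x \<noteq> 0})"
    using compact_Int_closed[OF assms(2) closed_closure, of "{x. v x \<noteq> 0}"]
    by (simp add: Int_absorb1 del: compact_closure)
  ultimately show ?thesis
    using assms by (auto simp: test_functions_def smooth_def)
qed

lemma test_functions_support:
  assumes "v \<in> test_functions \<Omega>"
  obtains K where "compact K" "K \<subseteq> \<Omega>" "\<And>x. x \<notin> K \<Longrightarrow> v x = 0" "\<And>k x. x \<notin> K \<Longrightarrow> partial k v x = 0"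
proof -
  define K where "K = closure {x. v x \<noteq> 0}"
  have z: "v x = 0" if "x \<notin> K" for x
    using that closure_subset[of "{x. v x \<noteq> 0}"] unfolding K_def by blast
  have "partial k v x = 0" if "x \<notin> K" for k x
  proof -
    have "(v has_derivative (\<lambda>y. 0)) (at x)"
    proof (rule has_derivative_transform_within_open[OF has_derivative_const])
      show "open (- K)" by (simp add: K_def open_Compl)
      show "x \<in> - K" using that by simp
      show "0 = v y" if "y \<in> - K" for y using z[of y] that by simp
    qed
    then show ?thesis by (simp add: partial_eqI)
  qed
  moreover have "compact K" "K \<subseteq> \<Omega>" using test_functionsD[OF assms] unfolding K_def by blast+
  ultimately show ?thesis using z that by blast
qed

lemma test_functions_mult:
  assumes "smooth s" "v \<in> test_functions \<Omega>"
  shows "(\<lambda>x. s x * v x) \<in> test_functions \<Omega>"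
  by (rule test_functions_support[OF assms(2)], rule test_functionsI)
     (use smooth_mult[OF assms(1) test_functionsD(1)[OF assms(2)]] in auto)

lemma test_functions_partial:
  assumes "v \<in> test_functions \<Omega>"
  shows "partial k v \<in> test_functions \<Omega>"
  by (rule test_functions_support[OF assms], rule test_functionsI)
     (use smooth_partial[OF test_functionsD(1)[OF assms]] in auto)

lemma test_functions_bounded:
  assumes "v \<in> test_functions \<Omega>"
  shows "bounded (range v)"
proof -
  obtain K where K: "compact K" "\<And>x. x \<notin> K \<Longrightarrow> v x = 0"
    by (rule test_functions_support[OF assms]) blast
  have "bounded (v ` K)"
    using K(1) assms by (intro compact_imp_bounded compact_continuous_image smooth_continuous_on test_functionsD)
  moreover have "range v \<subseteq> insert 0 (v ` K)" using K(2) by blast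
  ultimately show ?thesis by (metis bounded_insert bounded_subset)
qed

section \<open>Integrals of test functions and of their derivatives\<close>

lemma smooth_borel_measurable: "smooth f \<Longrightarrow> f \<in> borel_measurable borel"
  by (intro borel_measurable_continuous_onI smooth_continuous_on)

lemma smooth_measurable_lebesgue_on: "smooth f \<Longrightarrow> f \<in> borel_measurable (lebesgue_on S)"
  by (intro measurable_restrict_space1 measurable_completion) (simp add: smooth_borel_measurable)

lemma integrable_test_lborel:
  assumes "v \<in> test_functions \<Omega>"
  shows "integrable lborel v"
proof -
  obtain K where K: "compact K" "\<And>x. x \<notin> K \<Longrightarrow> v x = 0"
    by (rule test_functions_support[OF assms]) blast
  have "integrable lborel (\<lambda>x. indicator K x *\<^sub>R v x)"
    using borel_integrable_compact[OF K(1) smooth_continuous_on[OF test_functionsD(1)[OF assms]]]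
    by (simp add: set_integrable_def)
  moreover have "(\<lambda>x. indicator K x *\<^sub>R v x) = v" using K(2) by (auto simp: indicator_def)
  ultimately show ?thesis by simp
qed

text \<open>Translations do not preserve \<open>\<Omega>\<close>, so integrals of test functions are
  moved to the whole space, where \<open>lborel\<close> is translation invariant.\<close>

lemma integral_test_lebesgue_on:
  assumes "v \<in> test_functions \<Omega>" "open \<Omega>"
  shows "(LINT x|lebesgue_on \<Omega>. v x) = (LINT x|lborel. v x)"
proof -
  obtain K where K: "K \<subseteq> \<Omega>" "\<And>x. x \<notin> K \<Longrightarrow> v x = 0"
    by (rule test_functions_support[OF assms(1)]) blast
  have "(LINT x|lebesgue_on \<Omega>. v x) = (LINT x|lebesgue. indicator \<Omega> x *\<^sub>R v x)"
    using assms(2) by (intro integral_restrict_space) auto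
  also have "(\<lambda>x. indicator \<Omega> x *\<^sub>R v x) = v" using K by (fastforce simp: indicator_def)
  also have "(LINT x|lebesgue. v x) = (LINT x|lborel. v x)"
    using test_functionsD(1)[OF assms(1)] by (intro integral_completion) (simp add: smooth_borel_measurable)
  finally show ?thesis .
qed

lemma integral_translate_lborel:
  fixes f :: "'a::euclidean_space \<Rightarrow> 'b::{banach, second_countable_topology}"
  assumes "f \<in> borel_measurable borel"
  shows "(LINT x|lborel. f (c + x)) = (LINT x|lborel. f x)"
proof -
  have "(LINT x|lborel. f x) = (LINT x|distr lborel borel ((+) c). f x)"
    by (simp add: lborel_distr_plus)
  also have "\<dots> = (LINT x|lborel. f (c + x))"
    using assms by (intro integral_distr) auto
  finally show ?thesis ..
qed

lemma integrable_translate_lborel: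
  fixes f :: "'a::euclidean_space \<Rightarrow> 'b::{banach, second_countable_topology}"
  assumes "integrable lborel f"
  shows "integrable lborel (\<lambda>x. f (c + x))"
proof -
  have "f \<in> borel_measurable borel" using assms by auto
  moreover have "integrable (distr lborel borel ((+) c)) f" using assms by (simp add: lborel_distr_plus)
  ultimately show ?thesis by (subst (asm) integrable_distr_eq) auto
qed

text \<open>By translation invariance the integrals of the difference quotients vanish.\<close>

lemma integral_partial_test:
  fixes v :: "real^'n::finite \<Rightarrow> complex"
  assumes v: "v \<in> test_functions \<Omega>" and "open \<Omega>"
  shows "(LINT x|lebesgue_on \<Omega>. partial k v x) = 0"
proof -
  let ?e = "axis k 1 :: real^'n"
  obtain K where K: "compact K" "\<And>x. x \<notin> K \<Longrightarrow> v x = 0" by (rule test_functions_support[OF v]) blast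
  obtain R where R: "\<And>x. x \<in> K \<Longrightarrow> norm x \<le> R"
    using compact_imp_bounded[OF K(1)] unfolding bounded_iff by blast
  obtain B where B: "\<And>x. cmod (partial k v x) \<le> B"
    using test_functions_bounded[OF test_functions_partial[OF v]] unfolding bounded_iff by blast
  have B0: "B \<ge> 0" using B[of 0] by (meson norm_ge_zero order_trans)
  \<comment> \<open>Along the line through \<open>x\<close> in the \<open>k\<close>-th direction the
    derivative is the partial derivative. This gives both the limit of the difference quotients and,
    by the mean value inequality, their bound \<open>B\<close>.\<close>
  have der: "((\<lambda>t. v (t *\<^sub>R ?e + x)) has_derivative (\<lambda>s. s *\<^sub>R partial k v (t *\<^sub>R ?e + x))) (at t)" for x t
  proof -
    let ?D = "frechet_derivative v (at (t *\<^sub>R ?e + x))"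
    have D: "(v has_derivative ?D) (at (t *\<^sub>R ?e + x))"
      by (rule smooth_has_derivative[OF test_functionsD(1)[OF v]])
    have "((\<lambda>t. t *\<^sub>R ?e + x) has_derivative (\<lambda>s. s *\<^sub>R ?e)) (at t)"
      by (auto intro!: derivative_eq_intros)
    from has_derivative_compose[OF this D]
    have "((\<lambda>t. v (t *\<^sub>R ?e + x)) has_derivative (\<lambda>s. ?D (s *\<^sub>R ?e))) (at t)" .
    moreover have "?D (s *\<^sub>R ?e) = s *\<^sub>R ?D ?e" for s
      using has_derivative_bounded_linear[OF D] by (simp add: linear_simps)
    ultimately show ?thesis by (simp add: partial_def)
  qed
  define h where "h n = 1 / real (Suc n)" for n
  have h: "h n > 0" "h n \<le> 1" for n by (auto simp: h_def)
  define q where "q n x = (1 / h n) *\<^sub>R (v (h n *\<^sub>R ?e + x) - v x)" for n x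
  have intq: "(LINT x|lborel. q n x) = 0" for n
    using integrable_test_lborel[OF v] smooth_borel_measurable[OF test_functionsD(1)[OF v]]
    by (simp add: q_def integrable_translate_lborel integral_translate_lborel)
  \<comment> \<open>Steps \<open>h n\<close> of length at most 1 keep the supports of all difference
    quotients in the ball of radius \<open>R + 1\<close>, so one integrable majorant serves for
    every \<open>n\<close>.\<close>
  have "(\<lambda>n. LINT x|lborel. q n x) \<longlonglongrightarrow> (LINT x|lborel. partial k v x)"
  proof (rule integral_dominated_convergence[where w = "\<lambda>x. B * indicator (cball 0 (R + 1)) x"])
    show "partial k v \<in> borel_measurable lborel"
      using smooth_borel_measurable[OF smooth_partial[OF test_functionsD(1)[OF v]]] by simp
    have [measurable]: "v \<in> borel_measurable borel"
      using smooth_borel_measurable[OF test_functionsD(1)[OF v]] .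
    show "q n \<in> borel_measurable lborel" for n unfolding q_def by measurable
    show "integrable lborel (\<lambda>x. B * indicator (cball 0 (R + 1)) x)"
      by (intro integrable_mult_right integrable_real_indicator) (auto intro!: emeasure_bounded_finite[unfolded infinity_ennreal_def])
    show "AE x in lborel. (\<lambda>n. q n x) \<longlonglongrightarrow> partial k v x"
    proof (rule AE_I2)
      fix x
      have "((\<lambda>s. norm (v ((0 + s) *\<^sub>R ?e + x) - v (0 *\<^sub>R ?e + x) - s *\<^sub>R partial k v (0 *\<^sub>R ?e + x)) / norm s) \<longlongrightarrow> 0) (at 0)"
        using der[of x 0] unfolding has_derivative_at by blast
      moreover have "filterlim h (at 0) sequentially"
        unfolding filterlim_at using h(1) LIMSEQ_inverse_real_of_nat[folded inverse_eq_divide]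
        by (auto simp: h_def[abs_def] inverse_eq_divide less_imp_neq[symmetric])
      ultimately have "(\<lambda>n. norm (v ((0 + h n) *\<^sub>R ?e + x) - v (0 *\<^sub>R ?e + x) - h n *\<^sub>R partial k v (0 *\<^sub>R ?e + x)) / norm (h n)) \<longlonglongrightarrow> 0"
        by (rule filterlim_compose)
      moreover have "norm (v ((0 + h n) *\<^sub>R ?e + x) - v (0 *\<^sub>R ?e + x) - h n *\<^sub>R partial k v (0 *\<^sub>R ?e + x)) / norm (h n)
          = norm (q n x - partial k v x)" for n
      proof -
        have "q n x - partial k v x = (1 / h n) *\<^sub>R (v (h n *\<^sub>R ?e + x) - v x - h n *\<^sub>R partial k v x)"
          using h(1)[of n] by (simp add: q_def algebra_simps)
        then show ?thesis using h(1)[of n] by simp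
      qed
      ultimately have "(\<lambda>n. norm (q n x - partial k v x)) \<longlonglongrightarrow> 0" by simp
      then show "(\<lambda>n. q n x) \<longlonglongrightarrow> partial k v x"
        by (simp add: LIM_zero_iff tendsto_norm_zero_iff)
    qed
    show "AE x in lborel. norm (q n x) \<le> B * indicator (cball 0 (R + 1)) x" for n
    proof (rule AE_I2)
      fix x
      show "norm (q n x) \<le> B * indicator (cball 0 (R + 1)) x"
      proof (cases "x \<in> cball 0 (R + 1)")
        case True
        have "norm (v (h n *\<^sub>R ?e + x) - v (0 *\<^sub>R ?e + x)) \<le> B * norm (h n - 0)"
          by (rule differentiable_bound[OF convex_UNIV der])
             (auto intro!: onorm_le simp: B mult.commute[of B] mult_left_mono)
        then show ?thesis
          using True h[of n] by (simp add: q_def pos_divide_le_eq)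
      next
        case False
        then have "norm x > R + 1" by simp
        moreover have "norm (h n *\<^sub>R ?e) \<le> 1" using h[of n] by simp
        ultimately have "norm (h n *\<^sub>R ?e + x) > R" "norm x > R"
          using norm_triangle_ineq2[of x "- (h n *\<^sub>R ?e)"] by (auto simp: add.commute)
        then have "v (h n *\<^sub>R ?e + x) = 0" "v x = 0" using K(2) R by (meson not_le)+
        then show ?thesis using B0 by (simp add: q_def)
      qed
    qed
  qed
  then have "(LINT x|lborel. partial k v x) = 0"
    by (simp add: intq LIMSEQ_const_iff)
  then show ?thesis
    using integral_test_lebesgue_on[OF test_functions_partial[OF v] assms(2)] by metis
qed


section \<open>Local integrability and rules for weak derivatives\<close>

lemma locally_integrable_mult_smooth:
  assumes "locally_integrable \<Omega> f" "smooth s"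
  shows "locally_integrable \<Omega> (\<lambda>x. f x * s x)"
  unfolding locally_integrable_def
proof (intro allI impI)
  fix K assume K: "compact K \<and> K \<subseteq> \<Omega>"
  then have i: "integrable (lebesgue_on K) f" using assms(1) by (simp add: locally_integrable_def)
  have "bounded (s ` K)"
    using K assms(2) by (intro compact_imp_bounded compact_continuous_image smooth_continuous_on) auto
  then obtain B where B: "\<And>x. x \<in> K \<Longrightarrow> cmod (s x) \<le> B" unfolding bounded_iff by blast
  have "AE x in lebesgue_on K. norm (f x * s x) \<le> norm (of_real B * f x)"
  proof (rule AE_I2)
    fix x assume "x \<in> space (lebesgue_on K)"
    then have "cmod (s x) \<le> \<bar>B\<bar>" using B[of x] by (simp add: space_restrict_space)
    then show "norm (f x * s x) \<le> norm (of_real B * f x)"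
      by (simp add: norm_mult mult.commute[of "\<bar>B\<bar>"] mult_left_mono)
  qed
  moreover have "integrable (lebesgue_on K) (\<lambda>x. of_real B * f x)" using i by simp
  moreover have "(\<lambda>x. f x * s x) \<in> borel_measurable (lebesgue_on K)"
    using i smooth_measurable_lebesgue_on[OF assms(2)] by (intro borel_measurable_times) auto
  ultimately show "integrable (lebesgue_on K) (\<lambda>x. f x * s x)"
    by (rule Bochner_Integration.integrable_bound[rotated 2])
qed

lemma locally_integrable_add:
  "locally_integrable \<Omega> f \<Longrightarrow> locally_integrable \<Omega> g \<Longrightarrow> locally_integrable \<Omega> (\<lambda>x. f x + g x)"
  by (simp add: locally_integrable_def)

lemma locally_integrable_smooth:
  assumes "smooth s"
  shows "locally_integrable \<Omega> s"
proof -
  have "locally_integrable \<Omega> (\<lambda>x. 1)"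
    unfolding locally_integrable_def
  proof (intro allI impI)
    fix K assume K: "compact K \<and> K \<subseteq> \<Omega>"
    then show "integrable (lebesgue_on K) (\<lambda>x. 1 :: complex)"
      by (intro finite_measure.integrable_const finite_measure_lebesgue_on lmeasurable_compact) simp
  qed
  from locally_integrable_mult_smooth[OF this assms] show ?thesis by simp
qed

lemma integrable_mult_test:
  assumes f: "locally_integrable \<Omega> f" and v: "v \<in> test_functions \<Omega>" and "open \<Omega>"
  shows "integrable (lebesgue_on \<Omega>) (\<lambda>x. f x * v x)"
proof -
  obtain K where K: "compact K" "K \<subseteq> \<Omega>" "\<And>x. x \<notin> K \<Longrightarrow> v x = 0"
    by (rule test_functions_support[OF v]) blast
  have "integrable (lebesgue_on K) (\<lambda>x. f x * v x)"
    using locally_integrable_mult_smooth[OF f test_functionsD(1)[OF v]] K by (simp add: locally_integrable_def)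
  then have "integrable lebesgue (\<lambda>x. indicator K x *\<^sub>R (f x * v x))"
    using K(1) by (subst (asm) integrable_restrict_space) (auto simp: compact_imp_closed)
  moreover have "(\<lambda>x. indicator K x *\<^sub>R (f x * v x)) = (\<lambda>x. indicator \<Omega> x *\<^sub>R (f x * v x))"
    using K by (fastforce simp: indicator_def)
  ultimately show ?thesis
    using \<open>open \<Omega>\<close> by (subst integrable_restrict_space) auto
qed

lemma is_weak_partialD:
  assumes "is_weak_partial \<Omega> k u g"
  shows "locally_integrable \<Omega> u" "locally_integrable \<Omega> g"
    "v \<in> test_functions \<Omega> \<Longrightarrow>
      (LINT x|lebesgue_on \<Omega>. u x * partial k v x) = - (LINT x|lebesgue_on \<Omega>. g x * v x)"
  using assms unfolding is_weak_partial_def by blast+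

lemma is_weak_partial_add:
  assumes f: "is_weak_partial \<Omega> k u f" and g: "is_weak_partial \<Omega> k w g" and "open \<Omega>"
  shows "is_weak_partial \<Omega> k (\<lambda>x. u x + w x) (\<lambda>x. f x + g x)"
  unfolding is_weak_partial_def
proof (intro conjI ballI)
  note l = is_weak_partialD(1,2)[OF f] is_weak_partialD(1,2)[OF g]
  then show "locally_integrable \<Omega> (\<lambda>x. u x + w x)" "locally_integrable \<Omega> (\<lambda>x. f x + g x)"
    by (simp_all add: locally_integrable_add)
  fix v assume v: "v \<in> test_functions \<Omega>"
  have "(LINT x|lebesgue_on \<Omega>. (u x + w x) * partial k v x) =
      (LINT x|lebesgue_on \<Omega>. u x * partial k v x) + (LINT x|lebesgue_on \<Omega>. w x * partial k v x)"
    unfolding distrib_right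
    by (intro Bochner_Integration.integral_add integrable_mult_test l test_functions_partial v \<open>open \<Omega>\<close>)
  also have "\<dots> = - ((LINT x|lebesgue_on \<Omega>. f x * v x) + (LINT x|lebesgue_on \<Omega>. g x * v x))"
    using is_weak_partialD(3)[OF f v] is_weak_partialD(3)[OF g v] by simp
  also have "(LINT x|lebesgue_on \<Omega>. f x * v x) + (LINT x|lebesgue_on \<Omega>. g x * v x) =
      (LINT x|lebesgue_on \<Omega>. (f x + g x) * v x)"
    unfolding distrib_right
    by (intro Bochner_Integration.integral_add[symmetric] integrable_mult_test l v \<open>open \<Omega>\<close>)
  finally show "(LINT x|lebesgue_on \<Omega>. (u x + w x) * partial k v x) = - (LINT x|lebesgue_on \<Omega>. (f x + g x) * v x)" .
qed

text \<open>The weak derivative of \<open>u\<close> is tested with \<open>s * v\<close>, again a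
  test function; expanding \<open>partial k (s * v)\<close> leaves exactly the extra term with
  \<open>partial k s\<close>.\<close>

lemma is_weak_partial_mult_smooth:
  assumes g: "is_weak_partial \<Omega> k u g" and s: "smooth s" and "open \<Omega>"
  shows "is_weak_partial \<Omega> k (\<lambda>x. u x * s x) (\<lambda>x. g x * s x + u x * partial k s x)"
  unfolding is_weak_partial_def
proof (intro conjI ballI)
  note l = is_weak_partialD(1,2)[OF g]
  show "locally_integrable \<Omega> (\<lambda>x. u x * s x)"
    "locally_integrable \<Omega> (\<lambda>x. g x * s x + u x * partial k s x)"
    by (intro locally_integrable_add locally_integrable_mult_smooth smooth_partial s l)+
  fix v assume v: "v \<in> test_functions \<Omega>"
  note sv = test_functions_mult[OF s v] and psv = test_functions_mult[OF smooth_partial[OF s] v]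
  have P: "partial k (\<lambda>x. s x * v x) x = s x * partial k v x + partial k s x * v x" for x
    using s test_functionsD(1)[OF v] by (intro partial_mult smooth_differentiable)
  have "(LINT x|lebesgue_on \<Omega>. u x * s x * partial k v x) =
     (LINT x|lebesgue_on \<Omega>. u x * partial k (\<lambda>x. s x * v x) x - u x * (partial k s x * v x))"
    by (simp add: P algebra_simps)
  also have "\<dots> = (LINT x|lebesgue_on \<Omega>. u x * partial k (\<lambda>x. s x * v x) x)
      - (LINT x|lebesgue_on \<Omega>. u x * (partial k s x * v x))"
    by (intro Bochner_Integration.integral_diff integrable_mult_test l \<open>open \<Omega>\<close> test_functions_partial sv psv)
  also have "(LINT x|lebesgue_on \<Omega>. u x * partial k (\<lambda>x. s x * v x) x) = - (LINT x|lebesgue_on \<Omega>. g x * (s x * v x))"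
    by (rule is_weak_partialD(3)[OF g sv])
  also have "\<dots> - (LINT x|lebesgue_on \<Omega>. u x * (partial k s x * v x)) =
     - ((LINT x|lebesgue_on \<Omega>. g x * (s x * v x)) + (LINT x|lebesgue_on \<Omega>. u x * (partial k s x * v x)))"
    by simp
  also have "(LINT x|lebesgue_on \<Omega>. g x * (s x * v x)) + (LINT x|lebesgue_on \<Omega>. u x * (partial k s x * v x))
     = (LINT x|lebesgue_on \<Omega>. g x * (s x * v x) + u x * (partial k s x * v x))"
    by (intro Bochner_Integration.integral_add[symmetric] integrable_mult_test l \<open>open \<Omega>\<close> sv psv)
  finally show "(LINT x|lebesgue_on \<Omega>. u x * s x * partial k v x) =
     - (LINT x|lebesgue_on \<Omega>. (g x * s x + u x * partial k s x) * v x)"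
    by (simp add: algebra_simps)
qed

text \<open>A smooth function is the constant 1 times itself. Thus only the constant needs an
  argument, namely that derivatives of test functions have integral zero.\<close>

lemma is_weak_partial_smooth:
  assumes "smooth s" "open \<Omega>"
  shows "is_weak_partial \<Omega> k s (partial k s)"
proof -
  have "is_weak_partial \<Omega> k (\<lambda>x. 1) (\<lambda>x. 0)"
    unfolding is_weak_partial_def
    by (intro conjI ballI locally_integrable_smooth smooth_const)
       (simp add: integral_partial_test[OF _ assms(2)])
  from is_weak_partial_mult_smooth[OF this assms] show ?thesis by simp
qed

text \<open>The indicator of an open box is a bounded pointwise limit of test functions:
  \<open>s\<close> is smooth and positive exactly on the box, and \<open>1 - hat (n * s)\<close> is
  0 off the box and equals 1 as soon as \<open>n * s\<close> reaches 1. Dominated convergence with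
  majorant \<open>norm (g x)\<close> then carries the hypothesis over to the indicator.\<close>

lemma integral_box_eq_0:
  fixes g :: "real^'n::finite \<Rightarrow> complex"
  assumes g: "locally_integrable \<Omega> g" and "open \<Omega>"
    and zero: "\<And>v. v \<in> test_functions \<Omega> \<Longrightarrow> (LINT x|lebesgue_on \<Omega>. g x * v x) = 0"
    and sub: "cbox a b \<subseteq> \<Omega>"
  shows "(LINT x:box a b|lebesgue. g x) = 0"
proof -
  define s where "s x = (\<Prod>i\<in>UNIV. flat 1 (x$i - a$i) * flat 1 (b$i - x$i))" for x :: "real^'n"
  have s0: "s x \<ge> 0" for x unfolding s_def by (intro prod_nonneg) (simp add: flat_nonneg)
  have flat_pos: "flat 1 t > 0 \<longleftrightarrow> t > 0" for t by (simp add: flat_def)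
  have s_pos: "s x > 0" if "x \<in> box a b" for x
    unfolding s_def using that by (intro prod_pos) (auto simp: flat_pos mem_box_cart)
  have s_zero: "s x = 0" if "x \<notin> box a b" for x
    using that by (auto simp: s_def mem_box_cart flat_def not_less)
  have smooth_s: "smooth (\<lambda>x. complex_of_real (s x))"
  proof -
    have c: "smooth (\<lambda>x::real^'n. complex_of_real (x $ i))" for i
      by (rule smooth_linear) (rule bounded_linear_vec_nth)
    have "smooth (\<lambda>x::real^'n. complex_of_real (flat 1 (Re (complex_of_real (x$i) - of_real (a$i)))))"
      "smooth (\<lambda>x::real^'n. complex_of_real (flat 1 (Re (of_real (b$i) - complex_of_real (x$i)))))" for i
      by (rule smooth_flat[OF smooth_diff[OF c smooth_const]]
          smooth_flat[OF smooth_diff[OF smooth_const c]])+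
    then have "smooth (\<lambda>x::real^'n. complex_of_real (flat 1 (x$i - a$i)) * complex_of_real (flat 1 (b$i - x$i)))" for i
      by (intro smooth_mult) auto
    from smooth_prod[OF this, where I = UNIV] show ?thesis by (simp add: s_def)
  qed
  define v where "v n x = 1 - complex_of_real (hat (real n * s x))" for n x
  have smooth_v: "smooth (v n)" for n
  proof -
    have "smooth (\<lambda>x. complex_of_real (hat (Re (of_nat n * complex_of_real (s x)))))"
      by (rule smooth_hat[OF smooth_mult[OF smooth_const smooth_s]])
    from smooth_diff[OF smooth_const[of 1] this] show ?thesis by (simp add: v_def[abs_def])
  qed
  have v_zero: "v n x = 0" if "x \<notin> box a b" for n x
    using that by (simp add: v_def s_zero hat_0)
  have v: "v n \<in> test_functions \<Omega>" for n
    using smooth_v compact_cbox sub v_zero box_subset_cbox by (intro test_functionsI[where K = "cbox a b"]) blast+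
  have v_le: "cmod (v n x) \<le> 1" for n x
  proof -
    have "0 \<le> hat (real n * s x)" "hat (real n * s x) \<le> 1"
      by (auto simp: hat_nonneg hat_le_1 s0)
    moreover have "v n x = of_real (1 - hat (real n * s x))" by (simp add: v_def)
    ultimately show ?thesis by (simp del: of_real_diff)
  qed
  have gi: "integrable (lebesgue_on (cbox a b)) g"
    using g sub by (simp add: locally_integrable_def)
  \<comment> \<open>The integrals are taken over the closed box because local integrability of
    \<open>g\<close> speaks of compact sets; all the \<open>v n\<close> vanish off the open box
    anyway.\<close>
  then have gm: "g \<in> borel_measurable (lebesgue_on (cbox a b))" by auto
  have "(\<lambda>n. LINT x|lebesgue_on (cbox a b). g x * v n x) \<longlonglongrightarrow> (LINT x|lebesgue_on (cbox a b). indicator (box a b) x *\<^sub>R g x)"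
  proof (rule integral_dominated_convergence[where w = "\<lambda>x. norm (g x)"])
    show "(\<lambda>x. g x * v n x) \<in> borel_measurable (lebesgue_on (cbox a b))" for n
      by (intro borel_measurable_times gm smooth_measurable_lebesgue_on smooth_v)
    have "indicat_real (box a b) \<in> borel_measurable (lebesgue_on (cbox a b))"
      by (intro measurable_restrict_space1 borel_measurable_indicator) simp
    then show "(\<lambda>x. indicat_real (box a b) x *\<^sub>R g x) \<in> borel_measurable (lebesgue_on (cbox a b))"
      by (intro borel_measurable_scaleR gm)
    show "integrable (lebesgue_on (cbox a b)) (\<lambda>x. norm (g x))" using gi by simp
    show "AE x in lebesgue_on (cbox a b). norm (g x * v n x) \<le> norm (g x)" for n
      by (intro AE_I2) (simp add: norm_mult v_le mult_left_le)
    show "AE x in lebesgue_on (cbox a b). (\<lambda>n. g x * v n x) \<longlonglongrightarrow> indicat_real (box a b) x *\<^sub>R g x"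
    proof (rule AE_I2)
      fix x
      show "(\<lambda>n. g x * v n x) \<longlonglongrightarrow> indicat_real (box a b) x *\<^sub>R g x"
      proof (cases "x \<in> box a b")
        case True
        obtain N where N: "1 / s x < real N" using reals_Archimedean2 by blast
        have "v n x = 1" if "n \<ge> N" for n
        proof -
          have "1 / s x < real n" using N that by (meson le_less_trans less_le_trans of_nat_le_iff)
          then have "real n * s x \<ge> 1" using s_pos[OF True] by (simp add: field_simps)
          then show ?thesis by (simp add: v_def hat_ge_1)
        qed
        then have "eventually (\<lambda>n. g x = g x * v n x) sequentially"
          unfolding eventually_sequentially by auto
        from Lim_transform_eventually[OF tendsto_const this] show ?thesis using True by simp
      next
        case False
        then show ?thesis by (simp add: v_zero)
      qed
    qed
  qed
  moreover have "(LINT x|lebesgue_on (cbox a b). g x * v n x) = 0" for n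
  proof -
    have "(LINT x|lebesgue_on (cbox a b). g x * v n x) = (LINT x|lebesgue. indicator (cbox a b) x *\<^sub>R (g x * v n x))"
      by (intro integral_restrict_space) auto
    also have "(\<lambda>x. indicator (cbox a b) x *\<^sub>R (g x * v n x)) = (\<lambda>x. indicator \<Omega> x *\<^sub>R (g x * v n x))"
      using sub v_zero box_subset_cbox[of a b] by (fastforce simp: indicator_def)
    also have "(LINT x|lebesgue. indicator \<Omega> x *\<^sub>R (g x * v n x)) = (LINT x|lebesgue_on \<Omega>. g x * v n x)"
      using \<open>open \<Omega>\<close> by (intro integral_restrict_space[symmetric]) auto
    finally show ?thesis using zero[OF v] by simp
  qed
  ultimately have "(LINT x|lebesgue_on (cbox a b). indicator (box a b) x *\<^sub>R g x) = 0"
    by (simp add: LIMSEQ_const_iff)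
  moreover have "(LINT x|lebesgue_on (cbox a b). indicator (box a b) x *\<^sub>R g x) =
      (LINT x|lebesgue. indicator (cbox a b) x *\<^sub>R indicator (box a b) x *\<^sub>R g x)"
    by (intro integral_restrict_space) auto
  moreover have "(\<lambda>x. indicat_real (cbox a b) x *\<^sub>R indicat_real (box a b) x *\<^sub>R g x) = (\<lambda>x. indicat_real (box a b) x *\<^sub>R g x)"
    using box_subset_cbox[of a b] by (fastforce simp: indicator_def)
  ultimately show ?thesis by (simp add: set_lebesgue_integral_def)
qed

text \<open>Boxes are stable under intersection and generate the Borel sets, so vanishing of the
  integrals passes from boxes to Borel sets by the pi-lambda argument, the box
  \<open>box c d\<close> itself serving for complements. A Lebesgue set is an F-sigma set up to a
  null set, so all measurable sets are reached.\<close>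

lemma AE_eq_0_on_box:
  fixes g :: "real^'n::finite \<Rightarrow> complex"
  assumes gi: "integrable (lebesgue_on (box c d)) g"
    and zero: "\<And>a b. box a b \<subseteq> box c d \<Longrightarrow> (LINT x:box a b|lebesgue. g x) = 0"
  shows "AE x in lebesgue_on (box c d). g x = 0"
proof (rule sigma_finite_measure.density_zero[OF _ gi])
  show "sigma_finite_measure (lebesgue_on (box c d))"
    using finite_measure.axioms(1) finite_measure_lebesgue_on by auto
  have si: "set_integrable lebesgue (box c d) g"
    using gi by (simp add: set_integrable_def integrable_restrict_space)
  have siA: "set_integrable lebesgue A g" if "A \<in> sets lebesgue" "A \<subseteq> box c d" for A
    using set_integrable_subset[OF si that] .
  have borel: "(LINT x:A \<inter> box c d|lebesgue. g x) = 0" if "A \<in> sets borel" for A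
  proof -
    have "Int_stable (range (\<lambda>(a, b). box a b :: (real^'n) set))"
      by (auto simp: Int_stable_def box_Int_box)
    moreover have "range (\<lambda>(a, b). box a b :: (real^'n) set) \<subseteq> Pow UNIV" by auto
    moreover have "A \<in> sigma_sets UNIV (range (\<lambda>(a, b). box a b))"
      using that unfolding borel_eq_box by simp
    ultimately show ?thesis
    proof (induction rule: sigma_sets_induct_disjoint)
      case (basic A)
      then obtain a b where "A = box a b" by auto
      then obtain a' b' where *: "A \<inter> box c d = box a' b'" by (simp add: box_Int_box)
      show ?case unfolding * by (rule zero) (use * in blast)
    next
      case empty
      then show ?case by (simp add: set_lebesgue_integral_def)
    next
      case (compl A)
      then have A: "A \<in> sets borel" by (simp add: borel_eq_box)
      have "(LINT x:(A \<inter> box c d) \<union> ((UNIV - A) \<inter> box c d)|lebesgue. g x) =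
          (LINT x:A \<inter> box c d|lebesgue. g x) + (LINT x:(UNIV - A) \<inter> box c d|lebesgue. g x)"
        using A by (intro set_integral_Un siA) auto
      moreover have "(A \<inter> box c d) \<union> ((UNIV - A) \<inter> box c d) = box c d" by blast
      ultimately show ?case using compl.IH zero[OF order_refl] by simp
    next
      case (union A)
      then have [measurable]: "A i \<in> sets borel" for i
        by (simp add: borel_eq_box subset_eq)
      have "(LINT x:(\<Union>i. A i \<inter> box c d)|lebesgue. g x) = (\<Sum>i. LINT x:A i \<inter> box c d|lebesgue. g x)"
        using union(1) by (intro lebesgue_integral_countable_add siA) (auto simp: disjoint_family_on_def)
      then show ?case using union.IH by simp
    qed
  qed
  fix A assume "A \<in> sets (lebesgue_on (box c d))"
  then have A: "A \<in> sets lebesgue" "A \<subseteq> box c d" by (auto simp: sets_restrict_space_iff)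
  obtain C T where CT: "fsigma C" "T \<in> null_sets lebesgue" "C \<union> T = A" "disjnt C T"
    by (rule lebesgue_set_almost_fsigma[OF A(1)])
  have C: "C \<in> sets borel" using CT(1) by (auto elim!: fsigma.cases)
  have "AE x in lebesgue. x \<notin> T"
    using CT(2) by (rule AE_not_in)
  then have "AE x in lebesgue. indicat_real A x *\<^sub>R g x = indicat_real (C \<inter> box c d) x *\<^sub>R g x"
  proof eventually_elim
    case (elim x)
    then have "x \<in> A \<longleftrightarrow> x \<in> C \<inter> box c d" using CT(3) A(2) by blast
    then show ?case by (simp add: indicator_def)
  qed
  moreover have "C \<inter> box c d \<in> sets lebesgue" using C by simp
  ultimately have "(LINT x:A|lebesgue. g x) = (LINT x:C \<inter> box c d|lebesgue. g x)"
    unfolding set_lebesgue_integral_def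
    using siA[OF A] siA[of "C \<inter> box c d"]
    by (intro integral_cong_AE borel_measurable_integrable) (simp_all add: set_integrable_def)
  moreover have "(LINT x:A|lebesgue_on (box c d). g x) = (LINT x:A|lebesgue. g x)"
  proof -
    have "(\<lambda>x. indicat_real A x *\<^sub>R indicat_real (box c d) x *\<^sub>R g x) = (\<lambda>x. indicat_real A x *\<^sub>R g x)"
      using A(2) by (fastforce simp: indicator_def)
    then show ?thesis
      by (simp add: set_integral_restrict_space) (simp add: set_lebesgue_integral_def)
  qed
  ultimately show "(LINT x:A|lebesgue_on (box c d). g x) = 0"
    using borel[OF C] by simp
qed

text \<open>Needed because the \<open>SOME\<close> in \<open>weak_partial\<close>, and hence \<open>H1_norm\<close>, has to be compared with
  weak derivatives that are explicitly known.\<close>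

lemma du_Bois_Reymond:
  fixes g :: "real^'n::finite \<Rightarrow> complex"
  assumes g: "locally_integrable \<Omega> g" and "open \<Omega>"
    and zero: "\<And>v. v \<in> test_functions \<Omega> \<Longrightarrow> (LINT x|lebesgue_on \<Omega>. g x * v x) = 0"
  shows "AE x in lebesgue_on \<Omega>. g x = 0"
proof -
  obtain D where D: "countable D" "D \<subseteq> Pow \<Omega>" "\<And>X. X \<in> D \<Longrightarrow> \<exists>a b. X = cbox a b" "\<Union>D = \<Omega>"
    using open_countable_Union_open_cbox[OF \<open>open \<Omega>\<close>] by metis
  have "AE x in lebesgue. x \<in> X \<longrightarrow> g x = 0" if X: "X \<in> D" for X
  proof -
    obtain a b where ab: "X = cbox a b" using D(3)[OF X] by blast
    have sub: "cbox a b \<subseteq> \<Omega>" using D(2) X ab by blast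
    have "integrable (lebesgue_on (cbox a b)) g"
      using g sub by (simp add: locally_integrable_def)
    then have "set_integrable lebesgue (cbox a b) g"
      by (simp add: set_integrable_def integrable_restrict_space)
    from set_integrable_subset[OF this _ box_subset_cbox]
    have "integrable (lebesgue_on (box a b)) g"
      by (simp add: set_integrable_def integrable_restrict_space)
    then have "AE x in lebesgue_on (box a b). g x = 0"
    proof (rule AE_eq_0_on_box)
      fix a' b' assume sub': "box a' b' \<subseteq> box a b"
      show "(LINT x:box a' b'|lebesgue. g x) = 0"
      \<comment> \<open>The closed box is the closure of the open one only if the latter is
        nonempty; a degenerate \<open>cbox a' b'\<close> could lie outside
        \<open>\<Omega>\<close>.\<close>
      proof (cases "box a' b' = {}")
        case False
        then have "cbox a' b' \<subseteq> cbox a b"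
          using closure_mono[OF sub'] sub' by (metis closure_box subset_empty)
        then show ?thesis
          using sub by (intro integral_box_eq_0[OF g \<open>open \<Omega>\<close> zero]) auto
      qed (simp add: set_lebesgue_integral_def)
    qed
    then have "AE x in lebesgue. x \<in> box a b \<longrightarrow> g x = 0"
      by (simp add: AE_restrict_space_iff)
    moreover have "AE x in lebesgue. x \<notin> cbox a b - box a b"
      using negligible_frontier_interval[of a b] unfolding negligible_iff_null_sets by (rule AE_not_in)
    ultimately show ?thesis unfolding ab by eventually_elim blast
  qed
  then have "AE x in lebesgue. \<forall>X\<in>D. x \<in> X \<longrightarrow> g x = 0"
    by (subst AE_ball_countable[OF D(1)]) blast
  then have "AE x in lebesgue. x \<in> \<Omega> \<longrightarrow> g x = 0"
    by eventually_elim (use D(4) in blast)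
  then show ?thesis using \<open>open \<Omega>\<close> by (simp add: AE_restrict_space_iff)
qed

lemma is_weak_partial_unique:
  assumes f: "is_weak_partial \<Omega> k u f" and g: "is_weak_partial \<Omega> k u g" and "open \<Omega>"
  shows "AE x in lebesgue_on \<Omega>. f x = g x"
proof -
  note l = is_weak_partialD(2)[OF f] is_weak_partialD(2)[OF g]
  have "locally_integrable \<Omega> (\<lambda>x. f x - g x)"
    using l by (simp add: locally_integrable_def)
  then have "AE x in lebesgue_on \<Omega>. f x - g x = 0"
  proof (rule du_Bois_Reymond[OF _ \<open>open \<Omega>\<close>])
    fix v assume v: "v \<in> test_functions \<Omega>"
    have "(LINT x|lebesgue_on \<Omega>. (f x - g x) * v x) =
        (LINT x|lebesgue_on \<Omega>. f x * v x) - (LINT x|lebesgue_on \<Omega>. g x * v x)"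
      unfolding left_diff_distrib
      by (intro Bochner_Integration.integral_diff integrable_mult_test l v \<open>open \<Omega>\<close>)
    then show "(LINT x|lebesgue_on \<Omega>. (f x - g x) * v x) = 0"
      using is_weak_partialD(3)[OF f v] is_weak_partialD(3)[OF g v] by simp
  qed
  then show ?thesis by simp
qed

text \<open>Completeness of Lebesgue measure supplies the measurability of \<open>g\<close>. Hence
  the congruence rules below make no measurability assumption on the second function, which suits
  representatives chosen by \<open>SOME\<close>.\<close>

lemma measurable_lebesgue_on_AE:
  fixes f g :: "'a::euclidean_space \<Rightarrow> 'b::topological_space"
  assumes f: "f \<in> borel_measurable (lebesgue_on S)" and S: "S \<in> sets lebesgue"
    and eq: "AE x in lebesgue_on S. f x = g x"
  shows "g \<in> borel_measurable (lebesgue_on S)"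
proof (rule measurableI)
  fix A :: "'b set" assume A: "A \<in> sets borel"
  have fA: "f -` A \<inter> S \<in> sets lebesgue"
    using measurable_sets[OF f A] S by (simp add: space_restrict_space sets_restrict_space_iff)
  have "AE x in lebesgue. x \<in> S \<longrightarrow> f x = g x"
    using eq S by (simp add: AE_restrict_space_iff)
  then have ae: "AE x in lebesgue. x \<in> f -` A \<inter> S \<longleftrightarrow> x \<in> g -` A \<inter> S"
    by eventually_elim auto
  have "g -` A \<inter> S \<in> sets lebesgue"
    by (rule complete_measure.in_sets_AE[OF completion.complete_measure_axioms ae fA]) simp
  then show "g -` A \<inter> space (lebesgue_on S) \<in> sets (lebesgue_on S)"
    using S by (simp add: space_restrict_space sets_restrict_space_iff)
qed simp

lemma integrable_lebesgue_on_cong_AE: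
  fixes f g :: "'a::euclidean_space \<Rightarrow> 'b::{banach, second_countable_topology}"
  assumes "integrable (lebesgue_on S) f" "S \<in> sets lebesgue" "AE x in lebesgue_on S. f x = g x"
  shows "integrable (lebesgue_on S) g"
  by (rule integrable_cong_AE_imp[OF assms(1) measurable_lebesgue_on_AE[OF borel_measurable_integrable[OF assms(1)] assms(2,3)]])
     (use assms(3) in auto)

lemma integral_lebesgue_on_cong_AE:
  fixes f g :: "'a::euclidean_space \<Rightarrow> 'b::{banach, second_countable_topology}"
  assumes "f \<in> borel_measurable (lebesgue_on S)" "S \<in> sets lebesgue" "AE x in lebesgue_on S. f x = g x"
  shows "(LINT x|lebesgue_on S. f x) = (LINT x|lebesgue_on S. g x)"
  by (rule integral_cong_AE[OF assms(1) measurable_lebesgue_on_AE[OF assms] assms(3)])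

lemma AE_lebesgue_on_subset:
  assumes "AE x in lebesgue_on S. P x" "S \<in> sets lebesgue" "K \<in> sets lebesgue" "K \<subseteq> S"
  shows "AE x in lebesgue_on K. P x"
proof -
  have "AE x in lebesgue. x \<in> S \<longrightarrow> P x" using assms by (simp add: AE_restrict_space_iff)
  then have "AE x in lebesgue. x \<in> K \<longrightarrow> P x" by eventually_elim (use assms in auto)
  then show ?thesis using assms by (simp add: AE_restrict_space_iff)
qed

lemma locally_integrable_cong_AE:
  assumes f: "locally_integrable \<Omega> f" and "open \<Omega>" and eq: "AE x in lebesgue_on \<Omega>. f x = g x"
  shows "locally_integrable \<Omega> g"
  unfolding locally_integrable_def
proof (intro allI impI)
  fix K assume K: "compact K \<and> K \<subseteq> \<Omega>"
  then have "K \<in> sets lebesgue" by (simp add: compact_imp_closed)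
  moreover from this have "AE x in lebesgue_on K. f x = g x"
    using K \<open>open \<Omega>\<close> by (intro AE_lebesgue_on_subset[OF eq]) auto
  moreover have "integrable (lebesgue_on K) f" using f K unfolding locally_integrable_def by blast
  ultimately show "integrable (lebesgue_on K) g" using integrable_lebesgue_on_cong_AE by blast
qed

lemma is_weak_partial_cong_AE:
  assumes w: "is_weak_partial \<Omega> k u g" and "open \<Omega>"
    and u: "AE x in lebesgue_on \<Omega>. u x = u' x" and g: "AE x in lebesgue_on \<Omega>. g x = g' x"
  shows "is_weak_partial \<Omega> k u' g'"
  unfolding is_weak_partial_def
proof (intro conjI ballI)
  note l = is_weak_partialD(1,2)[OF w]
  show "locally_integrable \<Omega> u'" "locally_integrable \<Omega> g'"
    by (rule locally_integrable_cong_AE[OF l(1) \<open>open \<Omega>\<close> u] locally_integrable_cong_AE[OF l(2) \<open>open \<Omega>\<close> g])+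
  fix v assume v: "v \<in> test_functions \<Omega>"
  have "(LINT x|lebesgue_on \<Omega>. u x * partial k v x) = (LINT x|lebesgue_on \<Omega>. u' x * partial k v x)"
  proof (rule integral_lebesgue_on_cong_AE)
    show "AE x in lebesgue_on \<Omega>. u x * partial k v x = u' x * partial k v x"
      using u by eventually_elim simp
  qed (use \<open>open \<Omega>\<close> integrable_mult_test[OF l(1) test_functions_partial[OF v] \<open>open \<Omega>\<close>] in auto)
  moreover have "(LINT x|lebesgue_on \<Omega>. g x * v x) = (LINT x|lebesgue_on \<Omega>. g' x * v x)"
  proof (rule integral_lebesgue_on_cong_AE)
    show "AE x in lebesgue_on \<Omega>. g x * v x = g' x * v x"
      using g by eventually_elim simp
  qed (use \<open>open \<Omega>\<close> integrable_mult_test[OF l(2) v \<open>open \<Omega>\<close>] in auto)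
  ultimately show "(LINT x|lebesgue_on \<Omega>. u' x * partial k v x) = - (LINT x|lebesgue_on \<Omega>. g' x * v x)"
    using is_weak_partialD(3)[OF w v] by simp
qed

section \<open>Square integrable functions\<close>

text \<open>L2 and H1 estimates are kept in squared form; this takes the place of the triangle
  inequality, at the price of the factors 2.\<close>

lemma norm_add_square_le:
  fixes x y :: "'a::real_normed_vector"
  shows "(norm (x + y))\<^sup>2 \<le> 2 * (norm x)\<^sup>2 + 2 * (norm y)\<^sup>2"
proof -
  have "(norm (x + y))\<^sup>2 \<le> (norm x + norm y)\<^sup>2"
    by (intro power_mono norm_triangle_ineq) simp
  also have "\<dots> \<le> 2 * (norm x)\<^sup>2 + 2 * (norm y)\<^sup>2"
    using sum_squares_ge_zero[of "norm x - norm y" 0] by (simp add: power2_eq_square algebra_simps)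
  finally show ?thesis .
qed

lemma L2D:
  assumes "f \<in> L2 \<Omega>"
  shows "f \<in> borel_measurable (lebesgue_on \<Omega>)" "integrable (lebesgue_on \<Omega>) (\<lambda>x. (cmod (f x))\<^sup>2)"
  using assms by (auto simp: L2_def)

lemma L2_bound:
  assumes "f \<in> borel_measurable (lebesgue_on \<Omega>)" "integrable (lebesgue_on \<Omega>) w"
    "AE x in lebesgue_on \<Omega>. (cmod (f x))\<^sup>2 \<le> w x"
  shows "f \<in> L2 \<Omega>"
proof -
  have "AE x in lebesgue_on \<Omega>. norm ((cmod (f x))\<^sup>2) \<le> norm (w x)"
    using assms(3) by eventually_elim auto
  moreover have "(\<lambda>x. (cmod (f x))\<^sup>2) \<in> borel_measurable (lebesgue_on \<Omega>)"
    using assms(1) by simp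
  ultimately have "integrable (lebesgue_on \<Omega>) (\<lambda>x. (cmod (f x))\<^sup>2)"
    using Bochner_Integration.integrable_bound[OF assms(2)] by blast
  then show ?thesis using assms(1) by (simp add: L2_def)
qed

lemma L2_add:
  assumes "f \<in> L2 \<Omega>" "g \<in> L2 \<Omega>"
  shows "(\<lambda>x. f x + g x) \<in> L2 \<Omega>"
proof (rule L2_bound)
  show "(\<lambda>x. f x + g x) \<in> borel_measurable (lebesgue_on \<Omega>)"
    using L2D(1)[OF assms(1)] L2D(1)[OF assms(2)] by simp
  show "integrable (lebesgue_on \<Omega>) (\<lambda>x. 2 * (cmod (f x))\<^sup>2 + 2 * (cmod (g x))\<^sup>2)"
    using L2D(2)[OF assms(1)] L2D(2)[OF assms(2)] by simp
qed (simp add: norm_add_square_le)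

lemma L2_mult_bounded:
  assumes f: "f \<in> L2 \<Omega>" and m: "m \<in> borel_measurable (lebesgue_on \<Omega>)"
    and B: "\<And>x. x \<in> \<Omega> \<Longrightarrow> cmod (m x) \<le> B"
  shows "(\<lambda>x. f x * m x) \<in> L2 \<Omega>"
proof (rule L2_bound)
  show "(\<lambda>x. f x * m x) \<in> borel_measurable (lebesgue_on \<Omega>)"
    using L2D(1)[OF f] m by simp
  show "integrable (lebesgue_on \<Omega>) (\<lambda>x. B\<^sup>2 * (cmod (f x))\<^sup>2)"
    using L2D(2)[OF f] by simp
  show "AE x in lebesgue_on \<Omega>. (cmod (f x * m x))\<^sup>2 \<le> B\<^sup>2 * (cmod (f x))\<^sup>2"
  proof (rule AE_I2)
    fix x assume "x \<in> space (lebesgue_on \<Omega>)"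
    then have "(cmod (m x))\<^sup>2 \<le> B\<^sup>2" using B[of x] by (intro power_mono) (auto simp: space_restrict_space)
    then show "(cmod (f x * m x))\<^sup>2 \<le> B\<^sup>2 * (cmod (f x))\<^sup>2"
      by (simp add: norm_mult power_mult_distrib mult.commute[of "B\<^sup>2"] mult_left_mono)
  qed
qed

lemma L2_cmult: "f \<in> L2 \<Omega> \<Longrightarrow> (\<lambda>x. c * f x) \<in> L2 \<Omega>"
  using L2_mult_bounded[of f \<Omega> "\<lambda>x. c" "cmod c"] by (simp add: mult.commute)

lemma L2_diff: "f \<in> L2 \<Omega> \<Longrightarrow> g \<in> L2 \<Omega> \<Longrightarrow> (\<lambda>x. f x - g x) \<in> L2 \<Omega>"
  using L2_add[of f \<Omega> "\<lambda>x. (-1) * g x"] L2_cmult[of g \<Omega> "-1"] by simp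

lemma L2_sum: "(\<And>i. i \<in> I \<Longrightarrow> f i \<in> L2 \<Omega>) \<Longrightarrow> (\<lambda>x. \<Sum>i\<in>I. f i x) \<in> L2 \<Omega>"
proof (induction I rule: infinite_finite_induct)
  case (insert i I)
  then show ?case by (simp add: L2_add)
qed (simp_all add: L2_def)

lemma L2_cong_AE:
  assumes f: "f \<in> L2 \<Omega>" and \<Omega>: "\<Omega> \<in> sets lebesgue" and eq: "AE x in lebesgue_on \<Omega>. f x = g x"
  shows "g \<in> L2 \<Omega>"
proof (rule L2_bound[OF measurable_lebesgue_on_AE[OF L2D(1)[OF f] \<Omega> eq] L2D(2)[OF f]])
  show "AE x in lebesgue_on \<Omega>. (cmod (g x))\<^sup>2 \<le> (cmod (f x))\<^sup>2"
    using eq by eventually_elim simp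
qed

lemma finite_measure_lebesgue_on_open_bounded:
  assumes "open \<Omega>" "bounded \<Omega>"
  shows "finite_measure (lebesgue_on \<Omega>)"
  using assms by (intro finite_measure_lebesgue_on lmeasurable_open)

lemma L2_bounded:
  assumes "open \<Omega>" "bounded \<Omega>" "m \<in> borel_measurable (lebesgue_on \<Omega>)" "\<And>x. x \<in> \<Omega> \<Longrightarrow> cmod (m x) \<le> B"
  shows "m \<in> L2 \<Omega>"
proof -
  interpret finite_measure "lebesgue_on \<Omega>"
    using assms by (intro finite_measure_lebesgue_on_open_bounded)
  have "(\<lambda>x. 1) \<in> L2 \<Omega>" by (simp add: L2_def)
  from L2_mult_bounded[OF this assms(3,4)] show ?thesis by simp
qed

lemma L2_smooth:
  assumes "open \<Omega>" "bounded \<Omega>" "smooth s"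
  shows "s \<in> L2 \<Omega>"
proof -
  have "bounded (s ` closure \<Omega>)"
    using assms by (intro compact_imp_bounded compact_continuous_image smooth_continuous_on) auto
  then obtain B where "\<And>x. x \<in> closure \<Omega> \<Longrightarrow> cmod (s x) \<le> B" unfolding bounded_iff by blast
  then show ?thesis
    using closure_subset[of \<Omega>] by (intro L2_bounded[OF assms(1,2) smooth_measurable_lebesgue_on[OF assms(3)]]) blast
qed

lemma L2_integrable_mult:
  assumes f: "f \<in> L2 \<Omega>" and g: "g \<in> L2 \<Omega>"
  shows "integrable (lebesgue_on \<Omega>) (\<lambda>x. f x * g x)"
proof -
  have i: "integrable (lebesgue_on \<Omega>) (\<lambda>x. (cmod (f x))\<^sup>2 + (cmod (g x))\<^sup>2)"
    using L2D(2)[OF f] L2D(2)[OF g] by simp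
  have m: "(\<lambda>x. f x * g x) \<in> borel_measurable (lebesgue_on \<Omega>)"
    using L2D(1)[OF f] L2D(1)[OF g] by simp
  have le: "norm (f x * g x) \<le> norm ((cmod (f x))\<^sup>2 + (cmod (g x))\<^sup>2)" for x
    using sum_squares_bound[of "cmod (f x)" "cmod (g x)"] mult_nonneg_nonneg[OF norm_ge_zero norm_ge_zero, of "f x" "g x"]
    unfolding norm_mult real_norm_def by linarith
  show ?thesis by (rule Bochner_Integration.integrable_bound[OF i m AE_I2[OF le]])
qed

lemma L2_locally_integrable:
  assumes "open \<Omega>" "bounded \<Omega>" "f \<in> L2 \<Omega>"
  shows "locally_integrable \<Omega> f"
  unfolding locally_integrable_def
proof (intro allI impI)
  fix K assume K: "compact K \<and> K \<subseteq> \<Omega>"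
  have "integrable (lebesgue_on \<Omega>) (\<lambda>x. f x * 1)"
    by (rule L2_integrable_mult[OF assms(3) L2_smooth[OF assms(1,2) smooth_const]])
  then have "set_integrable lebesgue \<Omega> f"
    using assms(1) by (simp add: set_integrable_def integrable_restrict_space)
  then have "set_integrable lebesgue K f"
    by (rule set_integrable_subset) (use K in \<open>auto simp: compact_imp_closed\<close>)
  then show "integrable (lebesgue_on K) f"
    using K by (simp add: set_integrable_def integrable_restrict_space compact_imp_closed)
qed

text \<open>Membership in \<open>L2\<close> is bundled with the convergence because the integral of
  a non-integrable function has the default value 0, so that the limit alone would say
  little.\<close>

definition L2_lim :: "(real^'n::finite) set \<Rightarrow> (nat \<Rightarrow> real^'n \<Rightarrow> complex) \<Rightarrow> (real^'n \<Rightarrow> complex) \<Rightarrow> bool" where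
  "L2_lim \<Omega> f l \<longleftrightarrow> l \<in> L2 \<Omega> \<and> (\<forall>j. f j \<in> L2 \<Omega>) \<and>
     (\<lambda>j. LINT x|lebesgue_on \<Omega>. (cmod (f j x - l x))\<^sup>2) \<longlonglongrightarrow> 0"

lemma L2_limD:
  assumes "L2_lim \<Omega> f l"
  shows "l \<in> L2 \<Omega>" "f j \<in> L2 \<Omega>" "(\<lambda>j. LINT x|lebesgue_on \<Omega>. (cmod (f j x - l x))\<^sup>2) \<longlonglongrightarrow> 0"
  using assms by (auto simp: L2_lim_def)

lemma L2_lim_const: "f \<in> L2 \<Omega> \<Longrightarrow> L2_lim \<Omega> (\<lambda>j. f) f"
  by (simp add: L2_lim_def)

lemma L2_lim_bound:
  assumes "l \<in> L2 \<Omega>" "\<And>j. f j \<in> L2 \<Omega>" "\<And>j. integrable (lebesgue_on \<Omega>) (w j)"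
    and lim: "(\<lambda>j. LINT x|lebesgue_on \<Omega>. w j x) \<longlonglongrightarrow> 0"
    and le: "\<And>j x. x \<in> \<Omega> \<Longrightarrow> (cmod (f j x - l x))\<^sup>2 \<le> w j x"
  shows "L2_lim \<Omega> f l"
proof -
  have "(LINT x|lebesgue_on \<Omega>. (cmod (f j x - l x))\<^sup>2) \<le> (LINT x|lebesgue_on \<Omega>. w j x)" for j
    using L2D(2)[OF L2_diff[OF assms(2,1)]] assms(3) le
    by (intro integral_mono) (auto simp: space_restrict_space)
  then have "(\<lambda>j. LINT x|lebesgue_on \<Omega>. (cmod (f j x - l x))\<^sup>2) \<longlonglongrightarrow> 0"
    by (intro tendsto_sandwich[OF _ _ tendsto_const lim]) (auto intro!: always_eventually integral_nonneg)
  then show ?thesis using assms(1,2) by (simp add: L2_lim_def)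
qed

lemma L2_lim_add:
  assumes f: "L2_lim \<Omega> f l" and g: "L2_lim \<Omega> g m"
  shows "L2_lim \<Omega> (\<lambda>j x. f j x + g j x) (\<lambda>x. l x + m x)"
proof (rule L2_lim_bound[where w = "\<lambda>j x. 2 * (cmod (f j x - l x))\<^sup>2 + 2 * (cmod (g j x - m x))\<^sup>2"])
  note F = L2D(2)[OF L2_diff[OF L2_limD(2)[OF f] L2_limD(1)[OF f]]]
  note G = L2D(2)[OF L2_diff[OF L2_limD(2)[OF g] L2_limD(1)[OF g]]]
  show "integrable (lebesgue_on \<Omega>) (\<lambda>x. 2 * (cmod (f j x - l x))\<^sup>2 + 2 * (cmod (g j x - m x))\<^sup>2)" for j
    using F[of j] G[of j] by simp
  have "(\<lambda>j. 2 * (LINT x|lebesgue_on \<Omega>. (cmod (f j x - l x))\<^sup>2) + 2 * (LINT x|lebesgue_on \<Omega>. (cmod (g j x - m x))\<^sup>2)) \<longlonglongrightarrow> 2 * 0 + 2 * 0"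
    by (intro tendsto_intros L2_limD(3) f g)
  then show "(\<lambda>j. LINT x|lebesgue_on \<Omega>. 2 * (cmod (f j x - l x))\<^sup>2 + 2 * (cmod (g j x - m x))\<^sup>2) \<longlonglongrightarrow> 0"
    using F G by simp
  show "(cmod (f j x + g j x - (l x + m x)))\<^sup>2 \<le> 2 * (cmod (f j x - l x))\<^sup>2 + 2 * (cmod (g j x - m x))\<^sup>2" for j x
    using norm_add_square_le[of "f j x - l x" "g j x - m x"] by (simp add: algebra_simps)
qed (use f g in \<open>auto simp: L2_lim_def intro: L2_add\<close>)

text \<open>In the splitting \<open>(f j - l) * a j + l * (a j - b)\<close> the first term is
  controlled by the bound \<open>B\<close>, the second by dominated convergence with the fixed
  majorant \<open>(2 * B)^2 * (cmod l)^2\<close>. Bounded pointwise convergence of the multipliers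
  is exactly what a bounded continuous function of an a.e. convergent sequence provides.\<close>

lemma L2_lim_mult:
  assumes f: "L2_lim \<Omega> f l"
    and a: "\<And>j. a j \<in> borel_measurable (lebesgue_on \<Omega>)" "b \<in> borel_measurable (lebesgue_on \<Omega>)"
    and aB: "\<And>j x. x \<in> \<Omega> \<Longrightarrow> cmod (a j x) \<le> B" and bB: "\<And>x. x \<in> \<Omega> \<Longrightarrow> cmod (b x) \<le> B"
    and lim: "AE x in lebesgue_on \<Omega>. (\<lambda>j. a j x) \<longlonglongrightarrow> b x"
  shows "L2_lim \<Omega> (\<lambda>j x. f j x * a j x) (\<lambda>x. l x * b x)"
proof (rule L2_lim_bound[where w = "\<lambda>j x. 2 * (B\<^sup>2 * (cmod (f j x - l x))\<^sup>2) + 2 * (cmod (l x * (a j x - b x)))\<^sup>2"])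
  note F = L2D(2)[OF L2_diff[OF L2_limD(2)[OF f] L2_limD(1)[OF f]]]
  have ab: "cmod (a j x - b x) \<le> 2 * B" if "x \<in> \<Omega>" for j x
    using norm_triangle_ineq4[of "a j x" "b x"] aB[OF that, of j] bB[OF that] by linarith
  have "(\<lambda>x. l x * (a j x - b x)) \<in> L2 \<Omega>" for j
    using a by (intro L2_mult_bounded[OF L2_limD(1)[OF f] _ ab]) auto
  note G = L2D(2)[OF this]
  show "integrable (lebesgue_on \<Omega>) (\<lambda>x. 2 * (B\<^sup>2 * (cmod (f j x - l x))\<^sup>2) + 2 * (cmod (l x * (a j x - b x)))\<^sup>2)" for j
    using F[of j] G[of j] by simp
  have "(\<lambda>j. LINT x|lebesgue_on \<Omega>. (cmod (l x * (a j x - b x)))\<^sup>2) \<longlonglongrightarrow> (LINT x|lebesgue_on \<Omega>. 0)"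
  proof (rule integral_dominated_convergence[where w = "\<lambda>x. (2 * B)\<^sup>2 * (cmod (l x))\<^sup>2"])
    show "integrable (lebesgue_on \<Omega>) (\<lambda>x. (2 * B)\<^sup>2 * (cmod (l x))\<^sup>2)"
      using L2D(2)[OF L2_limD(1)[OF f]] by simp
    show "(\<lambda>x. (cmod (l x * (a j x - b x)))\<^sup>2) \<in> borel_measurable (lebesgue_on \<Omega>)" for j
      using G[of j] by simp
    show "AE x in lebesgue_on \<Omega>. (\<lambda>j. (cmod (l x * (a j x - b x)))\<^sup>2) \<longlonglongrightarrow> 0"
      using lim
    proof eventually_elim
      case (elim x)
      then have "(\<lambda>j. (cmod (l x * (a j x - b x)))\<^sup>2) \<longlonglongrightarrow> (cmod (l x * (b x - b x)))\<^sup>2"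
        by (intro tendsto_intros)
      then show ?case by simp
    qed
    show "AE x in lebesgue_on \<Omega>. norm ((cmod (l x * (a j x - b x)))\<^sup>2) \<le> (2 * B)\<^sup>2 * (cmod (l x))\<^sup>2" for j
    proof (rule AE_I2)
      fix x assume "x \<in> space (lebesgue_on \<Omega>)"
      then have "(cmod (a j x - b x))\<^sup>2 \<le> (2 * B)\<^sup>2" using ab[of x j] by (intro power_mono) (auto simp: space_restrict_space)
      then show "norm ((cmod (l x * (a j x - b x)))\<^sup>2) \<le> (2 * B)\<^sup>2 * (cmod (l x))\<^sup>2"
        by (simp add: norm_mult power_mult_distrib mult.commute[of "4 * B\<^sup>2"] mult_left_mono)
    qed
  qed simp
  then have "(\<lambda>j. 2 * (B\<^sup>2 * (LINT x|lebesgue_on \<Omega>. (cmod (f j x - l x))\<^sup>2)) + 2 * (LINT x|lebesgue_on \<Omega>. (cmod (l x * (a j x - b x)))\<^sup>2)) \<longlonglongrightarrow> 2 * (B\<^sup>2 * 0) + 2 * 0"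
    by (intro tendsto_intros L2_limD(3) f) simp
  then show "(\<lambda>j. LINT x|lebesgue_on \<Omega>. 2 * (B\<^sup>2 * (cmod (f j x - l x))\<^sup>2) + 2 * (cmod (l x * (a j x - b x)))\<^sup>2) \<longlonglongrightarrow> 0"
    using F G by simp
  show "(cmod (f j x * a j x - l x * b x))\<^sup>2 \<le> 2 * (B\<^sup>2 * (cmod (f j x - l x))\<^sup>2) + 2 * (cmod (l x * (a j x - b x)))\<^sup>2"
    if x: "x \<in> \<Omega>" for j x
  proof -
    have "(cmod (f j x * a j x - l x * b x))\<^sup>2 \<le> 2 * (cmod ((f j x - l x) * a j x))\<^sup>2 + 2 * (cmod (l x * (a j x - b x)))\<^sup>2"
      using norm_add_square_le[of "(f j x - l x) * a j x" "l x * (a j x - b x)"] by (simp add: algebra_simps)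
    also have "(cmod (a j x))\<^sup>2 \<le> B\<^sup>2" using aB[OF x, of j] by (intro power_mono) auto
    then have "(cmod ((f j x - l x) * a j x))\<^sup>2 \<le> B\<^sup>2 * (cmod (f j x - l x))\<^sup>2"
      by (simp add: norm_mult power_mult_distrib mult.commute[of "B\<^sup>2"] mult_left_mono)
    finally show ?thesis by simp
  qed
  show "(\<lambda>x. l x * b x) \<in> L2 \<Omega>" by (intro L2_mult_bounded[OF L2_limD(1)[OF f] a(2) bB])
  show "(\<lambda>x. f j x * a j x) \<in> L2 \<Omega>" for j by (intro L2_mult_bounded[OF L2_limD(2)[OF f] a(1) aB])
qed

lemma L2_lim_pairing:
  assumes f: "L2_lim \<Omega> f l" and w: "w \<in> L2 \<Omega>"
  shows "(\<lambda>j. LINT x|lebesgue_on \<Omega>. f j x * w x) \<longlonglongrightarrow> (LINT x|lebesgue_on \<Omega>. l x * w x)"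
proof (rule LIMSEQ_I)
  fix e :: real assume e: "e > 0"
  define W where "W = (LINT x|lebesgue_on \<Omega>. (cmod (w x))\<^sup>2)"
  \<comment> \<open>Young's inequality with weight \<open>c\<close> replaces Cauchy-Schwarz. The
    weight makes \<open>c * W\<close> less than \<open>e / 2\<close>, with \<open>W + 1\<close>
    guarding against \<open>W = 0\<close>; the remaining term is below \<open>e / 2\<close> once the
    squared distance is below \<open>c * (e / 2)\<close>.\<close>
  define c where "c = e / (2 * (W + 1))"
  have W: "W \<ge> 0" by (simp add: W_def)
  have c: "c > 0" unfolding c_def by (rule divide_pos_pos[OF e mult_pos_pos[OF _ add_nonneg_pos[OF W]]]) simp_all
  have cW: "c * W < e / 2"
    using e W by (simp add: c_def field_simps)
  obtain N where N: "\<And>j. j \<ge> N \<Longrightarrow> (LINT x|lebesgue_on \<Omega>. (cmod (f j x - l x))\<^sup>2) < c * (e / 2)"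
    using order_tendstoD(2)[OF L2_limD(3)[OF f], of "c * (e/2)"] c e unfolding eventually_sequentially by auto
  show "\<exists>N. \<forall>j\<ge>N. norm ((LINT x|lebesgue_on \<Omega>. f j x * w x) - (LINT x|lebesgue_on \<Omega>. l x * w x)) < e"
  proof (intro exI allI impI)
    fix j assume j: "j \<ge> N"
    have D: "(\<lambda>x. f j x - l x) \<in> L2 \<Omega>" using f by (intro L2_diff L2_limD)
    have "norm ((LINT x|lebesgue_on \<Omega>. f j x * w x) - (LINT x|lebesgue_on \<Omega>. l x * w x)) =
        norm (LINT x|lebesgue_on \<Omega>. (f j x - l x) * w x)"
      unfolding left_diff_distrib
      by (subst Bochner_Integration.integral_diff) (intro L2_integrable_mult L2_limD[OF f] w refl)+
    also have "\<dots> \<le> (LINT x|lebesgue_on \<Omega>. (cmod (f j x - l x))\<^sup>2 / c + c * (cmod (w x))\<^sup>2)"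
    proof (rule Bochner_Integration.integral_norm_bound_integral)
      show "integrable (lebesgue_on \<Omega>) (\<lambda>x. (f j x - l x) * w x)" by (rule L2_integrable_mult[OF D w])
      show "integrable (lebesgue_on \<Omega>) (\<lambda>x. (cmod (f j x - l x))\<^sup>2 / c + c * (cmod (w x))\<^sup>2)"
        using L2D(2)[OF D] L2D(2)[OF w] by simp
      fix x
      have "2 * (cmod (f j x - l x) / sqrt c) * (sqrt c * cmod (w x)) \<le> (cmod (f j x - l x) / sqrt c)\<^sup>2 + (sqrt c * cmod (w x))\<^sup>2"
        by (rule sum_squares_bound)
      then have "2 * (cmod (f j x - l x) * cmod (w x)) \<le> (cmod (f j x - l x))\<^sup>2 / c + c * (cmod (w x))\<^sup>2"
        using c by (simp add: power_mult_distrib power_divide)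
      moreover have "0 \<le> cmod (f j x - l x) * cmod (w x)" by simp
      ultimately show "norm ((f j x - l x) * w x) \<le> (cmod (f j x - l x))\<^sup>2 / c + c * (cmod (w x))\<^sup>2"
        unfolding norm_mult by linarith
    qed
    also have "\<dots> = (LINT x|lebesgue_on \<Omega>. (cmod (f j x - l x))\<^sup>2) / c + c * W"
      using L2D(2)[OF D] L2D(2)[OF w] by (simp add: W_def)
    also have "\<dots> < e / 2 + e / 2"
      using N[OF j] cW c by (intro add_strict_mono) (auto simp: pos_divide_less_eq mult.commute)
    finally show "norm ((LINT x|lebesgue_on \<Omega>. f j x * w x) - (LINT x|lebesgue_on \<Omega>. l x * w x)) < e" by simp
  qed
qed

text \<open>The weights \<open>2^n\<close> sit between 1 and \<open>4^n\<close>: the weighted series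
  \<open>h\<close> is still integrable, and Cauchy-Schwarz with the summable \<open>(1/2)^n\<close>
  bounds the square of every partial sum by \<open>2 * h\<close>. So \<open>h\<close> yields a.e.
  convergence and a majorant at the same time.\<close>

lemma L2_series:
  assumes f: "\<And>n. f n \<in> L2 \<Omega>"
    and small: "\<And>n. (LINT x|lebesgue_on \<Omega>. (cmod (f n x))\<^sup>2) \<le> (1/4)^n"
  obtains s where "L2_lim \<Omega> (\<lambda>n x. \<Sum>i<n. f i x) s" "AE x in lebesgue_on \<Omega>. (\<lambda>n. f n x) sums s x"
proof -
  define h where "h x = (\<Sum>n. 2^n * (cmod (f n x))\<^sup>2)" for x
  define s where "s x = (\<Sum>n. f n x)" for x
  have fm [measurable]: "f n \<in> borel_measurable (lebesgue_on \<Omega>)" for n by (rule L2D(1)[OF f])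
  have i: "integrable (lebesgue_on \<Omega>) (\<lambda>x. 2^n * (cmod (f n x))\<^sup>2)" for n
    using L2D(2)[OF f] by simp
  have le: "(LINT x|lebesgue_on \<Omega>. norm (2^n * (cmod (f n x))\<^sup>2)) \<le> (1/2)^n" for n
  proof -
    have "(LINT x|lebesgue_on \<Omega>. norm (2^n * (cmod (f n x))\<^sup>2)) = 2^n * (LINT x|lebesgue_on \<Omega>. (cmod (f n x))\<^sup>2)"
      by simp
    also have "\<dots> \<le> 2^n * (1/4)^n" by (intro mult_left_mono small) auto
    also have "\<dots> = (1/2)^n" by (simp flip: power_mult_distrib)
    finally show ?thesis .
  qed
  have summ: "summable (\<lambda>n. LINT x|lebesgue_on \<Omega>. norm (2^n * (cmod (f n x))\<^sup>2))"
    by (rule summable_comparison_test'[where N = 0 and g = "\<lambda>n. (1/2)^n"]) (use le in auto)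
  have AEs: "AE x in lebesgue_on \<Omega>. summable (\<lambda>n. norm (2^n * (cmod (f n x))\<^sup>2))"
  proof -
    have "(\<Sum>n. \<integral>\<^sup>+x. ennreal (norm (2^n * (cmod (f n x))\<^sup>2)) \<partial>lebesgue_on \<Omega>) = (\<Sum>n. ennreal (LINT x|lebesgue_on \<Omega>. norm (2^n * (cmod (f n x))\<^sup>2)))"
      using i by (intro suminf_cong nn_integral_eq_integral) auto
    also have "\<dots> = ennreal (\<Sum>n. LINT x|lebesgue_on \<Omega>. norm (2^n * (cmod (f n x))\<^sup>2))"
      by (rule suminf_ennreal2[OF _ summ]) simp
    finally have "(\<integral>\<^sup>+x. (\<Sum>n. ennreal (norm (2^n * (cmod (f n x))\<^sup>2))) \<partial>lebesgue_on \<Omega>) < \<infinity>"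
      by (subst nn_integral_suminf) auto
    then have "AE x in lebesgue_on \<Omega>. (\<Sum>n. ennreal (norm (2^n * (cmod (f n x))\<^sup>2))) \<noteq> \<infinity>"
      by (intro nn_integral_PInf_AE) auto
    then show ?thesis
      by eventually_elim (intro summable_suminf_not_top, auto)
  qed
  have hi: "integrable (lebesgue_on \<Omega>) h"
    unfolding h_def by (rule integrable_suminf[OF i AEs summ])
  have key: "summable (\<lambda>n. f n x) \<and> (\<forall>N. (cmod (\<Sum>n<N. f n x))\<^sup>2 \<le> 2 * h x) \<and> (cmod (s x))\<^sup>2 \<le> 2 * h x"
    if S: "summable (\<lambda>n. norm (2^n * (cmod (f n x))\<^sup>2))" for x
  proof -
    have S': "summable (\<lambda>n. 2^n * (cmod (f n x))\<^sup>2)" using S by simp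
    have bound: "(cmod (\<Sum>n<N. f n x))\<^sup>2 \<le> 2 * h x" for N
    proof -
      have "cmod (\<Sum>n<N. f n x) \<le> (\<Sum>n<N. sqrt ((1/2)^n) * (sqrt (2^n) * cmod (f n x)))"
        by (intro sum_norm_le) (simp add: real_sqrt_mult[symmetric] power_mult_distrib[symmetric] mult.assoc[symmetric])
      then have "(cmod (\<Sum>n<N. f n x))\<^sup>2 \<le> (\<Sum>n<N. sqrt ((1/2)^n) * (sqrt (2^n) * cmod (f n x)))\<^sup>2"
        by (intro power_mono) auto
      also have "\<dots> \<le> (\<Sum>n<N. (sqrt ((1/2)^n))\<^sup>2) * (\<Sum>n<N. (sqrt (2^n) * cmod (f n x))\<^sup>2)"
        by (rule Cauchy_Schwarz_ineq_sum)
      also have "\<dots> = (\<Sum>n<N. (1/2)^n) * (\<Sum>n<N. 2^n * (cmod (f n x))\<^sup>2)"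
        by (simp add: power_mult_distrib)
      also have "\<dots> \<le> 2 * h x"
      proof (rule mult_mono)
        show "(\<Sum>n<N. (1/2::real)^n) \<le> 2"
          using sum_le_suminf[of "\<lambda>n. (1/2::real)^n" "{..<N}"] by (simp add: suminf_geometric)
        show "(\<Sum>n<N. 2^n * (cmod (f n x))\<^sup>2) \<le> h x"
          unfolding h_def using S' by (intro sum_le_suminf) auto
      qed (auto intro: sum_nonneg)
      finally show ?thesis .
    qed
    have "summable (\<lambda>n. f n x)"
    proof (rule summable_norm_cancel, rule summable_comparison_test'[where N = 0])
      show "summable (\<lambda>n. (1/2)^n + 2^n * (cmod (f n x))\<^sup>2)"
        using S' by (intro summable_add) auto
      fix n
      have "2 * sqrt ((1/2)^n) * (sqrt (2^n) * cmod (f n x)) \<le> (sqrt ((1/2)^n))\<^sup>2 + (sqrt (2^n) * cmod (f n x))\<^sup>2"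
        by (rule sum_squares_bound)
      moreover have "sqrt ((1/2)^n) * (sqrt (2^n) * cmod (f n x)) = cmod (f n x)"
        by (simp add: real_sqrt_mult[symmetric] power_mult_distrib[symmetric] mult.assoc[symmetric])
      ultimately have "2 * cmod (f n x) \<le> (1/2)^n + 2^n * (cmod (f n x))\<^sup>2"
        by (simp add: power_mult_distrib mult.assoc)
      then show "norm (norm (f n x)) \<le> (1/2)^n + 2^n * (cmod (f n x))\<^sup>2"
        using norm_ge_zero[of "f n x"] unfolding real_norm_def by linarith
    qed
    moreover from this have "(\<lambda>N. (cmod (\<Sum>n<N. f n x))\<^sup>2) \<longlonglongrightarrow> (cmod (s x))\<^sup>2"
      unfolding s_def by (intro tendsto_intros summable_LIMSEQ)
    then have "(cmod (s x))\<^sup>2 \<le> 2 * h x"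
      by (rule LIMSEQ_le_const2) (use bound in auto)
    ultimately show ?thesis using bound by blast
  qed
  have sm: "s \<in> borel_measurable (lebesgue_on \<Omega>)" unfolding s_def by measurable
  have "s \<in> L2 \<Omega>"
  proof (rule L2_bound[OF sm])
    show "integrable (lebesgue_on \<Omega>) (\<lambda>x. 2 * h x)" using hi by simp
    show "AE x in lebesgue_on \<Omega>. (cmod (s x))\<^sup>2 \<le> 2 * h x"
      using AEs by eventually_elim (use key in blast)
  qed
  moreover have "(\<lambda>x. \<Sum>i<n. f i x) \<in> L2 \<Omega>" for n by (intro L2_sum f)
  \<comment> \<open>The constant 8 is \<open>2 * 2 + 2 * 2\<close>: the squared triangle inequality
    is applied to two terms whose squares are at most \<open>2 * h\<close>.\<close>
  moreover have "(\<lambda>n. LINT x|lebesgue_on \<Omega>. (cmod ((\<Sum>i<n. f i x) - s x))\<^sup>2) \<longlonglongrightarrow> (LINT x|lebesgue_on \<Omega>. 0)"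
  proof (rule integral_dominated_convergence[where w = "\<lambda>x. 8 * h x"])
    show "integrable (lebesgue_on \<Omega>) (\<lambda>x. 8 * h x)" using hi by simp
    show "(\<lambda>x. (cmod ((\<Sum>i<n. f i x) - s x))\<^sup>2) \<in> borel_measurable (lebesgue_on \<Omega>)" for n
      using sm by measurable
    show "AE x in lebesgue_on \<Omega>. (\<lambda>n. (cmod ((\<Sum>i<n. f i x) - s x))\<^sup>2) \<longlonglongrightarrow> 0"
      using AEs
    proof eventually_elim
      case (elim x)
      then have "(\<lambda>n. (cmod ((\<Sum>i<n. f i x) - s x))\<^sup>2) \<longlonglongrightarrow> (cmod (s x - s x))\<^sup>2"
        unfolding s_def using key by (intro tendsto_intros summable_LIMSEQ) blast
      then show ?case by simp
    qed
    show "AE x in lebesgue_on \<Omega>. norm ((cmod ((\<Sum>i<n. f i x) - s x))\<^sup>2) \<le> 8 * h x" for n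
      using AEs
    proof eventually_elim
      case (elim x)
      have "(cmod ((\<Sum>i<n. f i x) - s x))\<^sup>2 \<le> 2 * (cmod (\<Sum>i<n. f i x))\<^sup>2 + 2 * (cmod (s x))\<^sup>2"
        using norm_add_square_le[of "\<Sum>i<n. f i x" "- s x"] by simp
      moreover have "(cmod (\<Sum>i<n. f i x))\<^sup>2 \<le> 2 * h x" "(cmod (s x))\<^sup>2 \<le> 2 * h x"
        using key[OF elim] by auto
      ultimately show ?case by simp
    qed
  qed simp
  ultimately have "L2_lim \<Omega> (\<lambda>n x. \<Sum>i<n. f i x) s" by (simp add: L2_lim_def)
  moreover have "AE x in lebesgue_on \<Omega>. (\<lambda>n. f n x) sums s x"
    using AEs by eventually_elim (unfold s_def, rule summable_sums, use key in blast)
  ultimately show thesis by (rule that)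
qed

section \<open>Sobolev functions\<close>

text \<open>Carrying the weak gradient as an argument allows explicit computation with it; the
  arbitrary choice inside \<open>weak_partial\<close> is met only when \<open>H1_norm\<close> is
  evaluated.\<close>

definition sobolev ::
  "(real^'n::finite) set \<Rightarrow> (real^'n \<Rightarrow> complex) \<Rightarrow> ('n \<Rightarrow> real^'n \<Rightarrow> complex) \<Rightarrow> bool" where
  "sobolev \<Omega> u g \<longleftrightarrow> u \<in> L2 \<Omega> \<and> (\<forall>k. g k \<in> L2 \<Omega> \<and> is_weak_partial \<Omega> k u (g k))"

lemma sobolevD:
  assumes "sobolev \<Omega> u g"
  shows "u \<in> L2 \<Omega>" "g k \<in> L2 \<Omega>" "is_weak_partial \<Omega> k u (g k)"
  using assms by (auto simp: sobolev_def)

lemma H1_iff_sobolev: "u \<in> H1 \<Omega> \<longleftrightarrow> (\<exists>g. sobolev \<Omega> u g)"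
proof
  assume u: "u \<in> H1 \<Omega>"
  then have "\<exists>g. \<forall>k. g k \<in> L2 \<Omega> \<and> is_weak_partial \<Omega> k u (g k)"
    unfolding H1_def mem_Collect_eq Bex_def by (intro choice) blast
  with u show "\<exists>g. sobolev \<Omega> u g" unfolding sobolev_def H1_def by blast
next
  assume "\<exists>g. sobolev \<Omega> u g"
  then show "u \<in> H1 \<Omega>" unfolding sobolev_def H1_def by blast
qed

lemma sobolev_add:
  assumes "open \<Omega>" "sobolev \<Omega> u g" "sobolev \<Omega> w h"
  shows "sobolev \<Omega> (\<lambda>x. u x + w x) (\<lambda>k x. g k x + h k x)"
  using assms by (simp add: sobolev_def L2_add is_weak_partial_add)

lemma sobolev_mult_smooth:
  assumes "open \<Omega>" and u: "sobolev \<Omega> u g" and s: "smooth s"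
    and B: "\<And>x. x \<in> \<Omega> \<Longrightarrow> cmod (s x) \<le> B" and B': "\<And>k x. x \<in> \<Omega> \<Longrightarrow> cmod (partial k s x) \<le> B' k"
  shows "sobolev \<Omega> (\<lambda>x. u x * s x) (\<lambda>k x. g k x * s x + u x * partial k s x)"
  unfolding sobolev_def
proof (intro conjI allI)
  have m: "s \<in> borel_measurable (lebesgue_on \<Omega>)" "partial k s \<in> borel_measurable (lebesgue_on \<Omega>)" for k
    by (intro smooth_measurable_lebesgue_on smooth_partial s)+
  show "(\<lambda>x. u x * s x) \<in> L2 \<Omega>" by (rule L2_mult_bounded[OF sobolevD(1)[OF u] m(1) B])
  show "(\<lambda>x. g k x * s x + u x * partial k s x) \<in> L2 \<Omega>" for k
    by (intro L2_add L2_mult_bounded[OF sobolevD(1)[OF u] m(2) B'] L2_mult_bounded[OF sobolevD(2)[OF u] m(1) B])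
  show "is_weak_partial \<Omega> k (\<lambda>x. u x * s x) (\<lambda>x. g k x * s x + u x * partial k s x)" for k
    by (rule is_weak_partial_mult_smooth[OF sobolevD(3)[OF u] s \<open>open \<Omega>\<close>])
qed

lemma sobolev_smooth:
  assumes "open \<Omega>" "bounded \<Omega>" "smooth s"
  shows "sobolev \<Omega> s (\<lambda>k. partial k s)"
  using assms by (simp add: sobolev_def L2_smooth smooth_partial is_weak_partial_smooth)

lemma sobolev_cmult:
  assumes "open \<Omega>" "sobolev \<Omega> u g"
  shows "sobolev \<Omega> (\<lambda>x. c * u x) (\<lambda>k x. c * g k x)"
  using sobolev_mult_smooth[OF assms smooth_const[of c], of "cmod c" "\<lambda>k. 0"] by (simp add: mult.commute)

lemma sobolev_diff:
  assumes "open \<Omega>" "sobolev \<Omega> u g" "sobolev \<Omega> w h"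
  shows "sobolev \<Omega> (\<lambda>x. u x - w x) (\<lambda>k x. g k x - h k x)"
  using sobolev_add[OF assms(1,2) sobolev_cmult[OF assms(1,3), of "-1"]] by simp

lemma sobolev_cong_AE:
  assumes "open \<Omega>" and u: "sobolev \<Omega> u g" and eq: "AE x in lebesgue_on \<Omega>. u x = w x"
  shows "sobolev \<Omega> w g"
  unfolding sobolev_def
proof (intro conjI allI)
  show "w \<in> L2 \<Omega>" using \<open>open \<Omega>\<close> by (intro L2_cong_AE[OF sobolevD(1)[OF u] _ eq]) auto
  show "g k \<in> L2 \<Omega>" for k by (rule sobolevD(2)[OF u])
  show "is_weak_partial \<Omega> k w (g k)" for k
    by (rule is_weak_partial_cong_AE[OF sobolevD(3)[OF u] \<open>open \<Omega>\<close> eq]) simp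
qed

section \<open>The space \<open>H1\<close> and its norm\<close>

lemma H1_cong:
  assumes "open \<Omega>" "u \<in> H1 \<Omega>" "\<And>x. x \<in> \<Omega> \<Longrightarrow> u x = w x"
  shows "w \<in> H1 \<Omega>"
proof -
  obtain g where "sobolev \<Omega> u g" using assms(2) H1_iff_sobolev by blast
  then have "sobolev \<Omega> w g"
    by (rule sobolev_cong_AE[OF assms(1)]) (intro AE_I2, simp add: space_restrict_space assms(3))
  then show ?thesis using H1_iff_sobolev by blast
qed

lemma H1_add: "open \<Omega> \<Longrightarrow> u \<in> H1 \<Omega> \<Longrightarrow> w \<in> H1 \<Omega> \<Longrightarrow> (\<lambda>x. u x + w x) \<in> H1 \<Omega>"
  unfolding H1_iff_sobolev using sobolev_add by blast

lemma H1_diff: "open \<Omega> \<Longrightarrow> u \<in> H1 \<Omega> \<Longrightarrow> w \<in> H1 \<Omega> \<Longrightarrow> (\<lambda>x. u x - w x) \<in> H1 \<Omega>"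
  unfolding H1_iff_sobolev using sobolev_diff by blast

lemma H1_smooth: "open \<Omega> \<Longrightarrow> bounded \<Omega> \<Longrightarrow> smooth s \<Longrightarrow> s \<in> H1 \<Omega>"
  unfolding H1_iff_sobolev using sobolev_smooth by blast

text \<open>The gradient selected by \<open>SOME\<close> agrees a.e. with any known one, by
  uniqueness of weak derivatives.\<close>

lemma H1_norm_eq:
  assumes "open \<Omega>" and u: "sobolev \<Omega> u g"
  shows "(H1_norm \<Omega> u)\<^sup>2 = (LINT x|lebesgue_on \<Omega>. (cmod (u x))\<^sup>2) + (\<Sum>k\<in>UNIV. LINT x|lebesgue_on \<Omega>. (cmod (g k x))\<^sup>2)"
proof -
  have "(LINT x|lebesgue_on \<Omega>. (cmod (weak_partial \<Omega> k u x))\<^sup>2) = (LINT x|lebesgue_on \<Omega>. (cmod (g k x))\<^sup>2)" for k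
  proof (rule integral_lebesgue_on_cong_AE[symmetric])
    have w: "is_weak_partial \<Omega> k u (weak_partial \<Omega> k u)"
      unfolding weak_partial_def by (rule someI[where P = "is_weak_partial \<Omega> k u", OF sobolevD(3)[OF u]])
    show "AE x in lebesgue_on \<Omega>. (cmod (g k x))\<^sup>2 = (cmod (weak_partial \<Omega> k u x))\<^sup>2"
      using is_weak_partial_unique[OF sobolevD(3)[OF u] w \<open>open \<Omega>\<close>] by eventually_elim simp
    show "(\<lambda>x. (cmod (g k x))\<^sup>2) \<in> borel_measurable (lebesgue_on \<Omega>)"
      using L2D(2)[OF sobolevD(2)[OF u]] by (rule borel_measurable_integrable)
    show "\<Omega> \<in> sets lebesgue" using \<open>open \<Omega>\<close> by simp
  qed
  then have "H1_norm \<Omega> u = sqrt ((LINT x|lebesgue_on \<Omega>. (cmod (u x))\<^sup>2) + (\<Sum>k\<in>UNIV. LINT x|lebesgue_on \<Omega>. (cmod (g k x))\<^sup>2))"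
    by (simp add: H1_norm_def)
  moreover have "0 \<le> (LINT x|lebesgue_on \<Omega>. (cmod (u x))\<^sup>2) + (\<Sum>k\<in>UNIV. LINT x|lebesgue_on \<Omega>. (cmod (g k x))\<^sup>2)"
    by (intro add_nonneg_nonneg sum_nonneg integral_nonneg) auto
  ultimately show ?thesis by simp
qed

lemma H1_norm_cong:
  assumes "open \<Omega>" and u: "u \<in> H1 \<Omega>" and eq: "\<And>x. x \<in> \<Omega> \<Longrightarrow> u x = w x"
  shows "(H1_norm \<Omega> u)\<^sup>2 = (H1_norm \<Omega> w)\<^sup>2"
proof -
  obtain g where g: "sobolev \<Omega> u g" using u H1_iff_sobolev by blast
  have w: "sobolev \<Omega> w g"
    by (rule sobolev_cong_AE[OF \<open>open \<Omega>\<close> g]) (intro AE_I2, simp add: space_restrict_space eq)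
  have "(LINT x|lebesgue_on \<Omega>. (cmod (u x))\<^sup>2) = (LINT x|lebesgue_on \<Omega>. (cmod (w x))\<^sup>2)"
    by (rule Bochner_Integration.integral_cong) (simp_all add: space_restrict_space eq)
  then show ?thesis
    unfolding H1_norm_eq[OF \<open>open \<Omega>\<close> g] H1_norm_eq[OF \<open>open \<Omega>\<close> w] by simp
qed

lemma H1_norm_le:
  assumes "open \<Omega>" and u: "sobolev \<Omega> u g"
  shows "(LINT x|lebesgue_on \<Omega>. (cmod (u x))\<^sup>2) \<le> (H1_norm \<Omega> u)\<^sup>2"
    and "(LINT x|lebesgue_on \<Omega>. (cmod (g k x))\<^sup>2) \<le> (H1_norm \<Omega> u)\<^sup>2"
proof -
  have u0: "0 \<le> (LINT x|lebesgue_on \<Omega>. (cmod (u x))\<^sup>2)" by simp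
  have g0: "0 \<le> (LINT x|lebesgue_on \<Omega>. (cmod (g k x))\<^sup>2)" for k by simp
  have "(LINT x|lebesgue_on \<Omega>. (cmod (g k x))\<^sup>2) \<le> (\<Sum>k\<in>UNIV. LINT x|lebesgue_on \<Omega>. (cmod (g k x))\<^sup>2)"
    by (rule member_le_sum) auto
  with u0 show "(LINT x|lebesgue_on \<Omega>. (cmod (g k x))\<^sup>2) \<le> (H1_norm \<Omega> u)\<^sup>2"
    unfolding H1_norm_eq[OF assms] by linarith
  have "0 \<le> (\<Sum>k\<in>UNIV. LINT x|lebesgue_on \<Omega>. (cmod (g k x))\<^sup>2)" by (rule sum_nonneg) simp
  then show "(LINT x|lebesgue_on \<Omega>. (cmod (u x))\<^sup>2) \<le> (H1_norm \<Omega> u)\<^sup>2"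
    unfolding H1_norm_eq[OF assms] by linarith
qed

lemma H1_norm_add:
  assumes "open \<Omega>" and u: "u \<in> H1 \<Omega>" and w: "w \<in> H1 \<Omega>"
  shows "(H1_norm \<Omega> (\<lambda>x. u x + w x))\<^sup>2 \<le> 2 * (H1_norm \<Omega> u)\<^sup>2 + 2 * (H1_norm \<Omega> w)\<^sup>2"
proof -
  obtain g h where g: "sobolev \<Omega> u g" and h: "sobolev \<Omega> w h"
    using u w unfolding H1_iff_sobolev by blast
  have le: "(LINT x|lebesgue_on \<Omega>. (cmod (p x + q x))\<^sup>2) \<le>
      2 * (LINT x|lebesgue_on \<Omega>. (cmod (p x))\<^sup>2) + 2 * (LINT x|lebesgue_on \<Omega>. (cmod (q x))\<^sup>2)"
    if p: "p \<in> L2 \<Omega>" and q: "q \<in> L2 \<Omega>" for p q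
  proof -
    have "(LINT x|lebesgue_on \<Omega>. (cmod (p x + q x))\<^sup>2) \<le> (LINT x|lebesgue_on \<Omega>. 2 * (cmod (p x))\<^sup>2 + 2 * (cmod (q x))\<^sup>2)"
      using L2D(2)[OF L2_add[OF p q]] L2D(2)[OF p] L2D(2)[OF q]
      by (intro integral_mono) (auto simp: norm_add_square_le)
    also have "\<dots> = 2 * (LINT x|lebesgue_on \<Omega>. (cmod (p x))\<^sup>2) + 2 * (LINT x|lebesgue_on \<Omega>. (cmod (q x))\<^sup>2)"
      using L2D(2)[OF p] L2D(2)[OF q] by simp
    finally show ?thesis .
  qed
  have "(\<Sum>k\<in>UNIV. LINT x|lebesgue_on \<Omega>. (cmod (g k x + h k x))\<^sup>2) \<le>
      (\<Sum>k\<in>UNIV. 2 * (LINT x|lebesgue_on \<Omega>. (cmod (g k x))\<^sup>2) + 2 * (LINT x|lebesgue_on \<Omega>. (cmod (h k x))\<^sup>2))"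
    by (intro sum_mono le sobolevD(2)[OF g] sobolevD(2)[OF h])
  then show ?thesis
    using le[OF sobolevD(1)[OF g] sobolevD(1)[OF h]]
    unfolding H1_norm_eq[OF assms(1) sobolev_add[OF assms(1) g h]] H1_norm_eq[OF assms(1) g] H1_norm_eq[OF assms(1) h]
    by (simp add: sum.distrib sum_distrib_left)
qed

text \<open>The weak gradient is a closed operator: both sides of its defining identity are pairings
  with fixed \<open>L2\<close> functions and hence continuous under \<open>L2\<close>
  convergence.\<close>

lemma sobolev_lim:
  assumes \<Omega>: "open \<Omega>" "bounded \<Omega>" and s: "\<And>j. sobolev \<Omega> (f j) (g j)"
    and f: "L2_lim \<Omega> f u" and g: "\<And>k. L2_lim \<Omega> (\<lambda>j. g j k) (h k)"
  shows "sobolev \<Omega> u h"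
  unfolding sobolev_def is_weak_partial_def
proof (intro conjI allI ballI)
  show "u \<in> L2 \<Omega>" by (rule L2_limD(1)[OF f])
  show "h k \<in> L2 \<Omega>" for k by (rule L2_limD(1)[OF g])
  show "locally_integrable \<Omega> u" by (intro L2_locally_integrable \<Omega> L2_limD(1)[OF f])
  show "locally_integrable \<Omega> (h k)" for k by (intro L2_locally_integrable \<Omega> L2_limD(1)[OF g])
  fix k v assume v: "v \<in> test_functions \<Omega>"
  have "v \<in> L2 \<Omega>" "partial k v \<in> L2 \<Omega>"
    by (intro L2_smooth \<Omega> smooth_partial test_functionsD(1)[OF v])+
  have 1: "(\<lambda>j. LINT x|lebesgue_on \<Omega>. f j x * partial k v x) \<longlonglongrightarrow> (LINT x|lebesgue_on \<Omega>. u x * partial k v x)"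
    by (rule L2_lim_pairing[OF f]) fact
  have "(\<lambda>j. - (LINT x|lebesgue_on \<Omega>. g j k x * v x)) \<longlonglongrightarrow> - (LINT x|lebesgue_on \<Omega>. h k x * v x)"
    by (intro tendsto_minus L2_lim_pairing[OF g]) fact
  then have 2: "(\<lambda>j. LINT x|lebesgue_on \<Omega>. f j x * partial k v x) \<longlonglongrightarrow> - (LINT x|lebesgue_on \<Omega>. h k x * v x)"
    using is_weak_partialD(3)[OF sobolevD(3)[OF s] v] by simp
  show "(LINT x|lebesgue_on \<Omega>. u x * partial k v x) = - (LINT x|lebesgue_on \<Omega>. h k x * v x)"
    by (rule LIMSEQ_unique[OF 1 2])
qed

text \<open>Passing to a subsequence adds a.e. convergence to the convergence in \<open>H1\<close>.
  It is needed because continuous functions of the approximants, such as cutoffs, are handled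
  pointwise.\<close>

lemma H1_0_approx:
  assumes \<Omega>: "open \<Omega>" "bounded \<Omega>" and z: "z \<in> H1_0 \<Omega>"
  obtains g \<psi> where "sobolev \<Omega> z g" "\<And>j. \<psi> j \<in> test_functions \<Omega>" "L2_lim \<Omega> \<psi> z"
    "\<And>k. L2_lim \<Omega> (\<lambda>j. partial k (\<psi> j)) (g k)" "AE x in lebesgue_on \<Omega>. (\<lambda>j. \<psi> j x) \<longlonglongrightarrow> z x"
proof -
  obtain g where g: "sobolev \<Omega> z g" using z by (auto simp: H1_0_def H1_iff_sobolev)
  have "\<exists>v\<in>test_functions \<Omega>. H1_norm \<Omega> (\<lambda>x. z x - v x) < 1 / real (Suc j)" for j
    using z by (simp add: H1_0_def)
  then obtain v where v: "\<And>j. v j \<in> test_functions \<Omega>" and vz: "\<And>j. H1_norm \<Omega> (\<lambda>x. z x - v j x) < 1 / real (Suc j)"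
    by metis
  have s: "sobolev \<Omega> (\<lambda>x. z x - v j x) (\<lambda>k x. g k x - partial k (v j) x)" for j
    by (intro sobolev_diff sobolev_smooth \<Omega> g test_functionsD(1)[OF v])
  have sq: "(H1_norm \<Omega> (\<lambda>x. z x - v j x))\<^sup>2 \<le> (inverse (real (Suc j)))\<^sup>2" for j
    using vz[of j] by (intro power_mono) (auto simp: H1_norm_def inverse_eq_divide intro!: sum_nonneg add_nonneg_nonneg)
  have lim0: "(\<lambda>j. (inverse (real (Suc j)))\<^sup>2) \<longlonglongrightarrow> 0"
    using tendsto_power[OF LIMSEQ_inverse_real_of_nat, of 2] by simp
  have lim: "L2_lim \<Omega> f l" if f: "\<And>j. f j \<in> L2 \<Omega>" and l: "l \<in> L2 \<Omega>"
    and le: "\<And>j. (LINT x|lebesgue_on \<Omega>. (cmod (l x - f j x))\<^sup>2) \<le> (H1_norm \<Omega> (\<lambda>x. z x - v j x))\<^sup>2" for f l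
    unfolding L2_lim_def
  proof (intro conjI allI l f)
    show "(\<lambda>j. LINT x|lebesgue_on \<Omega>. (cmod (f j x - l x))\<^sup>2) \<longlonglongrightarrow> 0"
    proof (rule tendsto_sandwich[OF _ _ tendsto_const lim0])
      show "\<forall>\<^sub>F j in sequentially. 0 \<le> (LINT x|lebesgue_on \<Omega>. (cmod (f j x - l x))\<^sup>2)" by simp
      show "\<forall>\<^sub>F j in sequentially. (LINT x|lebesgue_on \<Omega>. (cmod (f j x - l x))\<^sup>2) \<le> (inverse (real (Suc j)))\<^sup>2"
        using order_trans[OF le sq] by (intro always_eventually allI) (simp add: norm_minus_commute)
    qed
  qed
  have L: "L2_lim \<Omega> v z"
    by (intro lim H1_norm_le(1)[OF \<Omega>(1) s] L2_smooth \<Omega> test_functionsD(1)[OF v] sobolevD(1)[OF g])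
  have Lk: "L2_lim \<Omega> (\<lambda>j. partial k (v j)) (g k)" for k
    by (intro lim H1_norm_le(2)[OF \<Omega>(1) s] L2_smooth smooth_partial \<Omega> test_functionsD(1)[OF v] sobolevD(2)[OF g])
  have "\<exists>r::nat\<Rightarrow>nat. strict_mono r \<and> (AE x in lebesgue_on \<Omega>. (\<lambda>n. (cmod (v (r n) x - z x))\<^sup>2) \<longlonglongrightarrow> 0)"
    using L2D(2)[OF L2_diff[OF L2_limD(2)[OF L] L2_limD(1)[OF L]]] L2_limD(3)[OF L]
    by (intro tendsto_L1_AE_subseq) auto
  then obtain r where r: "strict_mono r" and ae: "AE x in lebesgue_on \<Omega>. (\<lambda>n. (cmod (v (r n) x - z x))\<^sup>2) \<longlonglongrightarrow> 0"
    by blast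
  have sub: "L2_lim \<Omega> (\<lambda>j. f (r j)) l" if "L2_lim \<Omega> f l" for f l
    using that LIMSEQ_subseq_LIMSEQ[OF L2_limD(3)[OF that] r] by (auto simp: L2_lim_def o_def)
  show thesis
  proof (rule that[of g "\<lambda>j. v (r j)"])
    show "AE x in lebesgue_on \<Omega>. (\<lambda>j. v (r j) x) \<longlonglongrightarrow> z x"
      using ae
    proof eventually_elim
      case (elim x)
      from tendsto_real_sqrt[OF this] have "(\<lambda>n. cmod (v (r n) x - z x)) \<longlonglongrightarrow> 0" by simp
      then show ?case by (simp add: LIM_zero_iff tendsto_norm_zero_iff)
    qed
  qed (use g v sub[OF L] sub[OF Lk] in auto)
qed

section \<open>Multiplication by cutoffs of \<open>H1_0\<close> functions\<close>

lemma cutoffD: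
  fixes \<psi> :: "real^'n::finite \<Rightarrow> complex"
  assumes "cutoff TYPE('n) F H"
  shows "continuous_on UNIV F" "continuous_on UNIV H" "bounded (range H)" "0 \<le> F t" "F t \<le> 1"
    "smooth \<psi> \<Longrightarrow> smooth (\<lambda>x. complex_of_real (F (\<psi> x)))"
    "smooth \<psi> \<Longrightarrow> partial k (\<lambda>x. complex_of_real (F (\<psi> x))) x = of_real (Re (H (\<psi> x) * partial k \<psi> x))"
  using assms unfolding cutoff_def by blast+

lemma sobolev_mult_cutoff:
  fixes \<Omega> :: "(real^'n::finite) set"
  assumes \<Omega>: "open \<Omega>" and D: "sobolev \<Omega> D d" and F: "cutoff TYPE('n) F H"
    and \<psi>: "\<psi> \<in> test_functions \<Omega>"
  shows "sobolev \<Omega> (\<lambda>x. D x * of_real (F (\<psi> x)))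
     (\<lambda>k x. d k x * of_real (F (\<psi> x)) + D x * of_real (Re (H (\<psi> x) * partial k \<psi> x)))"
proof -
  obtain C where C: "\<And>t. cmod (H t) \<le> C" using cutoffD(3)[OF F] unfolding bounded_iff by blast
  have "\<exists>C'. \<forall>x. cmod (partial k \<psi> x) \<le> C'" for k
    using test_functions_bounded[OF test_functions_partial[OF \<psi>]] unfolding bounded_iff by blast
  then obtain C' where C': "\<And>k x. cmod (partial k \<psi> x) \<le> C' k" by metis
  have sm: "smooth \<psi>" by (rule test_functionsD(1)[OF \<psi>])
  have "sobolev \<Omega> (\<lambda>x. D x * of_real (F (\<psi> x)))
     (\<lambda>k x. d k x * of_real (F (\<psi> x)) + D x * partial k (\<lambda>x. of_real (F (\<psi> x))) x)"
  proof (rule sobolev_mult_smooth[OF \<Omega> D cutoffD(6)[OF F sm]])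
    show "cmod (of_real (F (\<psi> x))) \<le> 1" for x using cutoffD(4,5)[OF F, of "\<psi> x"] by simp
    show "cmod (partial k (\<lambda>x. of_real (F (\<psi> x))) x) \<le> C * C' k" for k x
    proof -
      have "\<bar>Re (H (\<psi> x) * partial k \<psi> x)\<bar> \<le> cmod (H (\<psi> x)) * cmod (partial k \<psi> x)"
        using abs_Re_le_cmod[of "H (\<psi> x) * partial k \<psi> x"] by (simp add: norm_mult)
      also have "\<dots> \<le> C * C' k"
        using C[of "\<psi> x"] C'[of k x] order_trans[OF norm_ge_zero C] by (intro mult_mono) auto
      finally show ?thesis unfolding cutoffD(7)[OF F sm] norm_of_real .
    qed
  qed
  then show ?thesis by (simp add: cutoffD(7)[OF F sm])
qed

text \<open>The gradient of the product contains \<open>D\<close> times the gradient of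
  \<open>F(z)\<close>, which is only in \<open>L2\<close>; this is why \<open>D\<close> has to be
  bounded. For test functions \<psi> tending to \<open>z\<close> in \<open>H1\<close> and a.e., the
  products and their gradients converge in \<open>L2\<close>, so closedness gives membership of the
  limit, and the same convergence gives the approximation in \<open>H1\<close>.\<close>

lemma H1_mult_cutoff:
  fixes \<Omega> :: "(real^'n::finite) set"
  assumes \<Omega>: "open \<Omega>" "bounded \<Omega>" and D: "D \<in> H1 \<Omega>" and B: "\<And>x. x \<in> \<Omega> \<Longrightarrow> cmod (D x) \<le> B"
    and z: "z \<in> H1_0 \<Omega>" and F: "cutoff TYPE('n) F H"
  shows "(\<lambda>x. D x * of_real (F (z x))) \<in> H1 \<Omega>"
    and "e > 0 \<Longrightarrow> \<exists>\<psi>\<in>test_functions \<Omega>. (\<lambda>x. D x * of_real (F (\<psi> x))) \<in> H1 \<Omega> \<and>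
      (H1_norm \<Omega> (\<lambda>x. D x * of_real (F (\<psi> x)) - D x * of_real (F (z x))))\<^sup>2 < e"
proof -
  obtain d where d: "sobolev \<Omega> D d" using D H1_iff_sobolev by blast
  obtain g \<psi> where g: "sobolev \<Omega> z g" and \<psi>: "\<And>j. \<psi> j \<in> test_functions \<Omega>" and lim: "L2_lim \<Omega> \<psi> z"
    "\<And>k. L2_lim \<Omega> (\<lambda>j. partial k (\<psi> j)) (g k)" and ae: "AE x in lebesgue_on \<Omega>. (\<lambda>j. \<psi> j x) \<longlonglongrightarrow> z x"
    by (rule H1_0_approx[OF \<Omega> z]) blast
  obtain C where C: "\<And>t. cmod (H t) \<le> C" using cutoffD(3)[OF F] unfolding bounded_iff by blast
  have FH: "isCont F t" "isCont H t" for t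
    using cutoffD(1,2)[OF F] by (auto simp: continuous_on_eq_continuous_at)
  have [measurable]: "F \<in> borel_measurable borel" "H \<in> borel_measurable borel"
    by (intro borel_measurable_continuous_onI cutoffD(1,2)[OF F])+
  have [measurable]: "\<psi> j \<in> borel_measurable (lebesgue_on \<Omega>)" "z \<in> borel_measurable (lebesgue_on \<Omega>)" for j
    by (rule L2D(1)[OF L2_limD(2)[OF lim(1)]] L2D(1)[OF L2_limD(1)[OF lim(1)]])+
  have [measurable]: "D \<in> borel_measurable (lebesgue_on \<Omega>)" by (rule L2D(1)[OF sobolevD(1)[OF d]])
  have F1: "cmod (of_real (F t)) \<le> 1" for t using cutoffD(4,5)[OF F, of t] by simp
  have Fae: "AE x in lebesgue_on \<Omega>. (\<lambda>j. complex_of_real (F (\<psi> j x))) \<longlonglongrightarrow> of_real (F (z x))"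
    using ae by eventually_elim (intro tendsto_of_real isCont_tendsto_compose[OF FH(1)])
  have Hae: "AE x in lebesgue_on \<Omega>. (\<lambda>j. H (\<psi> j x)) \<longlonglongrightarrow> H (z x)"
    using ae by eventually_elim (intro isCont_tendsto_compose[OF FH(2)])
  have limF: "L2_lim \<Omega> (\<lambda>j x. f x * of_real (F (\<psi> j x))) (\<lambda>x. f x * of_real (F (z x)))" if "f \<in> L2 \<Omega>" for f
    by (rule L2_lim_mult[OF L2_lim_const[OF that] _ _ F1 F1 Fae]) measurable
  have limH: "L2_lim \<Omega> (\<lambda>j x. partial k (\<psi> j) x * H (\<psi> j x)) (\<lambda>x. g k x * H (z x))" for k
    by (rule L2_lim_mult[OF lim(2) _ _ C C Hae]) measurable
  \<comment> \<open>Boundedness of \<open>H\<close> gives convergence of the complex products by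
    \<open>limH\<close>; taking real parts does not increase moduli, and multiplying by
    \<open>D\<close> costs at most the factor \<open>B\<close>.\<close>
  have limDH: "L2_lim \<Omega> (\<lambda>j x. D x * of_real (Re (H (\<psi> j x) * partial k (\<psi> j) x))) (\<lambda>x. D x * of_real (Re (H (z x) * g k x)))" for k
  proof (rule L2_lim_bound[where w = "\<lambda>j x. B\<^sup>2 * (cmod (partial k (\<psi> j) x * H (\<psi> j x) - g k x * H (z x)))\<^sup>2"])
    note i = L2D(2)[OF L2_diff[OF L2_limD(2)[OF limH] L2_limD(1)[OF limH]]]
    show "integrable (lebesgue_on \<Omega>) (\<lambda>x. B\<^sup>2 * (cmod (partial k (\<psi> j) x * H (\<psi> j x) - g k x * H (z x)))\<^sup>2)" for j
      using i by simp
    show "(\<lambda>j. LINT x|lebesgue_on \<Omega>. B\<^sup>2 * (cmod (partial k (\<psi> j) x * H (\<psi> j x) - g k x * H (z x)))\<^sup>2) \<longlonglongrightarrow> 0"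
      using tendsto_mult_left[OF L2_limD(3)[OF limH], of "B\<^sup>2"] by simp
    have Re_L2: "(\<lambda>x. D x * of_real (Re (H (f x) * f' x))) \<in> L2 \<Omega>"
      if f: "(\<lambda>x. f' x * H (f x)) \<in> L2 \<Omega>" for f f'
    proof (rule L2_bound)
      have "(\<lambda>x. f' x * H (f x)) \<in> borel_measurable (lebesgue_on \<Omega>)" by (rule L2D(1)[OF f])
      then have "(\<lambda>x. D x * of_real (Re (f' x * H (f x)))) \<in> borel_measurable (lebesgue_on \<Omega>)" by measurable
      then show "(\<lambda>x. D x * of_real (Re (H (f x) * f' x))) \<in> borel_measurable (lebesgue_on \<Omega>)"
        by (simp add: mult.commute)
      show "integrable (lebesgue_on \<Omega>) (\<lambda>x. B\<^sup>2 * (cmod (f' x * H (f x)))\<^sup>2)" using L2D(2)[OF f] by simp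
      show "AE x in lebesgue_on \<Omega>. (cmod (D x * of_real (Re (H (f x) * f' x))))\<^sup>2 \<le> B\<^sup>2 * (cmod (f' x * H (f x)))\<^sup>2"
      proof (rule AE_I2)
        fix x assume "x \<in> space (lebesgue_on \<Omega>)"
        then have "cmod (D x) \<le> B" using B by (simp add: space_restrict_space)
        moreover have "\<bar>Re (H (f x) * f' x)\<bar> \<le> cmod (f' x * H (f x))"
          using abs_Re_le_cmod[of "f' x * H (f x)"] by (simp add: mult.commute)
        ultimately have "cmod (D x) * \<bar>Re (H (f x) * f' x)\<bar> \<le> B * cmod (f' x * H (f x))"
          using order_trans[OF norm_ge_zero] by (intro mult_mono) auto
        then have "(cmod (D x) * \<bar>Re (H (f x) * f' x)\<bar>)\<^sup>2 \<le> (B * cmod (f' x * H (f x)))\<^sup>2"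
          by (intro power_mono) auto
        then show "(cmod (D x * of_real (Re (H (f x) * f' x))))\<^sup>2 \<le> B\<^sup>2 * (cmod (f' x * H (f x)))\<^sup>2"
          by (simp only: norm_mult norm_of_real power_mult_distrib)
      qed
    qed
    show "(\<lambda>x. D x * of_real (Re (H (z x) * g k x))) \<in> L2 \<Omega>" by (rule Re_L2[OF L2_limD(1)[OF limH]])
    show "(\<lambda>x. D x * of_real (Re (H (\<psi> j x) * partial k (\<psi> j) x))) \<in> L2 \<Omega>" for j
      by (rule Re_L2[OF L2_limD(2)[OF limH]])
    fix j x assume x: "x \<in> \<Omega>"
    let ?a = "partial k (\<psi> j) x * H (\<psi> j x)" and ?b = "g k x * H (z x)"
    have "D x * of_real (Re (H (\<psi> j x) * partial k (\<psi> j) x)) - D x * of_real (Re (H (z x) * g k x)) = D x * of_real (Re (?a - ?b))"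
      by (simp add: algebra_simps)
    moreover have "cmod (D x * of_real (Re (?a - ?b))) \<le> B * cmod (?a - ?b)"
      unfolding norm_mult norm_of_real using B[OF x] order_trans[OF norm_ge_zero B[OF x]] abs_Re_le_cmod[of "?a - ?b"]
      by (intro mult_mono) auto
    ultimately have "(cmod (D x * of_real (Re (H (\<psi> j x) * partial k (\<psi> j) x)) - D x * of_real (Re (H (z x) * g k x))))\<^sup>2 \<le> (B * cmod (?a - ?b))\<^sup>2"
      by (intro power_mono) auto
    then show "(cmod (D x * of_real (Re (H (\<psi> j x) * partial k (\<psi> j) x)) - D x * of_real (Re (H (z x) * g k x))))\<^sup>2 \<le> B\<^sup>2 * (cmod (?a - ?b))\<^sup>2"
      by (simp only: power_mult_distrib)
  qed
  let ?p = "\<lambda>j x. D x * of_real (F (\<psi> j x))" and ?q = "\<lambda>x. D x * of_real (F (z x))"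
  let ?P = "\<lambda>j k x. d k x * of_real (F (\<psi> j x)) + D x * of_real (Re (H (\<psi> j x) * partial k (\<psi> j) x))"
  let ?Q = "\<lambda>k x. d k x * of_real (F (z x)) + D x * of_real (Re (H (z x) * g k x))"
  have sp: "sobolev \<Omega> (?p j) (?P j)" for j by (rule sobolev_mult_cutoff[OF \<Omega>(1) d F \<psi>])
  have lp: "L2_lim \<Omega> ?p ?q" by (rule limF[OF sobolevD(1)[OF d]])
  have lP: "L2_lim \<Omega> (\<lambda>j. ?P j k) (?Q k)" for k by (rule L2_lim_add[OF limF[OF sobolevD(2)[OF d]] limDH])
  have sq: "sobolev \<Omega> ?q ?Q" by (rule sobolev_lim[OF \<Omega> sp lp lP])
  then show "?q \<in> H1 \<Omega>" unfolding H1_iff_sobolev by blast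
  assume e: "e > 0"
  have "(\<lambda>j. (LINT x|lebesgue_on \<Omega>. (cmod (?p j x - ?q x))\<^sup>2) + (\<Sum>k\<in>UNIV. LINT x|lebesgue_on \<Omega>. (cmod (?P j k x - ?Q k x))\<^sup>2)) \<longlonglongrightarrow> 0 + (\<Sum>k\<in>(UNIV::'n set). 0)"
    by (intro tendsto_add tendsto_sum L2_limD(3) lp lP)
  then have "(\<lambda>j. (H1_norm \<Omega> (\<lambda>x. ?p j x - ?q x))\<^sup>2) \<longlonglongrightarrow> 0"
    unfolding H1_norm_eq[OF \<Omega>(1) sobolev_diff[OF \<Omega>(1) sp sq]] by simp
  from order_tendstoD(2)[OF this e] obtain j where "(H1_norm \<Omega> (\<lambda>x. ?p j x - ?q x))\<^sup>2 < e"
    unfolding eventually_sequentially by blast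
  moreover have "?p j \<in> H1 \<Omega>" using sp unfolding H1_iff_sobolev by blast
  ultimately show "\<exists>\<psi>\<in>test_functions \<Omega>. (\<lambda>x. D x * of_real (F (\<psi> x))) \<in> H1 \<Omega> \<and>
      (H1_norm \<Omega> (\<lambda>x. D x * of_real (F (\<psi> x)) - D x * of_real (F (z x))))\<^sup>2 < e"
    using \<psi> by blast
qed

text \<open>Completeness of \<open>H1\<close> for a series whose pointwise sum is already known: the
  \<open>L2\<close> sum agrees with it a.e., so the given representative, continuous in the
  application, is itself in \<open>H1\<close>.\<close>

lemma H1_series:
  assumes \<Omega>: "open \<Omega>" "bounded \<Omega>" and q: "\<And>n. q n \<in> H1 \<Omega>"
    and small: "\<And>n. (H1_norm \<Omega> (q n))\<^sup>2 \<le> (1/4)^n"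
    and sums: "\<And>x. x \<in> \<Omega> \<Longrightarrow> (\<lambda>n. q n x) sums s x"
  shows "s \<in> H1 \<Omega>"
proof -
  obtain g where g: "\<And>n. sobolev \<Omega> (q n) (g n)"
    using q unfolding H1_iff_sobolev by metis
  obtain s' where s': "L2_lim \<Omega> (\<lambda>n x. \<Sum>i<n. q i x) s'" "AE x in lebesgue_on \<Omega>. (\<lambda>n. q n x) sums s' x"
    by (rule L2_series[OF sobolevD(1)[OF g] order_trans[OF H1_norm_le(1)[OF \<Omega>(1) g] small]])
  have "\<exists>h. L2_lim \<Omega> (\<lambda>n x. \<Sum>i<n. g i k x) h" for k
    by (rule L2_series[where f = "\<lambda>n. g n k", OF sobolevD(2)[OF g] order_trans[OF H1_norm_le(2)[OF \<Omega>(1) g] small]]) blast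
  then obtain h where h: "\<And>k. L2_lim \<Omega> (\<lambda>n x. \<Sum>i<n. g i k x) (h k)" by metis
  have "sobolev \<Omega> (\<lambda>x. \<Sum>i<n. q i x) (\<lambda>k x. \<Sum>i<n. g i k x)" for n
  proof (induction n)
    case 0
    show ?case using sobolev_smooth[OF \<Omega> smooth_const[of 0]] by simp
  next
    case (Suc n)
    show ?case using sobolev_add[OF \<Omega>(1) Suc g[of n]] by simp
  qed
  then have "sobolev \<Omega> s' h" by (rule sobolev_lim[OF \<Omega> _ s'(1) h])
  moreover have "AE x in lebesgue_on \<Omega>. x \<in> \<Omega>" by (intro AE_I2) (simp add: space_restrict_space)
  with s'(2) have "AE x in lebesgue_on \<Omega>. s' x = s x"
    by eventually_elim (use sums sums_unique2 in blast)
  ultimately show ?thesis using sobolev_cong_AE[OF \<Omega>(1)] H1_iff_sobolev by blast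
qed

section \<open>Functions with prescribed boundary values\<close>

text \<open>\<open>F\<close> and \<open>F'\<close> of test functions are 1 outside a compact set. Replacing \<open>z\<close> and \<open>z'\<close> by
  approximating test functions turns the product \<open>D F(z) F'(z') = 0\<close> into a product that is
  small in \<open>H1\<close> and equals \<open>D\<close> near the boundary.\<close>

lemma H1_cutoff_pair:
  fixes \<Omega> :: "(real^'n::finite) set"
  assumes \<Omega>: "open \<Omega>" "bounded \<Omega>" and D: "D \<in> H1 \<Omega>" "\<And>x. x \<in> \<Omega> \<Longrightarrow> cmod (D x) \<le> B"
    and F: "cutoff TYPE('n) F H" "F 0 = 1" and z: "z \<in> H1_0 \<Omega>"
    and F': "cutoff TYPE('n) F' H'" "F' 0 = 1" and z': "z' \<in> H1_0 \<Omega>"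
    and vanish: "\<And>x. x \<in> \<Omega> \<Longrightarrow> D x * of_real (F (z x)) * of_real (F' (z' x)) = 0" and e: "e > 0"
  obtains q K where "q \<in> H1 \<Omega>" "(H1_norm \<Omega> q)\<^sup>2 \<le> e" "compact K" "K \<subseteq> \<Omega>" "\<And>x. x \<notin> K \<Longrightarrow> q x = D x"
    "\<And>x. cmod (q x) \<le> cmod (D x)" "continuous_on \<Omega> D \<Longrightarrow> continuous_on \<Omega> q"
proof -
  have le: "cmod (w * of_real (F t)) \<le> cmod w" "cmod (w * of_real (F' t)) \<le> cmod w" for w t
    using cutoffD(4,5)[OF F(1), of t] cutoffD(4,5)[OF F'(1), of t] by (auto simp: norm_mult mult_left_le)
  \<comment> \<open>The cutoffs are exchanged one at a time. Since
    \<open>D' * F(\<psi>) = E * F'(z')\<close>, the two errors telescope to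
    \<open>q - D * F(z) * F'(z')\<close>, which is \<open>q\<close> by \<open>vanish\<close>. Each
    squared error is below \<open>e / 4\<close>, because the squared triangle inequality doubles
    both.\<close>
  define D' where "D' x = D x * of_real (F' (z' x))" for x
  have D': "D' \<in> H1 \<Omega>" unfolding D'_def by (rule H1_mult_cutoff(1)[OF \<Omega> D z' F'(1)])
  have D'B: "cmod (D' x) \<le> B" if "x \<in> \<Omega>" for x
    unfolding D'_def using order_trans[OF le(2) D(2)[OF that]] .
  obtain \<psi> where \<psi>: "\<psi> \<in> test_functions \<Omega>" "(\<lambda>x. D' x * of_real (F (\<psi> x))) \<in> H1 \<Omega>"
    "(H1_norm \<Omega> (\<lambda>x. D' x * of_real (F (\<psi> x)) - D' x * of_real (F (z x))))\<^sup>2 < e / 4"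
    using H1_mult_cutoff(2)[OF \<Omega> D' D'B z F(1), of "e / 4"] e by auto
  define E where "E x = D x * of_real (F (\<psi> x))" for x
  obtain d where "sobolev \<Omega> D d" using D(1) H1_iff_sobolev by blast
  from sobolev_mult_cutoff[OF \<Omega>(1) this F(1) \<psi>(1)] have E: "E \<in> H1 \<Omega>"
    unfolding E_def H1_iff_sobolev by blast
  have EB: "cmod (E x) \<le> B" if "x \<in> \<Omega>" for x
    unfolding E_def using order_trans[OF le(1) D(2)[OF that]] .
  obtain \<psi>' where \<psi>': "\<psi>' \<in> test_functions \<Omega>" "(\<lambda>x. E x * of_real (F' (\<psi>' x))) \<in> H1 \<Omega>"
    "(H1_norm \<Omega> (\<lambda>x. E x * of_real (F' (\<psi>' x)) - E x * of_real (F' (z' x))))\<^sup>2 < e / 4"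
    using H1_mult_cutoff(2)[OF \<Omega> E EB z' F'(1), of "e / 4"] e by auto
  define q where "q x = E x * of_real (F' (\<psi>' x))" for x
  have Ez: "(\<lambda>x. E x * of_real (F' (z' x))) \<in> H1 \<Omega>" by (rule H1_mult_cutoff(1)[OF \<Omega> E EB z' F'(1)])
  have D'z: "(\<lambda>x. D' x * of_real (F (z x))) \<in> H1 \<Omega>" by (rule H1_mult_cutoff(1)[OF \<Omega> D' D'B z F(1)])
  obtain K1 where K1: "compact K1" "K1 \<subseteq> \<Omega>" "\<And>x. x \<notin> K1 \<Longrightarrow> \<psi> x = 0"
    by (rule test_functions_support[OF \<psi>(1)]) blast
  obtain K2 where K2: "compact K2" "K2 \<subseteq> \<Omega>" "\<And>x. x \<notin> K2 \<Longrightarrow> \<psi>' x = 0"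
    by (rule test_functions_support[OF \<psi>'(1)]) blast
  show thesis
  proof (rule that[of q "K1 \<union> K2"])
    show "q \<in> H1 \<Omega>" using \<psi>'(2) by (simp add: q_def[abs_def])
    let ?a = "\<lambda>x. q x - E x * of_real (F' (z' x))"
    let ?b = "\<lambda>x. D' x * of_real (F (\<psi> x)) - D' x * of_real (F (z x))"
    have ab: "?a \<in> H1 \<Omega>" "?b \<in> H1 \<Omega>"
      by (intro H1_diff \<Omega>(1) \<open>q \<in> H1 \<Omega>\<close> Ez \<psi>(2) D'z)+
    have eq: "?a x + ?b x = q x" if "x \<in> \<Omega>" for x
      using vanish[OF that] by (simp add: E_def D'_def mult.commute mult.left_commute)
    have "(H1_norm \<Omega> q)\<^sup>2 = (H1_norm \<Omega> (\<lambda>x. ?a x + ?b x))\<^sup>2"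
      by (rule H1_norm_cong[OF \<Omega>(1) \<open>q \<in> H1 \<Omega>\<close>]) (rule eq[symmetric])
    also have "\<dots> \<le> 2 * (H1_norm \<Omega> ?a)\<^sup>2 + 2 * (H1_norm \<Omega> ?b)\<^sup>2"
      by (rule H1_norm_add[OF \<Omega>(1) ab])
    also have "\<dots> \<le> e" using \<psi>(3) \<psi>'(3) by (simp add: q_def)
    finally show "(H1_norm \<Omega> q)\<^sup>2 \<le> e" .
    show "compact (K1 \<union> K2)" "K1 \<union> K2 \<subseteq> \<Omega>" using K1 K2 by (auto intro: compact_Un)
    show "q x = D x" if "x \<notin> K1 \<union> K2" for x
      using that K1(3)[of x] K2(3)[of x] F(2) F'(2) by (simp add: q_def E_def)
    show "cmod (q x) \<le> cmod (D x)" for x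
      unfolding q_def E_def using order_trans[OF le(2) le(1)] .
    show "continuous_on \<Omega> q" if "continuous_on \<Omega> D"
      unfolding q_def E_def
      by (intro continuous_on_mult that smooth_continuous_on cutoffD(6)[OF F(1)] cutoffD(6)[OF F'(1)]
          test_functionsD(1)[OF \<psi>(1)] test_functionsD(1)[OF \<psi>'(1)])
  qed
qed

text \<open>The increments \<open>v (n + 1) - v n\<close> are replaced by functions \<open>q n\<close> which differ from them only on
  compact sets: near the boundary the partial sums of \<open>v 0 + (\<Sum>n. q n)\<close> still agree with \<open>v n\<close>, and the
  series converges in \<open>H1\<close> although the \<open>v n\<close> need not.\<close>

lemma H1_glue_approximations:
  fixes \<Omega> :: "(real^'n::finite) set" and v :: "nat \<Rightarrow> real^'n \<Rightarrow> complex"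
  assumes \<Omega>: "open \<Omega>" "bounded \<Omega>" and \<Phi>0: "continuous_on UNIV \<Phi>0"
    and v: "\<And>n. v n \<in> H1 \<Omega>" "\<And>n. continuous_on \<Omega> (v n)"
    and near: "\<And>n x. x \<in> \<Omega> \<Longrightarrow> cmod (v n x - \<Phi>0 x) \<le> c * (1/2)^n"
    and cut: "\<And>n e. e > 0 \<Longrightarrow> \<exists>q K. q \<in> H1 \<Omega> \<and> (H1_norm \<Omega> q)\<^sup>2 \<le> e \<and> continuous_on \<Omega> q \<and> compact K \<and> K \<subseteq> \<Omega> \<and>
      (\<forall>x. x \<notin> K \<longrightarrow> q x = v (Suc n) x - v n x) \<and> (\<forall>x. cmod (q x) \<le> cmod (v (Suc n) x - v n x))"
  shows "\<exists>\<Phi>. continuous_on (closure \<Omega>) \<Phi> \<and> \<Phi> \<in> H1 \<Omega> \<and> (\<forall>x\<in>frontier \<Omega>. \<Phi> x = \<Phi>0 x)"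
proof -
  have "\<forall>n. \<exists>q K. q \<in> H1 \<Omega> \<and> (H1_norm \<Omega> q)\<^sup>2 \<le> (1/4)^n \<and> continuous_on \<Omega> q \<and> compact K \<and> K \<subseteq> \<Omega> \<and>
      (\<forall>x. x \<notin> K \<longrightarrow> q x = v (Suc n) x - v n x) \<and> (\<forall>x. cmod (q x) \<le> cmod (v (Suc n) x - v n x))"
    by (intro allI cut) simp
  then obtain q K where q: "\<And>n. q n \<in> H1 \<Omega>" "\<And>n. (H1_norm \<Omega> (q n))\<^sup>2 \<le> (1/4)^n" "\<And>n. continuous_on \<Omega> (q n)"
    and K: "\<And>n. compact (K n)" "\<And>n. K n \<subseteq> \<Omega>" and qv: "\<And>n x. x \<notin> K n \<Longrightarrow> q n x = v (Suc n) x - v n x"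
    and qle: "\<And>n x. cmod (q n x) \<le> cmod (v (Suc n) x - v n x)"
    by metis
  \<comment> \<open>Both \<open>v n\<close> and \<open>v (Suc n)\<close> lie within
    \<open>c * (1/2)^n\<close> of \<open>\<Phi>0\<close>, so their difference, and with it
    \<open>q n\<close>, is at most twice that.\<close>
  define M where "M n = 2 * c * (1/2)^n" for n :: nat
  have qM: "cmod (q n x) \<le> M n" if x: "x \<in> \<Omega>" for n x
  proof -
    have "0 \<le> c" using order_trans[OF norm_ge_zero near[OF x, of 0]] by simp
    then have "c * (1/2)^Suc n \<le> c * (1/2)^n" by (intro mult_left_mono power_decreasing) auto
    moreover have "cmod (v (Suc n) x - v n x) \<le> cmod (v (Suc n) x - \<Phi>0 x) + cmod (v n x - \<Phi>0 x)"
      using norm_triangle_ineq4[of "v (Suc n) x - \<Phi>0 x" "v n x - \<Phi>0 x"] by simp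
    ultimately show ?thesis
      using near[OF x, of n] near[OF x, of "Suc n"] qle[of n x] by (simp add: M_def)
  qed
  have sM: "summable M" unfolding M_def by (intro summable_mult summable_geometric) simp
  have tail: "(\<Sum>n. M (n + N)) = 4 * c * (1/2)^N" for N
  proof -
    have "(\<lambda>n. M (n + N)) = (\<lambda>n. 2 * c * (1/2)^N * (1/2)^n)" by (auto simp: M_def power_add)
    then show ?thesis by (simp only: suminf_mult[OF summable_geometric[of "1/2::real"]] suminf_geometric) (simp add: suminf_mult suminf_geometric)
  qed
  define s where "s x = (\<Sum>n. q n x)" for x
  have sq: "summable (\<lambda>n. q n x)" if "x \<in> \<Omega>" for x
    by (rule summable_comparison_test'[OF sM, of 0]) (simp add: qM that)
  have sH: "s \<in> H1 \<Omega>"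
    by (rule H1_series[OF \<Omega> q(1,2)]) (auto simp: s_def intro: summable_sums sq)
  have "uniform_limit \<Omega> (\<lambda>n x. \<Sum>i<n. q i x) s sequentially"
    unfolding s_def using qM sM by (intro Weierstrass_m_test)
  then have sc: "continuous_on \<Omega> s"
    by (rule uniform_limit_theorem[rotated]) (auto intro!: always_eventually continuous_on_sum q(3))
  define \<Phi> where "\<Phi> x = (if x \<in> \<Omega> then v 0 x + s x else \<Phi>0 x)" for x
  \<comment> \<open>Off the first \<open>N\<close> compact sets the partial sum telescopes to
    \<open>v N\<close>, which contributes \<open>c * (1/2)^N\<close>; the tail of the majorants
    \<open>M\<close> contributes \<open>4 * c * (1/2)^N\<close>.\<close>
  have close: "cmod (\<Phi> x - \<Phi>0 x) \<le> 5 * c * (1/2)^N" if x: "x \<in> \<Omega>" and xK: "\<And>n. n < N \<Longrightarrow> x \<notin> K n" for N x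
  proof -
    have "v 0 x + (\<Sum>n<N. q n x) = v N x"
      using xK sum_lessThan_telescope[of "\<lambda>n. v n x" N] by (simp add: qv)
    moreover have "s x = (\<Sum>n. q (n + N) x) + (\<Sum>n<N. q n x)"
      unfolding s_def by (rule suminf_split_initial_segment[OF sq[OF x]])
    moreover have "cmod (\<Sum>n. q (n + N) x) \<le> (\<Sum>n. M (n + N))"
      using sM qM[OF x] by (intro norm_suminf_le) auto
    ultimately have eq: "\<Phi> x - \<Phi>0 x = (v N x - \<Phi>0 x) + (\<Sum>n. q (n + N) x)"
      and "cmod (\<Sum>n. q (n + N) x) \<le> 4 * c * (1/2)^N"
      using x by (simp_all add: \<Phi>_def tail algebra_simps)
    then show ?thesis
      unfolding eq using near[OF x, of N] norm_triangle_ineq[of "v N x - \<Phi>0 x" "\<Sum>n. q (n + N) x"] by linarith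
  qed
  have "continuous_on (closure \<Omega>) \<Phi>"
    unfolding continuous_on_eq_continuous_within
  proof
    fix x assume x: "x \<in> closure \<Omega>"
    show "continuous (at x within closure \<Omega>) \<Phi>"
    proof (cases "x \<in> \<Omega>")
      case True
      have "continuous_on \<Omega> \<Phi>"
        by (rule continuous_on_eq[OF continuous_on_add[OF v(2)[of 0] sc]]) (simp add: \<Phi>_def)
      then have "isCont \<Phi> x" using True \<Omega>(1) continuous_on_eq_continuous_at by blast
      then show ?thesis by (rule continuous_at_imp_continuous_at_within)
    next
      case False
      show ?thesis
        unfolding continuous_within
      proof (rule tendstoI)
        fix e :: real assume e: "e > 0"
        have "(\<lambda>N. 5 * c * (1/2)^N) \<longlonglongrightarrow> 5 * c * 0"
          by (intro tendsto_mult tendsto_const LIMSEQ_power_zero) simp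
        then have "\<forall>\<^sub>F N in sequentially. 5 * c * (1/2)^N < e / 2"
          using e by (intro order_tendstoD(2)) auto
        then obtain N where N: "5 * c * (1/2)^N < e / 2" unfolding eventually_sequentially by blast
        \<comment> \<open>Finitely many compact subsets of \<open>\<Omega>\<close> stay away from a
          point outside \<open>\<Omega>\<close>, so a whole neighbourhood of \<open>x\<close>
          satisfies the premise of \<open>close\<close>. Its points off \<open>\<Omega>\<close> are
          harmless, since there \<open>\<Phi>\<close> is \<open>\<Phi>0\<close>.\<close>
        have "compact (\<Union>n<N. K n)" using K(1) by (intro compact_UN) auto
        then have op: "open (- (\<Union>n<N. K n))" using compact_imp_closed open_Compl by blast
        have "x \<in> - (\<Union>n<N. K n)" using False K(2) by blast
        with op have 1: "\<forall>\<^sub>F y in at x within closure \<Omega>. y \<in> - (\<Union>n<N. K n)"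
          by (rule eventually_at_in_open'[THEN filter_leD[OF at_le[OF subset_UNIV]]])
        have "(\<Phi>0 \<longlongrightarrow> \<Phi>0 x) (at x within closure \<Omega>)"
          using \<Phi>0 continuous_on_subset[of UNIV \<Phi>0 "closure \<Omega>"] x by (simp add: continuous_on_def)
        then have 2: "\<forall>\<^sub>F y in at x within closure \<Omega>. dist (\<Phi>0 y) (\<Phi>0 x) < e / 2"
          using e by (intro tendstoD) auto
        show "\<forall>\<^sub>F y in at x within closure \<Omega>. dist (\<Phi> y) (\<Phi> x) < e"
          using 1 2
        proof eventually_elim
          case (elim y)
          have \<Phi>x: "\<Phi> x = \<Phi>0 x" using False by (simp add: \<Phi>_def)
          have "dist (\<Phi> y) (\<Phi>0 y) \<le> e / 2"
          proof (cases "y \<in> \<Omega>")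
            case True
            then have "cmod (\<Phi> y - \<Phi>0 y) \<le> 5 * c * (1/2)^N" using elim(1) by (intro close) auto
            then show ?thesis using N by (simp add: dist_norm)
          qed (use e in \<open>simp add: \<Phi>_def\<close>)
          then show ?case
            unfolding \<Phi>x using elim(2) dist_triangle[of "\<Phi> y" "\<Phi>0 x" "\<Phi>0 y"] by linarith
        qed
      qed
    qed
  qed
  moreover have "\<Phi> \<in> H1 \<Omega>"
    by (rule H1_cong[OF \<Omega>(1) H1_add[OF \<Omega>(1) v(1)[of 0] sH]]) (simp add: \<Phi>_def)
  moreover have "\<Phi> x = \<Phi>0 x" if "x \<in> frontier \<Omega>" for x
    using that \<Omega>(1) by (simp add: \<Phi>_def frontier_def interior_open)
  ultimately show ?thesis by blast
qed

text \<open>Linearity turns the supremum bound into a Lipschitz estimate. With \<open>e = 0\<close>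
  it shows that the values on \<open>\<Omega>\<close> depend only on the boundary values.\<close>

lemma perron_operator_diff_le:
  assumes T: "perron_operator \<Omega> a b c c0 T"
  obtains C where "C \<ge> 0" "\<And>\<phi> \<psi> e x. continuous_on (frontier \<Omega>) \<phi> \<Longrightarrow> continuous_on (frontier \<Omega>) \<psi> \<Longrightarrow> bounded \<Omega> \<Longrightarrow>
     (\<And>y. y \<in> frontier \<Omega> \<Longrightarrow> cmod (\<phi> y - \<psi> y) \<le> e) \<Longrightarrow> x \<in> \<Omega> \<Longrightarrow> cmod (T \<phi> x - T \<psi> x) \<le> C * e"
proof -
  obtain C where C: "\<And>\<phi> x. continuous_on (frontier \<Omega>) \<phi> \<Longrightarrow> x \<in> \<Omega> \<Longrightarrow>
      cmod (T \<phi> x) \<le> C * (SUP y\<in>frontier \<Omega>. cmod (\<phi> y))"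
    using T unfolding perron_operator_def by blast
  have add: "T (\<lambda>y. \<phi> y + \<psi> y) x = T \<phi> x + T \<psi> x"
    if "continuous_on (frontier \<Omega>) \<phi>" "continuous_on (frontier \<Omega>) \<psi>" "x \<in> \<Omega>" for \<phi> \<psi> x
    using T that unfolding perron_operator_def by blast
  have scale: "T (\<lambda>y. \<alpha> * \<phi> y) x = \<alpha> * T \<phi> x"
    if "continuous_on (frontier \<Omega>) \<phi>" "x \<in> \<Omega>" for \<alpha> \<phi> x
    using T that unfolding perron_operator_def by blast
  show thesis
  \<comment> \<open>The constant in \<open>perron_operator\<close> carries no sign, but enlarging
    the supremum to \<open>e\<close> needs a nonnegative factor.\<close>
  proof (rule that[of "max 0 C"])
    fix \<phi> \<psi> e x
    assume \<phi>: "continuous_on (frontier \<Omega>) \<phi>" and \<psi>: "continuous_on (frontier \<Omega>) \<psi>" and "bounded \<Omega>"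
      and le: "\<And>y. y \<in> frontier \<Omega> \<Longrightarrow> cmod (\<phi> y - \<psi> y) \<le> e" and x: "x \<in> \<Omega>"
    \<comment> \<open>A nonempty bounded set is not the whole space and so has a boundary point; the
      supremum estimates need a nonempty index set.\<close>
    have ne: "frontier \<Omega> \<noteq> {}"
      using x \<open>bounded \<Omega>\<close> not_bounded_UNIV unfolding frontier_eq_empty by blast
    have m: "continuous_on (frontier \<Omega>) (\<lambda>y. (-1) * \<psi> y)" using \<psi> by (intro continuous_intros)
    let ?\<delta> = "\<lambda>y. \<phi> y + (-1) * \<psi> y"
    have \<delta>: "continuous_on (frontier \<Omega>) ?\<delta>" by (intro continuous_on_add \<phi> m)
    have "T \<phi> x - T \<psi> x = T ?\<delta> x" unfolding add[OF \<phi> m x] scale[OF \<psi> x] by simp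
    then have "cmod (T \<phi> x - T \<psi> x) \<le> C * (SUP y\<in>frontier \<Omega>. cmod (?\<delta> y))" using C[OF \<delta> x] by simp
    also have "\<dots> \<le> max 0 C * (SUP y\<in>frontier \<Omega>. cmod (?\<delta> y))"
    proof (rule mult_right_mono)
      have "bdd_above ((\<lambda>y. cmod (?\<delta> y)) ` frontier \<Omega>)" using le by (intro bdd_aboveI[of _ e]) auto
      moreover obtain y where "y \<in> frontier \<Omega>" using ne by blast
      ultimately show "0 \<le> (SUP y\<in>frontier \<Omega>. cmod (?\<delta> y))"
        by (intro cSUP_upper2[of _ _ y]) auto
    qed simp
    also have "\<dots> \<le> max 0 C * e"
      using ne le by (intro mult_left_mono cSUP_least) auto
    finally show "cmod (T \<phi> x - T \<psi> x) \<le> max 0 C * e" .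
  qed simp
qed

theorem corollary1p4:
  fixes \<Omega> :: "(real^'n::finite) set"
    and a :: "'n \<Rightarrow> 'n \<Rightarrow> real^'n \<Rightarrow> real"
    and b :: "'n \<Rightarrow> real^'n \<Rightarrow> complex"
    and c :: "'n \<Rightarrow> real^'n \<Rightarrow> real"
    and c0 :: "real^'n \<Rightarrow> complex"
    and \<mu> :: real
    and T :: "(real^'n \<Rightarrow> complex) \<Rightarrow> real^'n \<Rightarrow> complex"
    and \<phi> :: "real^'n \<Rightarrow> complex"
  assumes "CARD('n) \<ge> 2"
    and "open \<Omega>" and "bounded \<Omega>"
    and "\<And>k l. a k l \<in> borel_measurable (lebesgue_on \<Omega>)" and "\<And>k l. bounded (a k l ` \<Omega>)"
    and "\<And>k. b k \<in> borel_measurable (lebesgue_on \<Omega>)" and "\<And>k. bounded (b k ` \<Omega>)"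
    and "\<And>k. c k \<in> borel_measurable (lebesgue_on \<Omega>)" and "\<And>k. bounded (c k ` \<Omega>)"
    and "c0 \<in> borel_measurable (lebesgue_on \<Omega>)" and "bounded (c0 ` \<Omega>)"
    and "0 < \<mu>" and "\<mu> \<le> 1"
    and "\<And>x (\<xi> :: complex^'n). x \<in> \<Omega> \<Longrightarrow>
           Re (\<Sum>k\<in>UNIV. \<Sum>l\<in>UNIV. of_real (a k l x) * \<xi> $ k * cnj (\<xi> $ l)) \<ge> \<mu> * (norm \<xi>)\<^sup>2"
    and "\<And>u. u \<in> H1_0 \<Omega> \<Longrightarrow> harmonic \<Omega> a b c c0 u \<Longrightarrow> AE x in lebesgue_on \<Omega>. u x = 0"
    and "perron_operator \<Omega> a b c c0 T"
    and "continuous_on (frontier \<Omega>) \<phi>"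
  shows "T \<phi> \<in> H1 \<Omega> \<longleftrightarrow>
         (\<exists>\<Phi>. continuous_on (closure \<Omega>) \<Phi> \<and> \<Phi> \<in> H1 \<Omega> \<and> (\<forall>x\<in>frontier \<Omega>. \<Phi> x = \<phi> x))"
proof
  note \<Omega> = \<open>open \<Omega>\<close> \<open>bounded \<Omega>\<close>
  note T = \<open>perron_operator \<Omega> a b c c0 T\<close> and \<phi> = \<open>continuous_on (frontier \<Omega>) \<phi>\<close>
  obtain C where C: "C \<ge> 0" "\<And>\<phi> \<psi> e x. continuous_on (frontier \<Omega>) \<phi> \<Longrightarrow> continuous_on (frontier \<Omega>) \<psi> \<Longrightarrow>
     (\<And>y. y \<in> frontier \<Omega> \<Longrightarrow> cmod (\<phi> y - \<psi> y) \<le> e) \<Longrightarrow> x \<in> \<Omega> \<Longrightarrow> cmod (T \<phi> x - T \<psi> x) \<le> C * e"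
    using perron_operator_diff_le[OF T] \<Omega>(2) by metis
  have TH: "(\<lambda>x. \<Phi> x - T \<Phi> x) \<in> H1_0 \<Omega>" if "continuous_on (closure \<Omega>) \<Phi>" "\<Phi> \<in> H1 \<Omega>" for \<Phi>
    using T that unfolding perron_operator_def by blast
  have Tc: "continuous_on \<Omega> (T \<psi>)" "bounded (T \<psi> ` \<Omega>)" if "continuous_on (frontier \<Omega>) \<psi>" for \<psi>
    using T that unfolding perron_operator_def by blast+
  {
    assume "\<exists>\<Phi>. continuous_on (closure \<Omega>) \<Phi> \<and> \<Phi> \<in> H1 \<Omega> \<and> (\<forall>x\<in>frontier \<Omega>. \<Phi> x = \<phi> x)"
    then obtain \<Phi> where \<Phi>: "continuous_on (closure \<Omega>) \<Phi>" "\<Phi> \<in> H1 \<Omega>" "\<And>x. x \<in> frontier \<Omega> \<Longrightarrow> \<Phi> x = \<phi> x"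
      by blast
    have c\<Phi>: "continuous_on (frontier \<Omega>) \<Phi>"
      using \<Phi>(1) by (rule continuous_on_subset) (simp add: frontier_def)
    have "(\<lambda>x. \<Phi> x - T \<Phi> x) \<in> H1 \<Omega>" using TH[OF \<Phi>(1,2)] by (simp add: H1_0_def)
    from H1_diff[OF \<Omega>(1) \<Phi>(2) this] have "T \<Phi> \<in> H1 \<Omega>" by simp
    then show "T \<phi> \<in> H1 \<Omega>"
    proof (rule H1_cong[OF \<Omega>(1)])
      fix x assume "x \<in> \<Omega>"
      \<comment> \<open>\<open>T\<close> acts on total functions, and \<open>\<Phi>\<close> and
        \<open>\<phi>\<close> agree only on the boundary; the Lipschitz estimate with
        \<open>e = 0\<close> identifies the two solutions on \<open>\<Omega>\<close>.\<close>
      then have "cmod (T \<Phi> x - T \<phi> x) \<le> C * 0" using \<Phi>(3) by (intro C(2) c\<Phi> \<phi>) auto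
      then show "T \<Phi> x = T \<phi> x" by simp
    qed
  next
    define u where "u = T \<phi>"
    assume "T \<phi> \<in> H1 \<Omega>"
    then have u: "u \<in> H1 \<Omega>" by (simp add: u_def)
    obtain \<Phi>0 where \<Phi>0: "continuous_on UNIV \<Phi>0" "\<And>x. x \<in> frontier \<Omega> \<Longrightarrow> \<Phi>0 x = \<phi> x"
      using Tietze_unbounded[OF \<phi>, of UNIV] by auto
    define r :: "nat \<Rightarrow> real" where "r n = (1/2)^n" for n
    have r: "r n > 0" for n by (simp add: r_def)
    \<comment> \<open>The continuous extension need not be in \<open>H1\<close>, so the property of
      \<open>T\<close> on \<open>H1\<close> data is applied to polynomials, which are in
      \<open>H1\<close> because \<open>\<Omega>\<close> is bounded.\<close>
    have "\<exists>p. polynomial_function p \<and> (\<forall>x\<in>closure \<Omega>. cmod (\<Phi>0 x - p x) < r n)" for n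
      using \<Omega>(2) \<Phi>0(1) by (intro Stone_Weierstrass_polynomial_function r) (auto intro: continuous_on_subset)
    then obtain P where P: "\<And>n. polynomial_function (P n)" "\<And>n x. x \<in> closure \<Omega> \<Longrightarrow> cmod (\<Phi>0 x - P n x) < r n"
      by metis
    have Ps: "smooth (P n)" for n by (rule smooth_polynomial[OF P(1)])
    have PH: "P n \<in> H1 \<Omega>" for n by (rule H1_smooth[OF \<Omega> Ps])
    define z where "z n x = P n x - T (P n) x" for n x
    have z: "z n \<in> H1_0 \<Omega>" for n
      unfolding z_def by (rule TH[OF smooth_continuous_on[OF Ps] PH])
    \<comment> \<open>Here \<open>u - P n = (u - T (P n)) - z n\<close>, and the boundary data
      \<open>\<phi>\<close> and \<open>P n\<close> differ by at most \<open>r n\<close>.\<close>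
    have uz: "cmod (u x - P n x) \<le> C * r n + cmod (z n x)" if "x \<in> \<Omega>" for n x
    proof -
      have "cmod (\<phi> y - P n y) \<le> r n" if "y \<in> frontier \<Omega>" for y
        using P(2)[of y n] \<Phi>0(2)[OF that] that by (simp add: frontier_def)
      then have "cmod (u x - T (P n) x) \<le> C * r n"
        unfolding u_def using that by (intro C(2) \<phi> smooth_continuous_on Ps)
      then show ?thesis
        using norm_triangle_ineq4[of "u x - T (P n) x" "z n x"] by (simp add: z_def)
    qed
    define F where "F n t = plateau ((cmod t / r n)\<^sup>2)" for n t
    define G where "G n t = hat ((cmod t / r n)\<^sup>2)" for n t
    have "\<exists>H. cutoff TYPE('n) (F n) H" for n
      unfolding F_def using plateau_has_derivative smooth_plateau plateau_bounds plateau_ge_2 r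
      by (intro cutoff_radial) auto
    then obtain HF where F: "\<And>n. cutoff TYPE('n) (F n) (HF n)" by metis
    have "\<exists>H. cutoff TYPE('n) (G n) H" for n
      unfolding G_def using hat_has_derivative smooth_hat hat_nonneg hat_le_1 hat_ge_1 r
      by (intro cutoff_radial) auto
    then obtain HG where G: "\<And>n. cutoff TYPE('n) (G n) (HG n)" by metis
    have G0: "G n 0 = 1" for n by (simp add: G_def hat_0)
    have GF: "F n t = 1" if "G n t \<noteq> 0" for n t
      using that hat_ge_1 plateau_le_1 unfolding F_def G_def by (meson linorder_linear)
    \<comment> \<open>Where \<open>z n\<close> is small, so is \<open>u - P n\<close>, and \<open>v n\<close> is \<open>u\<close>; where \<open>z n\<close> is large, \<open>v n\<close> is \<open>P n\<close>.\<close>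
    define v where "v n x = P n x + (u x - P n x) * of_real (F n (z n x))" for n x
    \<comment> \<open>The constant is \<open>C + 2 + 1\<close>: where the cutoff is nonzero,
      \<open>cmod (z n x) < 2 * r n\<close>, so \<open>u - P n\<close> is at most
      \<open>(C + 2) * r n\<close> by \<open>uz\<close>; the polynomial adds
      \<open>r n\<close>.\<close>
    have near: "cmod (v n x - \<Phi>0 x) \<le> (C + 3) * r n" if x: "x \<in> \<Omega>" for n x
    proof -
      have "cmod ((u x - P n x) * of_real (F n (z n x))) \<le> (C + 2) * r n"
      proof (cases "F n (z n x) = 0")
        case True
        then show ?thesis using C(1) r[of n] by simp
      next
        case False
        then have "(cmod (z n x) / r n)\<^sup>2 < 2\<^sup>2"
          using plateau_ge_2[of "(cmod (z n x) / r n)\<^sup>2"] unfolding F_def by fastforce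
        then have "cmod (z n x) / r n < 2" by (rule power2_less_imp_less) simp
        then have "cmod (u x - P n x) \<le> (C + 2) * r n"
          using uz[OF x, of n] r[of n] by (simp add: pos_divide_less_eq algebra_simps)
        moreover have "\<bar>F n (z n x)\<bar> \<le> 1" using cutoffD(4,5)[OF F, of n "z n x"] by simp
        ultimately show ?thesis
          unfolding norm_mult norm_of_real using mult_mono[of "cmod (u x - P n x)" "(C + 2) * r n" "\<bar>F n (z n x)\<bar>" 1] C(1) r[of n]
          by simp
      qed
      moreover have "cmod (P n x - \<Phi>0 x) \<le> r n"
        using P(2)[of x n] x closure_subset[of \<Omega>] by (auto simp: norm_minus_commute intro: less_imp_le)
      ultimately show ?thesis
        using norm_triangle_ineq[of "(u x - P n x) * of_real (F n (z n x))" "P n x - \<Phi>0 x"]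
        by (simp add: v_def algebra_simps)
    qed
    have uP: "(\<lambda>x. u x - P n x) \<in> H1 \<Omega>" for n by (rule H1_diff[OF \<Omega>(1) u PH])
    \<comment> \<open>Multiplication by a cutoff of an \<open>H1_0\<close> function requires a
      bounded factor; \<open>T \<phi>\<close> is bounded by definition of the Perron operator and
      \<open>P n\<close> by compactness of the closure.\<close>
    have uP_le: "\<exists>B. \<forall>x\<in>\<Omega>. cmod (u x - P n x) \<le> B" for n
    proof -
      obtain B where B: "\<And>x. x \<in> \<Omega> \<Longrightarrow> cmod (u x) \<le> B"
        using Tc(2)[OF \<phi>] unfolding u_def bounded_iff by blast
      have "bounded (P n ` closure \<Omega>)"
        using \<Omega>(2) by (intro compact_imp_bounded compact_continuous_image smooth_continuous_on Ps) auto
      then obtain B' where B': "\<And>x. x \<in> closure \<Omega> \<Longrightarrow> cmod (P n x) \<le> B'" unfolding bounded_iff by blast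
      have "cmod (u x - P n x) \<le> B + B'" if "x \<in> \<Omega>" for x
        using norm_triangle_ineq4[of "u x" "P n x"] B[OF that] B'[of x] that closure_subset[of \<Omega>] by fastforce
      then show ?thesis by blast
    qed
    have vH: "v n \<in> H1 \<Omega>" for n
    proof -
      obtain B where "\<And>x. x \<in> \<Omega> \<Longrightarrow> cmod (u x - P n x) \<le> B" using uP_le by blast
      from H1_add[OF \<Omega>(1) PH H1_mult_cutoff(1)[OF \<Omega> uP this z F]] show ?thesis
        unfolding v_def by blast
    qed
    have vc: "continuous_on \<Omega> (v n)" for n
    proof -
      have "continuous_on \<Omega> (z n)"
        unfolding z_def by (intro continuous_on_diff smooth_continuous_on Ps Tc(1))
      then have "continuous_on \<Omega> (\<lambda>x. F n (z n x))"
        by (rule continuous_on_compose2[OF cutoffD(1)[OF F]]) simp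
      then show ?thesis
        unfolding v_def u_def by (intro continuous_intros smooth_continuous_on Ps Tc(1) \<phi>)
    qed
    have "\<exists>\<Phi>. continuous_on (closure \<Omega>) \<Phi> \<and> \<Phi> \<in> H1 \<Omega> \<and> (\<forall>x\<in>frontier \<Omega>. \<Phi> x = \<Phi>0 x)"
    proof (rule H1_glue_approximations[OF \<Omega> \<Phi>0(1) vH vc])
      show "cmod (v n x - \<Phi>0 x) \<le> (C + 3) * (1/2)^n" if "x \<in> \<Omega>" for n x
        using near[OF that, of n] by (simp add: r_def)
      fix n and e :: real assume e: "e > 0"
      let ?D = "\<lambda>x. v (Suc n) x - v n x"
      have DB: "cmod (?D x) \<le> (C + 3) * r (Suc n) + (C + 3) * r n" if "x \<in> \<Omega>" for x
        using norm_triangle_ineq4[of "v (Suc n) x - \<Phi>0 x" "v n x - \<Phi>0 x"] near[OF that, of n] near[OF that, of "Suc n"]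
        by simp
      \<comment> \<open>The narrower cutoffs \<open>G\<close> are used here, not the
        \<open>F\<close> that build \<open>v\<close>: a nonzero \<open>G n\<close> lies where
        \<open>F n\<close> is 1, so if both factors survive, both approximations equal
        \<open>u\<close> and cancel.\<close>
      have vanish: "?D x * of_real (G n (z n x)) * of_real (G (Suc n) (z (Suc n) x)) = 0" for x
      proof (cases "G n (z n x) = 0 \<or> G (Suc n) (z (Suc n) x) = 0")
        case False
        then have "v n x = u x" "v (Suc n) x = u x" by (simp_all add: v_def GF)
        then show ?thesis by simp
      qed auto
      obtain q K where "q \<in> H1 \<Omega>" "(H1_norm \<Omega> q)\<^sup>2 \<le> e" "compact K" "K \<subseteq> \<Omega>" "\<And>x. x \<notin> K \<Longrightarrow> q x = ?D x"
        "\<And>x. cmod (q x) \<le> cmod (?D x)" "continuous_on \<Omega> ?D \<Longrightarrow> continuous_on \<Omega> q"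
        by (rule H1_cutoff_pair[OF \<Omega> H1_diff[OF \<Omega>(1) vH vH] DB G G0 z G G0 z vanish e]) blast+
      moreover have "continuous_on \<Omega> ?D" by (intro continuous_on_diff vc)
      ultimately show "\<exists>q K. q \<in> H1 \<Omega> \<and> (H1_norm \<Omega> q)\<^sup>2 \<le> e \<and> continuous_on \<Omega> q \<and> compact K \<and> K \<subseteq> \<Omega> \<and>
          (\<forall>x. x \<notin> K \<longrightarrow> q x = ?D x) \<and> (\<forall>x. cmod (q x) \<le> cmod (?D x))"
        by blast
    qed
    then show "\<exists>\<Phi>. continuous_on (closure \<Omega>) \<Phi> \<and> \<Phi> \<in> H1 \<Omega> \<and> (\<forall>x\<in>frontier \<Omega>. \<Phi> x = \<phi> x)"
      using \<Phi>0(2) by (metis (no_types))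
  }
qed

end
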